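(* Let $E/\mathbb{Q}$ be an elliptic curve with conductor $N_E$, and let $K$ be a quadratic number field such that $E_\mathrm{tors}(\mathbb{Q}) \neq E_\mathrm{tors}(K)$. If $p \in \{5,7\}$ ramifies in $K$, then $p \mid N_E$.
   Context: For a number field $F$, $E_\mathrm{tors}(F)$ denotes the torsion subgroup of $E(F)$. *)

theory Defs
  imports
    Complex_Main
    "HOL-Library.FuncSet"
    "HOL-Computational_Algebra.Computational_Algebra"
    "HOL-Algebra.Algebra"
    "HOL-Algebra.Algebraic_Closure_Type"
begin

section \<open>Weierstrass curves and their points\<close>

text \<open>The curve \<open>y\<^sup>2 + a1 x y + a3 y = x\<^sup>3 + a2 x\<^sup>2 + a4 x + a6\<close>.\<close>

datatype 'a weierstrass =
  Weierstrass (a1: 'a) (a2: 'a) (a3: 'a) (a4: 'a) (a6: 'a)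

definition b2 :: "'a::field weierstrass \<Rightarrow> 'a" where
  "b2 E = a1 E ^ 2 + 4 * a2 E"

definition b4 :: "'a::field weierstrass \<Rightarrow> 'a" where
  "b4 E = 2 * a4 E + a1 E * a3 E"

definition b6 :: "'a::field weierstrass \<Rightarrow> 'a" where
  "b6 E = a3 E ^ 2 + 4 * a6 E"

definition b8 :: "'a::field weierstrass \<Rightarrow> 'a" where
  "b8 E = a1 E ^ 2 * a6 E + 4 * a2 E * a6 E - a1 E * a3 E * a4 E + a2 E * a3 E ^ 2 - a4 E ^ 2"

definition c4 :: "'a::field weierstrass \<Rightarrow> 'a" where
  "c4 E = b2 E ^ 2 - 24 * b4 E"

definition discriminant :: "'a::field weierstrass \<Rightarrow> 'a" where
  "discriminant E = - (b2 E ^ 2 * b8 E) - 8 * b4 E ^ 3 - 27 * b6 E ^ 2 + 9 * b2 E * b4 E * b6 E"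

definition elliptic_curve :: "'a::field weierstrass \<Rightarrow> bool" where
  "elliptic_curve E \<longleftrightarrow> discriminant E \<noteq> 0"

definition base_change :: "rat weierstrass \<Rightarrow> 'a::field_char_0 weierstrass" where
  "base_change E = map_weierstrass of_rat E"

datatype 'a point = Infinity | Affine 'a 'a

definition on_curve :: "'a::field weierstrass \<Rightarrow> 'a \<Rightarrow> 'a \<Rightarrow> bool" where
  "on_curve E x y \<longleftrightarrow>
     y ^ 2 + a1 E * x * y + a3 E * y = x ^ 3 + a2 E * x ^ 2 + a4 E * x + a6 E"

text \<open>The chord-tangent law: the line through the two points has slope \<open>l\<close>, and the
  third point of intersection is reflected by \<open>(x, y) \<mapsto> (x, - y - a1 x - a3)\<close>.\<close>

fun point_add :: "'a::field weierstrass \<Rightarrow> 'a point \<Rightarrow> 'a point \<Rightarrow> 'a point" where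
  "point_add E Infinity Q = Q"
| "point_add E P Infinity = P"
| "point_add E (Affine x1 y1) (Affine x2 y2) =
     (if x1 = x2 \<and> y1 + y2 + a1 E * x2 + a3 E = 0 then Infinity
      else
        let l = (if x1 = x2
                 then (3 * x1 ^ 2 + 2 * a2 E * x1 + a4 E - a1 E * y1) / (2 * y1 + a1 E * x1 + a3 E)
                 else (y2 - y1) / (x2 - x1));
            x3 = l ^ 2 + a1 E * l - a2 E - x1 - x2
        in Affine x3 (- (y1 + l * (x3 - x1)) - a1 E * x3 - a3 E))"

text \<open>\<open>E(F)\<close> for a subfield \<open>F\<close> of the ambient field type.\<close>

definition point_group :: "'a::field weierstrass \<Rightarrow> 'a set \<Rightarrow> 'a point monoid" where
  "point_group E F =
     \<lparr> carrier = insert Infinity {Affine x y | x y. x \<in> F \<and> y \<in> F \<and> on_curve E x y},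
       monoid.mult = point_add E,
       one = Infinity \<rparr>"

definition torsion :: "('a, 'b) monoid_scheme \<Rightarrow> 'a set" where
  "torsion G = {x \<in> carrier G. \<exists>n::nat. n > 0 \<and> x [^]\<^bsub>G\<^esub> n = \<one>\<^bsub>G\<^esub>}"

definition E_tors :: "rat weierstrass \<Rightarrow> 'a::field_char_0 set \<Rightarrow> 'a point set" where
  "E_tors E F = torsion (point_group (base_change E) F)"


section \<open>Number fields\<close>

text \<open>Number fields are subfields of an arbitrary ambient field type of characteristic
  zero. The prime field \<open>\<rat>\<close> is then literally a subfield of each of them, and \<open>E(\<rat>)\<close> a
  subset of \<open>E(K)\<close>.\<close>

abbreviation ambient :: "'a::field ring" where
  "ambient \<equiv> ring_of_type_algebra"

definition quadratic_field :: "'a::field_char_0 set \<Rightarrow> bool" where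
  "quadratic_field K \<longleftrightarrow> subfield K ambient \<and> ring.dimension ambient 2 \<rat> K"

definition ring_of_integers :: "'a::field_char_0 set \<Rightarrow> 'a ring" where
  "ring_of_integers K = ambient\<lparr>carrier := {x \<in> K. algebraic_int x}\<rparr>"

text \<open>\<open>p\<close> ramifies in \<open>K\<close> if the square of some prime ideal divides the ideal generated by
  \<open>p\<close>. Products and powers of ideals are those of the library structure \<open>ideals_set\<close>.\<close>

definition ramifies_in :: "nat \<Rightarrow> 'a::field_char_0 set \<Rightarrow> bool" where
  "ramifies_in p K \<longleftrightarrow>
     (let R = ring_of_integers K in
      \<exists>P J. primeideal P R \<and> ideal J R \<and>
        PIdl\<^bsub>R\<^esub> (of_nat p) = (P [^]\<^bsub>ideals_set R\<^esub> (2::nat)) \<otimes>\<^bsub>ideals_set R\<^esub> J)"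


section \<open>Minimal models over the rationals\<close>

text \<open>The coefficients after the substitution \<open>x = u\<^sup>2 x' + r\<close>, \<open>y = u\<^sup>3 y' + u\<^sup>2 s x' + t\<close>.\<close>

definition change_of_variables ::
  "'a::field \<Rightarrow> 'a \<Rightarrow> 'a \<Rightarrow> 'a \<Rightarrow> 'a weierstrass \<Rightarrow> 'a weierstrass" where
  "change_of_variables u r s t E = Weierstrass
     ((a1 E + 2 * s) / u)
     ((a2 E - s * a1 E + 3 * r - s ^ 2) / u ^ 2)
     ((a3 E + r * a1 E + 2 * t) / u ^ 3)
     ((a4 E - s * a3 E + 2 * r * a2 E - (t + r * s) * a1 E + 3 * r ^ 2 - 2 * s * t) / u ^ 4)
     ((a6 E + r * a4 E + r ^ 2 * a2 E + r ^ 3 - t * a3 E - t ^ 2 - r * t * a1 E) / u ^ 6)"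

definition isomorphic_curves :: "'a::field weierstrass \<Rightarrow> 'a weierstrass \<Rightarrow> bool" where
  "isomorphic_curves E E' \<longleftrightarrow> (\<exists>u r s t. u \<noteq> 0 \<and> E' = change_of_variables u r s t E)"

text \<open>The \<open>p\<close>-adic valuation on the rationals; meaningful for nonzero arguments only.\<close>

definition padic_val :: "nat \<Rightarrow> rat \<Rightarrow> int" where
  "padic_val p q = int (multiplicity (int p) (fst (quotient_of q)))
                 - int (multiplicity (int p) (snd (quotient_of q)))"

definition padic_integral :: "nat \<Rightarrow> rat \<Rightarrow> bool" where
  "padic_integral p q \<longleftrightarrow> q = 0 \<or> padic_val p q \<ge> 0"

definition vanishes_mod :: "nat \<Rightarrow> rat \<Rightarrow> bool" where
  "vanishes_mod p q \<longleftrightarrow> q = 0 \<or> padic_val p q > 0"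

definition integral_model :: "nat \<Rightarrow> rat weierstrass \<Rightarrow> rat weierstrass \<Rightarrow> bool" where
  "integral_model p E W \<longleftrightarrow>
     isomorphic_curves E W \<and> (\<forall>a \<in> set_weierstrass W. padic_integral p a)"

definition minimal_model :: "nat \<Rightarrow> rat weierstrass \<Rightarrow> rat weierstrass \<Rightarrow> bool" where
  "minimal_model p E W \<longleftrightarrow>
     integral_model p E W \<and>
     (\<forall>W'. integral_model p E W' \<longrightarrow>
        padic_val p (discriminant W) \<le> padic_val p (discriminant W'))"

text \<open>The reduction of a \<open>p\<close>-minimal model is a Weierstrass cubic over the field of \<open>p\<close>
  elements. It is nonsingular iff its discriminant is nonzero; otherwise its unique singular
  point is a node iff its \<open>c4\<close> is nonzero, and a cusp iff its \<open>c4\<close> is zero. The choice of a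
  minimal model is immaterial, since two of them differ by a substitution with \<open>u\<close> a
  \<open>p\<close>-adic unit, which multiplies \<open>discriminant\<close> and \<open>c4\<close> by units.\<close>

definition good_reduction :: "nat \<Rightarrow> rat weierstrass \<Rightarrow> bool" where
  "good_reduction p E \<longleftrightarrow>
     (\<exists>W. minimal_model p E W \<and> \<not> vanishes_mod p (discriminant W))"

definition multiplicative_reduction :: "nat \<Rightarrow> rat weierstrass \<Rightarrow> bool" where
  "multiplicative_reduction p E \<longleftrightarrow>
     (\<exists>W. minimal_model p E W \<and> vanishes_mod p (discriminant W) \<and> \<not> vanishes_mod p (c4 W))"


section \<open>The conductor\<close>

text \<open>The wild part of the exponent of the conductor at \<open>p\<close> is
  \[ \delta_p = \sum_{i \ge 1} \frac{|G_i|}{|G_0|} \dim_{F_l} (E[l] / E[l]^{G_i}) \]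
  where \<open>l\<close> is a prime different from \<open>p\<close> and \<open>G_i\<close> are the ramification groups, in the lower
  numbering, of the extension of the \<open>p\<close>-adic numbers generated by \<open>E[l]\<close>. They are computed
  here in the number field \<open>L\<close> generated by \<open>E[l]\<close> inside the complex numbers, at a prime \<open>P\<close>
  of \<open>L\<close> above \<open>p\<close>: restriction identifies the Galois group of the completion at \<open>P\<close> with the
  decomposition group of \<open>P\<close> and preserves the ramification filtration. Neither the choice of
  \<open>P\<close> (all choices are conjugate) nor that of \<open>l\<close> changes \<open>\<delta>_p\<close>.\<close>

definition torsion_points :: "nat \<Rightarrow> rat weierstrass \<Rightarrow> complex point set" where
  "torsion_points l E =
     (let G = point_group (base_change E) UNIV in
      {P \<in> carrier G. P [^]\<^bsub>G\<^esub> l = \<one>\<^bsub>G\<^esub>})"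

definition division_field :: "nat \<Rightarrow> rat weierstrass \<Rightarrow> complex set" where
  "division_field l E = generate_field ambient (\<Union>P \<in> torsion_points l E. set_point P)"

text \<open>All field automorphisms fix the rationals. Intersecting with \<open>extensional L\<close> makes them
  determined by their values on \<open>L\<close>, so that they can be counted.\<close>

definition galois_group :: "'a::field_char_0 set \<Rightarrow> ('a \<Rightarrow> 'a) set" where
  "galois_group L =
     ring_iso (ambient\<lparr>carrier := L\<rparr>) (ambient\<lparr>carrier := L\<rparr>) \<inter> extensional L"

definition prime_above :: "nat \<Rightarrow> 'a::field_char_0 set \<Rightarrow> 'a set" where
  "prime_above p L = (SOME P. primeideal P (ring_of_integers L) \<and> of_nat p \<in> P)"

definition ramification_group :: "'a::field_char_0 set \<Rightarrow> 'a set \<Rightarrow> nat \<Rightarrow> ('a \<Rightarrow> 'a) set" where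
  "ramification_group L P i =
     {\<sigma> \<in> galois_group L. \<forall>x \<in> carrier (ring_of_integers L).
        \<sigma> x - x \<in> P [^]\<^bsub>ideals_set (ring_of_integers L)\<^esub> Suc i}"

definition fixed_torsion_points ::
  "nat \<Rightarrow> rat weierstrass \<Rightarrow> (complex \<Rightarrow> complex) set \<Rightarrow> complex point set" where
  "fixed_torsion_points l E H =
     {P \<in> torsion_points l E. \<forall>\<sigma> \<in> H. map_point \<sigma> P = P}"

text \<open>The dimension of a quotient \<open>V / W\<close> of finite vector spaces over the field of \<open>l\<close>
  elements is the logarithm to the base \<open>l\<close> of \<open>|V| / |W|\<close>. Only finitely many terms of the
  series are nonzero.\<close>

definition wild_part_at :: "nat \<Rightarrow> nat \<Rightarrow> rat weierstrass \<Rightarrow> real" where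
  "wild_part_at l p E =
     (let L = division_field l E;
          G = ramification_group L (prime_above p L)
      in suminf (\<lambda>i. real (card (G (Suc i))) / real (card (G 0)) *
             log (real l) (real (card (torsion_points l E)) /
                           real (card (fixed_torsion_points l E (G (Suc i)))))))"

text \<open>The real number \<open>wild_part_at l p E\<close> is in fact a nonnegative integer.\<close>

definition wild_part :: "nat \<Rightarrow> rat weierstrass \<Rightarrow> nat" where
  "wild_part p E = nat \<lfloor>wild_part_at (if p = 2 then 3 else 2) p E\<rfloor>"

definition conductor_exponent :: "nat \<Rightarrow> rat weierstrass \<Rightarrow> nat" where
  "conductor_exponent p E =
     (if good_reduction p E then 0
      else if multiplicative_reduction p E then 1
      else 2 + wild_part p E)"

text \<open>The product has only finitely many factors, since the exponent vanishes at all primes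
  of good reduction.\<close>

definition conductor :: "rat weierstrass \<Rightarrow> nat" where
  "conductor E = (\<Prod>p | Factorial_Ring.prime p \<and> conductor_exponent p E \<noteq> 0. p ^ conductor_exponent p E)"

end

theory Submission
  imports Defs "HOL-Library.Set_Algebras"
begin

text \<open>Let \<open>E\<close> have good reduction at \<open>p > 3\<close>, let \<open>p\<close> ramify in \<open>K\<close>, and let \<open>P\<close> be a torsion point of
  \<open>E(K)\<close> with conjugate \<open>P'\<close>. Conjugation is trivial on the residue field of the prime above \<open>p\<close>, so
  \<open>P - P'\<close> is a torsion point in the kernel of reduction. With the parameter \<open>t = x / y\<close> and a short
  Weierstrass equation, which exists because \<open>p > 3\<close>, one has
  \<open>t (P + Q) = t (P) + t (Q) + O(\<pi>^(5 n))\<close> for points of the kernel with parameters in \<open>(\<pi>^n)\<close>. As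
  \<open>p\<close> has valuation 2, the kernel of reduction has no point of prime order, and \<open>P = P'\<close> is rational.

  Associativity of the chord-tangent law is obtained by embedding the points into the ideal class
  group of the coordinate ring: the ideals \<open>I_P\<close> of points satisfy \<open>I_P I_Q = g I_(P+Q)\<close>, and no
  \<open>I_P\<close> is principal because no function on the curve has a single simple pole at infinity.\<close>

text \<open>The exponent 5 decides: a point of prime order q in the kernel, with parameter of
  valuation exactly k, satisfies 5 k \<le> v(q) + k \<le> 2 + k, which is impossible for k \<ge> 1.
  No completion, formal group or reduction map is built; a valuation on K and explicit chord
  formulas in the coordinates x / y and 1 / y give all congruences. That P - P' lies in the kernel
  is read off from its abscissa l^2 - x - x': if the slope l were integral, P would reduce to a
  singular point. A second obstacle is that ramification is defined through ideals of the ring of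
  integers. It is resolved by writing K as Q(\<delta>) with \<delta>^2 = d and v_p(d) equal to 0 or
  1. If v_p(d) = 0, the ring Z_(p)[\<delta>] is reduced modulo p, which excludes a square factor of
  (p). So v_p(d) = 1, and the p-adic valuation of the norm is an explicit valuation on K that takes
  the value 2 at p.\<close>

definition short_weierstrass :: "'a::field \<Rightarrow> 'a \<Rightarrow> 'a weierstrass" where
  "short_weierstrass A B = Weierstrass 0 0 0 A B"

lemma short_weierstrass_sel [simp]:
  "a1 (short_weierstrass A B) = 0" "a2 (short_weierstrass A B) = 0"
  "a3 (short_weierstrass A B) = 0" "a4 (short_weierstrass A B) = A"
  "a6 (short_weierstrass A B) = B"
  by (simp_all add: short_weierstrass_def)

section \<open>Chords and tangents on a short Weierstrass curve\<close>

lemma on_curve_short: "on_curve (short_weierstrass A B) x y \<longleftrightarrow> y\<^sup>2 = x ^ 3 + A * x + B"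
  by (simp add: on_curve_def)

fun on_curve_point :: "'a::field weierstrass \<Rightarrow> 'a point \<Rightarrow> bool" where
  "on_curve_point E Infinity = True"
| "on_curve_point E (Affine x y) = on_curve E x y"

fun point_neg :: "'a::field point \<Rightarrow> 'a point" where
  "point_neg Infinity = Infinity"
| "point_neg (Affine x y) = Affine x (- y)"

lemma point_add_Infinity_right [simp]: "point_add E P Infinity = P"
  by (cases P) auto

text \<open>The coefficients of \<open>T\<^sup>2\<close>, \<open>T\<close> and \<open>1\<close> in
  \<open>T\<^sup>3 + A T + B - (l T + m)\<^sup>2 = (T - x1) (T - x2) (T - x3)\<close>.\<close>

definition line_meets :: "'a::field \<Rightarrow> 'a \<Rightarrow> 'a \<Rightarrow> 'a \<Rightarrow> 'a \<Rightarrow> 'a \<Rightarrow> 'a \<Rightarrow> bool" where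
  "line_meets A B l m x1 x2 x3 \<longleftrightarrow>
     x1 + x2 + x3 = l\<^sup>2 \<and> x1 * x2 + x1 * x3 + x2 * x3 = A - 2 * l * m \<and> x1 * x2 * x3 = m\<^sup>2 - B"

lemma line_meetsD:
  assumes "line_meets A B l m x1 x2 x3"
  shows "x1 + x2 + x3 = l\<^sup>2" "x1 * x2 + x1 * x3 + x2 * x3 = A - 2 * l * m" "x1 * x2 * x3 = m\<^sup>2 - B"
  using assms by (simp_all add: line_meets_def)

text \<open>Vieta's relations for the cubic cut out by the chord or tangent. Later proofs work with
  \<open>line_meets\<close> instead of the division formula for the slope; the clause for
  \<open>x1 = x2\<close> keeps the tangent slope, which would otherwise have to be recovered from
  the double root.\<close>

lemma point_add_short_cases:
  fixes A B :: "'a::field_char_0"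
  defines "E \<equiv> short_weierstrass A B"
  assumes "on_curve E x1 y1" "on_curve E x2 y2"
  obtains (opposite) "x1 = x2" "y2 = - y1" "point_add E (Affine x1 y1) (Affine x2 y2) = Infinity"
  | (line) l m x3 where "line_meets A B l m x1 x2 x3" "y1 = l * x1 + m" "y2 = l * x2 + m"
      "x1 = x2 \<Longrightarrow> y1 = y2 \<and> y1 \<noteq> 0 \<and> 2 * y1 * l = 3 * x1\<^sup>2 + A"
      "point_add E (Affine x1 y1) (Affine x2 y2) = Affine x3 (- (l * x3 + m))"
proof -
  have c1: "y1\<^sup>2 = x1 ^ 3 + A * x1 + B" and c2: "y2\<^sup>2 = x2 ^ 3 + A * x2 + B"
    using assms by (simp_all add: on_curve_short)
  consider "x1 = x2" "y1 + y2 = 0" | "x1 = x2" "y1 + y2 \<noteq> 0" | "x1 \<noteq> x2" by blast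
  then show thesis
  proof cases
    case 1
    then show thesis
      by (intro opposite) (auto simp: E_def add_eq_0_iff)
  next
    case 2
    have "(y1 - y2) * (y1 + y2) = 0"
      using c1 c2 2 by (simp add: algebra_simps power2_eq_square)
    then have y: "y2 = y1" using 2 by auto
    then have y0: "y1 \<noteq> 0" using 2 by auto
    define l where "l = (3 * x1\<^sup>2 + A) / (2 * y1)"
    have l: "2 * y1 * l = 3 * x1\<^sup>2 + A" using y0 by (simp add: l_def)
    define m where "m = y1 - l * x1"
    define x3 where "x3 = l\<^sup>2 - x1 - x2"
    have m: "y1 = l * x1 + m" by (simp add: m_def)
    have e2: "x1 * x1 + x1 * x3 + x1 * x3 = A - 2 * l * m"
      using l 2 unfolding m_def x3_def by (simp add: algebra_simps power2_eq_square)
    have A: "A = 2 * y1 * l - 3 * x1\<^sup>2" using l by simp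
    have "B = y1\<^sup>2 - x1 ^ 3 - A * x1" using c1 by simp
    then have "x1 * x1 * x3 = m\<^sup>2 - B"
      using 2 by (simp add: A m_def x3_def algebra_simps power2_eq_square power3_eq_cube)
    then have lm: "line_meets A B l m x1 x2 x3"
      using e2 2 by (simp add: line_meets_def x3_def)
    show thesis
    proof (rule line[OF lm m])
      show "y2 = l * x2 + m" using m 2 y by simp
      show "y1 = y2 \<and> y1 \<noteq> 0 \<and> 2 * y1 * l = 3 * x1\<^sup>2 + A" using y y0 l by simp
      show "point_add E (Affine x1 y1) (Affine x2 y2) = Affine x3 (- (l * x3 + m))"
      proof -
        have "(if x1 = x2 then (3 * x1\<^sup>2 + 2 * a2 E * x1 + a4 E - a1 E * y1) / (2 * y1 + a1 E * x1 + a3 E)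
            else (y2 - y1) / (x2 - x1)) = l"
          using 2 by (simp add: E_def l_def)
        moreover have "\<not> (x1 = x2 \<and> y1 + y2 + a1 E * x2 + a3 E = 0)"
          using 2 by (simp add: E_def)
        ultimately show ?thesis
          unfolding point_add.simps Let_def by (simp only: if_False) (simp add: E_def x3_def m_def algebra_simps)
      qed
    qed
  next
    case 3
    define l where "l = (y2 - y1) / (x2 - x1)"
    have l: "l * (x2 - x1) = y2 - y1" using 3 by (simp add: l_def)
    define m where "m = y1 - l * x1"
    define x3 where "x3 = l\<^sup>2 - x1 - x2"
    have m: "y1 = l * x1 + m" by (simp add: m_def)
    have m2: "y2 = l * x2 + m" using l by (simp add: m_def algebra_simps)
    \<comment> \<open>The difference of the two curve equations is divisible by
      \<open>x1 - x2\<close>; the quotient is the second Vieta relation, and the equation at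
      \<open>x1\<close> then yields the third.\<close>
    have "A * (x1 - x2) = y1\<^sup>2 - y2\<^sup>2 - (x1 ^ 3 - x2 ^ 3)"
      using c1 c2 by (simp add: algebra_simps)
    then have "A * x1 = A * x2 + ((l * x1 + m)\<^sup>2 - (l * x2 + m)\<^sup>2 - (x1 ^ 3 - x2 ^ 3))"
      unfolding m m2 by (simp add: algebra_simps)
    then have "(x1 - x2) * (x1 * x2 + x1 * x3 + x2 * x3 - (A - 2 * l * m)) = 0"
      unfolding x3_def by (simp add: algebra_simps power2_eq_square power3_eq_cube)
    then have e2: "x1 * x2 + x1 * x3 + x2 * x3 = A - 2 * l * m" using 3 by simp
    have A: "A = x1 * x2 + x1 * x3 + x2 * x3 + 2 * l * m" using e2 by simp
    have "B = (l * x1 + m)\<^sup>2 - x1 ^ 3 - A * x1" using c1 m by simp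
    then have "x1 * x2 * x3 = m\<^sup>2 - B"
      unfolding A x3_def by (simp add: algebra_simps power2_eq_square power3_eq_cube)
    then have lm: "line_meets A B l m x1 x2 x3"
      using e2 by (simp add: line_meets_def x3_def)
    show thesis
    proof (rule line[OF lm m m2])
      show "point_add E (Affine x1 y1) (Affine x2 y2) = Affine x3 (- (l * x3 + m))"
        using 3 by (simp add: E_def Let_def l_def[symmetric] x3_def[symmetric])
          (simp add: x3_def m_def algebra_simps)
    qed (use 3 in auto)
  qed
qed

text \<open>By Vieta \<open>x3\<close> is the third root of T^3 + A T + B - (l T + m)^2.\<close>

lemma line_meets_on_curve:
  assumes "line_meets A B l m x1 x2 x3"
  shows "on_curve (short_weierstrass A B) x3 (l * x3 + m)"
proof -
  note e = line_meetsD[OF assms]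
  have A: "A = x1 * x2 + x1 * x3 + x2 * x3 + 2 * l * m" using e(2) by simp
  have B: "B = m\<^sup>2 - x1 * x2 * x3" using e(3) by simp
  have "l\<^sup>2 * x3\<^sup>2 = (x1 + x2 + x3) * x3\<^sup>2" using e(1) by simp
  then have "(l * x3 + m)\<^sup>2 = x3 ^ 3 + A * x3 + B"
    unfolding A B by (simp add: algebra_simps power2_eq_square power3_eq_cube)
  then show ?thesis by (simp add: on_curve_short)
qed

lemma on_curve_short_neg:
  "on_curve (short_weierstrass A B) x (- y) \<longleftrightarrow> on_curve (short_weierstrass A B) x y"
  by (simp add: on_curve_short)

lemma on_curve_point_neg:
  "on_curve_point (short_weierstrass A B) (point_neg P) \<longleftrightarrow> on_curve_point (short_weierstrass A B) P"
  by (cases P) (auto simp: on_curve_short)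

lemma on_curve_point_add:
  fixes A B :: "'a::field_char_0"
  assumes "on_curve_point (short_weierstrass A B) P" "on_curve_point (short_weierstrass A B) Q"
  shows "on_curve_point (short_weierstrass A B) (point_add (short_weierstrass A B) P Q)"
proof (cases P; cases Q)
  fix x1 y1 x2 y2 assume PQ: "P = Affine x1 y1" "Q = Affine x2 y2"
  then show ?thesis
    using assms point_add_short_cases[of A B x1 y1 x2 y2] line_meets_on_curve
    by (metis on_curve_point.simps on_curve_short_neg)
qed (use assms in auto)

text \<open>Scaling an ideal by g is written as the product with \<open>{g}\<close>, so that scaling
  and ideal multiplication are rearranged by the same laws of set multiplication.\<close>

lemma singleton_mult: "{a} * {b} = {a * b}" for a b :: "'b::field"
  by (simp add: set_times_def)

lemma singleton_mult_mult: "{a} * ({b} * S) = {a * b} * S" for a b :: "'b::field"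
  by (simp only: singleton_mult flip: mult.assoc)

section \<open>Modules over a subring of a field\<close>

locale subring_of_field =
  fixes R :: "'b::field set"
  assumes R_1: "1 \<in> R"
    and R_minus: "a \<in> R \<Longrightarrow> b \<in> R \<Longrightarrow> a - b \<in> R"
    and R_mult: "a \<in> R \<Longrightarrow> b \<in> R \<Longrightarrow> a * b \<in> R"
begin

lemma R_0: "0 \<in> R" using R_minus[OF R_1 R_1] by simp
lemma R_uminus: "a \<in> R \<Longrightarrow> - a \<in> R" using R_minus[OF R_0] by simp
lemma R_add: "a \<in> R \<Longrightarrow> b \<in> R \<Longrightarrow> a + b \<in> R"
  using R_minus[of a "- b"] R_uminus[of b] by simp
lemma R_power: "a \<in> R \<Longrightarrow> a ^ n \<in> R"
  by (induction n) (auto intro: R_1 R_mult)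

text \<open>A fractional ideal is handled through a generating set: the product of two ideals is
  \<open>rspan (S * T)\<close> with the elementwise product of generators, and an equality of ideals
  is an equality of spans.\<close>

inductive_set rspan :: "'b set \<Rightarrow> 'b set" for S where
  zero: "0 \<in> rspan S"
| step: "r \<in> R \<Longrightarrow> s \<in> S \<Longrightarrow> v \<in> rspan S \<Longrightarrow> r * s + v \<in> rspan S"

lemma rspan_base: "s \<in> S \<Longrightarrow> s \<in> rspan S"
  using rspan.step[OF R_1 _ rspan.zero] by simp

lemma rspan_add: "u \<in> rspan S \<Longrightarrow> v \<in> rspan S \<Longrightarrow> u + v \<in> rspan S"
  by (induction rule: rspan.induct) (auto simp: add.assoc intro: rspan.step)

lemma rspan_scale: "u \<in> rspan S \<Longrightarrow> r \<in> R \<Longrightarrow> r * u \<in> rspan S"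
  by (induction rule: rspan.induct)
    (auto simp: distrib_left mult.assoc[symmetric] intro: rspan.zero rspan.step R_mult)

lemma rspan_uminus: "u \<in> rspan S \<Longrightarrow> - u \<in> rspan S"
  using rspan_scale[OF _ R_uminus[OF R_1]] by simp

lemma rspan_diff: "u \<in> rspan S \<Longrightarrow> v \<in> rspan S \<Longrightarrow> u - v \<in> rspan S"
  using rspan_add[OF _ rspan_uminus] by fastforce

lemma rspan_least: "S \<subseteq> rspan T \<Longrightarrow> rspan S \<subseteq> rspan T"
proof
  fix u assume S: "S \<subseteq> rspan T" and "u \<in> rspan S"
  from this(2) show "u \<in> rspan T"
    by (induction rule: rspan.induct) (use S in \<open>auto intro: rspan.zero rspan_add rspan_scale\<close>)
qed

lemma rspan_eqI: "S \<subseteq> rspan T \<Longrightarrow> T \<subseteq> rspan S \<Longrightarrow> rspan S = rspan T"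
  by (intro equalityI rspan_least)

text \<open>This makes the product of ideals independent of the chosen generators, so that known
  ideal equalities can be substituted inside products.\<close>

lemma rspan_mult_subset:
  assumes "S \<subseteq> rspan T" shows "rspan (S * U) \<subseteq> rspan (T * U)"
proof (rule rspan_least, rule subsetI)
  fix a assume "a \<in> S * U"
  then obtain s u where a: "a = s * u" "s \<in> S" "u \<in> U" by (auto simp: set_times_def)
  have "s \<in> rspan T" using a assms by auto
  then have "s * u \<in> rspan (T * U)"
  proof (induction rule: rspan.induct)
    case (step r t v)
    have "r * (t * u) + v * u \<in> rspan (T * U)"
      using step a by (intro rspan.step) auto
    then show ?case by (simp add: algebra_simps)
  qed (auto intro: rspan.zero)
  then show "a \<in> rspan (T * U)" using a by simp
qed

lemma rspan_mult_cong: "rspan S = rspan T \<Longrightarrow> rspan (S * U) = rspan (T * U)"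
  by (intro equalityI rspan_mult_subset) (auto intro: rspan_base)

lemma rspan_mult_cong_right: "rspan S = rspan T \<Longrightarrow> rspan (U * S) = rspan (U * T)"
  using rspan_mult_cong[of S T U] by (simp add: mult.commute)

lemma rspan_mult_cong2: "rspan S = rspan T \<Longrightarrow> rspan U = rspan V \<Longrightarrow> rspan (S * U) = rspan (T * V)"
  using rspan_mult_cong[of S T U] rspan_mult_cong[of U V T] by (simp add: mult.commute)

lemma rspan_singleton: "rspan {g} = (\<lambda>r. r * g) ` R"
proof (intro equalityI subsetI)
  fix u assume "u \<in> rspan {g}"
  then show "u \<in> (\<lambda>r. r * g) ` R"
  proof (induction rule: rspan.induct)
    case zero
    then show ?case using R_0 by force
  next
    case (step r s v)
    then obtain r' where "r' \<in> R" "v = r' * g" by auto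
    then show ?case using step R_add[of r r'] by (auto simp: image_def algebra_simps intro!: bexI[of _ "r + r'"])
  qed
qed (auto intro: rspan_scale rspan_base)

lemma rspan_scale_singleton:
  "rspan ({g} * S) = (\<lambda>u. g * u) ` rspan S"
proof (intro equalityI subsetI)
  fix u assume "u \<in> rspan ({g} * S)"
  then show "u \<in> (\<lambda>u. g * u) ` rspan S"
  proof (induction rule: rspan.induct)
    case zero
    then show ?case by (force intro: rspan.zero)
  next
    case (step r s v)
    then obtain s' v' where "s = g * s'" "s' \<in> S" "v = g * v'" "v' \<in> rspan S"
      by (auto simp: set_times_def)
    then show ?case
      using step rspan.step[of r s' S v'] by (auto simp: image_def algebra_simps intro!: bexI[of _ "r * s' + v'"])
  qed
next
  fix u assume "u \<in> (\<lambda>u. g * u) ` rspan S"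
  then obtain w where "u = g * w" "w \<in> rspan S" by auto
  then show "u \<in> rspan ({g} * S)"
    using rspan_mult_subset[of "{w}" S "{g}"] rspan_base[of "w * g" "{w} * {g}"]
    by (auto simp: mult.commute)
qed

lemma rspan_cancel: "g \<noteq> 0 \<Longrightarrow> rspan ({g} * S) = rspan ({g} * T) \<Longrightarrow> rspan S = rspan T"
  by (simp add: rspan_scale_singleton inj_image_eq_iff inj_on_def)

end

section \<open>The coordinate ring\<close>

definition poly_at :: "'a::field_char_0 poly \<Rightarrow> 'a fls \<Rightarrow> 'a fls" where
  "poly_at a x = poly (map_poly fls_const a) x"

lemma poly_at_simps [simp]:
  "poly_at 0 x = 0" "poly_at 1 x = 1" "poly_at (pCons c a) x = fls_const c + x * poly_at a x"
  by (simp_all add: poly_at_def map_poly_pCons flip: one_pCons)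

lemma poly_at_add: "poly_at (a + b) x = poly_at a x + poly_at b x"
  by (induction a b rule: poly_induct2)
    (auto simp: algebra_simps simp flip: fls_plus_const)

lemma poly_at_smult: "poly_at (smult c a) x = fls_const c * poly_at a x"
  by (induction a) (auto simp: algebra_simps simp flip: fls_const_mult_const)

lemma poly_at_mult: "poly_at (a * b) x = poly_at a x * poly_at b x"
  by (induction a) (auto simp: algebra_simps poly_at_add poly_at_smult)

lemma poly_at_diff: "poly_at (a - b) x = poly_at a x - poly_at b x"
  using poly_at_add[of "a - b" b x] by simp

text \<open>The coordinate ring is realised inside Laurent series in a uniformiser at infinity,
  with a pole of order 2 for \<open>\<xi>\<close> and of order 3 for \<open>\<eta>\<close>.\<close>

locale coordinate_ring =
  fixes A B :: "'a::field_char_0" and \<eta> :: "'a fls"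
  assumes \<eta>_square: "\<eta>\<^sup>2 = (fls_X_intpow (-2)) ^ 3 + fls_const A * fls_X_intpow (-2) + fls_const B"
    and nonsingular: "4 * A ^ 3 + 27 * B\<^sup>2 \<noteq> 0"
begin

definition \<xi> :: "'a fls" where "\<xi> = fls_X_intpow (-2)"

abbreviation k :: "'a \<Rightarrow> 'a fls" where "k \<equiv> fls_const"

lemma \<xi>_nonzero [simp]: "\<xi> \<noteq> 0"
  unfolding \<xi>_def by (rule fls_X_intpow_nonzero)

lemma subdegree_\<xi> [simp]: "fls_subdegree \<xi> = -2"
  by (simp add: \<xi>_def)

lemma \<eta>_eq: "\<eta>\<^sup>2 = \<xi> ^ 3 + k A * \<xi> + k B"
  using \<eta>_square by (simp add: \<xi>_def)

text \<open>No cancellation in Horner's scheme: a constant has order 0, while \<xi> times the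
  nonzero value of the rest has negative order.\<close>

lemma subdegree_poly_at: "a \<noteq> 0 \<Longrightarrow> poly_at a \<xi> \<noteq> 0 \<and> fls_subdegree (poly_at a \<xi>) = - 2 * int (degree a)"
proof (induction a)
  case (pCons c a)
  show ?case
  proof (cases "a = 0")
    case True
    then show ?thesis using pCons by simp
  next
    case False
    then have IH: "poly_at a \<xi> \<noteq> 0" "fls_subdegree (poly_at a \<xi>) = - 2 * int (degree a)"
      using pCons by auto
    then have d: "fls_subdegree (\<xi> * poly_at a \<xi>) = - 2 * int (degree (pCons c a))"
      using False by simp
    have "fls_subdegree (\<xi> * poly_at a \<xi> + k c) = fls_subdegree (\<xi> * poly_at a \<xi>)"
      using IH d False by (intro fls_subdegree_add_eq1) auto
    then have "fls_subdegree (poly_at (pCons c a) \<xi>) = - 2 * int (degree (pCons c a))"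
      using d by (simp add: add.commute)
    moreover from this have "poly_at (pCons c a) \<xi> \<noteq> 0"
      using False by (intro notI) auto
    ultimately show ?thesis by simp
  qed
qed auto

lemma \<eta>_poly: "\<eta> * \<eta> = poly_at [:B, A, 0, 1:] \<xi>"
  using \<eta>_eq by (simp add: algebra_simps power2_eq_square power3_eq_cube)

lemma \<eta>_nonzero [simp]: "\<eta> \<noteq> 0" and subdegree_\<eta> [simp]: "fls_subdegree \<eta> = -3"
proof -
  have *: "poly_at [:B, A, 0, 1:] \<xi> \<noteq> 0" "fls_subdegree (poly_at [:B, A, 0, 1:] \<xi>) = -6"
    using subdegree_poly_at[of "[:B, A, 0, 1:]"] by auto
  then show "\<eta> \<noteq> 0" using \<eta>_poly by auto
  then show "fls_subdegree \<eta> = -3" using fls_subdegree_mult[of \<eta> \<eta>] * \<eta>_poly by auto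
qed

definition R :: "'a fls set" where
  "R = {poly_at a \<xi> + poly_at b \<xi> * \<eta> | a b. True}"

text \<open>The pole orders of the two summands, 2 deg a and 2 deg b + 3, have different parity, so
  the larger one survives.\<close>

lemma subdegree_R:
  assumes "a \<noteq> 0 \<or> b \<noteq> 0"
  shows "poly_at a \<xi> + poly_at b \<xi> * \<eta> \<noteq> 0"
    and "fls_subdegree (poly_at a \<xi> + poly_at b \<xi> * \<eta>) =
      - int (max (if a = 0 then 0 else 2 * degree a) (if b = 0 then 0 else 2 * degree b + 3))"
proof -
  let ?a = "poly_at a \<xi>" and ?b = "poly_at b \<xi> * \<eta>"
  have b: "b \<noteq> 0 \<Longrightarrow> ?b \<noteq> 0 \<and> fls_subdegree ?b = - int (2 * degree b + 3)"
    using subdegree_poly_at[of b] by simp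
  have a: "a \<noteq> 0 \<Longrightarrow> ?a \<noteq> 0 \<and> fls_subdegree ?a = - int (2 * degree a)"
    using subdegree_poly_at[of a] by simp
  consider "a = 0" "b \<noteq> 0" | "b = 0" "a \<noteq> 0" | "a \<noteq> 0" "b \<noteq> 0" using assms by blast
  then have "?a + ?b \<noteq> 0 \<and> fls_subdegree (?a + ?b) =
      - int (max (if a = 0 then 0 else 2 * degree a) (if b = 0 then 0 else 2 * degree b + 3))"
  proof cases
    case 3
    consider "degree a < degree b + 2" | "degree b + 2 \<le> degree a" by linarith
    then show ?thesis
    proof cases
      case 1
      then have "fls_subdegree (?b + ?a) = fls_subdegree ?b"
        using a b 3 by (intro fls_subdegree_add_eq1) auto
      then show ?thesis using a b 3 1 by (auto simp: add.commute)
    next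
      case 2
      then have "fls_subdegree (?a + ?b) = fls_subdegree ?a"
        using a b 3 by (intro fls_subdegree_add_eq1) auto
      then show ?thesis using a b 3 2 by auto
    qed
  qed (use a b in auto)
  then show "?a + ?b \<noteq> 0" "fls_subdegree (?a + ?b) =
      - int (max (if a = 0 then 0 else 2 * degree a) (if b = 0 then 0 else 2 * degree b + 3))"
    by auto
qed

lemma ring_repr_unique:
  assumes "poly_at a \<xi> + poly_at b \<xi> * \<eta> = poly_at c \<xi> + poly_at d \<xi> * \<eta>"
  shows "a = c" "b = d"
proof -
  have "poly_at (a - c) \<xi> + poly_at (b - d) \<xi> * \<eta> = 0"
    using assms by (simp add: poly_at_diff algebra_simps)
  then show "a = c" "b = d" using subdegree_R(1)[of "a - c" "b - d"] by auto
qed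

text \<open>Pole orders are even, or odd and at least 3; the gap at 1 is where the genus of the
  curve enters. For g = 0 the conventional value of \<open>fls_subdegree\<close> is 0.\<close>

lemma subdegree_R_nonpos: "g \<in> R \<Longrightarrow> fls_subdegree g \<le> 0 \<and> fls_subdegree g \<noteq> -1"
proof -
  assume "g \<in> R"
  then obtain a b where g: "g = poly_at a \<xi> + poly_at b \<xi> * \<eta>" by (auto simp: R_def)
  have ne: "- int (max (if a = 0 then 0 else 2 * degree a) (if b = 0 then 0 else 2 * degree b + 3)) \<noteq> - 1"
    unfolding max_def by (cases "a = 0"; cases "b = 0"; simp; presburger)
  show ?thesis
  proof (cases "a \<noteq> 0 \<or> b \<noteq> 0")
    case True
    show ?thesis using ne unfolding g subdegree_R(2)[OF True] by simp
  next
    case False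
    then show ?thesis by (simp add: g)
  qed
qed

lemma R_const_of_subdegree_0:
  assumes "g \<in> R" "g \<noteq> 0" "fls_subdegree g = 0"
  obtains c where "c \<noteq> 0" "g = k c"
proof -
  obtain a b where g: "g = poly_at a \<xi> + poly_at b \<xi> * \<eta>" using assms by (auto simp: R_def)
  have "a \<noteq> 0 \<or> b \<noteq> 0" using assms g by auto
  then have b: "b = 0" and a: "degree a = 0" "a \<noteq> 0"
    using subdegree_R(2)[of a b] assms g by (auto split: if_splits)
  then obtain c where "a = [:c:]" by (metis degree_eq_zeroE)
  then show thesis using that[of c] a b g by auto
qed

sublocale subring_of_field R
proof
  show "1 \<in> R" unfolding R_def by (rule CollectI, rule exI[of _ 1], rule exI[of _ 0]) simp
next
  fix g h assume "g \<in> R" "h \<in> R"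
  then obtain a b c d where gh: "g = poly_at a \<xi> + poly_at b \<xi> * \<eta>" "h = poly_at c \<xi> + poly_at d \<xi> * \<eta>"
    by (auto simp: R_def)
  have "g - h = poly_at (a - c) \<xi> + poly_at (b - d) \<xi> * \<eta>"
    by (simp add: gh poly_at_diff algebra_simps)
  then show "g - h \<in> R" unfolding R_def by blast
  have "g * h = poly_at a \<xi> * poly_at c \<xi> + poly_at b \<xi> * poly_at d \<xi> * (\<eta> * \<eta>)
      + (poly_at a \<xi> * poly_at d \<xi> + poly_at b \<xi> * poly_at c \<xi>) * \<eta>"
    by (simp add: gh algebra_simps)
  also have "\<dots> = poly_at (a * c + b * d * [:B, A, 0, 1:]) \<xi> + poly_at (a * d + b * c) \<xi> * \<eta>"
    by (simp only: poly_at_add poly_at_mult \<eta>_poly)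
  finally show "g * h \<in> R" unfolding R_def by blast
qed

lemma R_\<xi> [simp]: "\<xi> \<in> R" and R_\<eta> [simp]: "\<eta> \<in> R" and R_const [simp]: "k c \<in> R"
proof -
  show "\<xi> \<in> R" unfolding R_def by (rule CollectI, rule exI[of _ "[:0, 1:]"], rule exI[of _ 0]) simp
  show "\<eta> \<in> R" unfolding R_def by (rule CollectI, rule exI[of _ 0], rule exI[of _ 1]) simp
  show "k c \<in> R" unfolding R_def by (rule CollectI, rule exI[of _ "[:c:]"], rule exI[of _ 0]) simp
qed

lemma R_numeral [simp]: "numeral n \<in> R"
  using R_const[of "numeral n"] by simp

lemmas R_closed = R_minus R_mult R_add R_uminus R_power

lemma rspan_const_unit: "k c \<in> rspan S \<Longrightarrow> c \<noteq> 0 \<Longrightarrow> 1 \<in> rspan S"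
  using rspan_scale[of "k c" S "k (1 / c)"] by (simp add: fls_const_mult_const[symmetric] del: fls_const_mult_const) (simp add: fls_const_mult_const)

lemma rspan_const_cancel: "k c * g \<in> rspan S \<Longrightarrow> c \<noteq> 0 \<Longrightarrow> g \<in> rspan S"
  using rspan_scale[of "k c * g" S "k (1 / c)"] by (simp flip: mult.assoc)

section \<open>The ideal of a point\<close>

fun point_gens :: "'a point \<Rightarrow> 'a fls set" where
  "point_gens Infinity = {1}"
| "point_gens (Affine x y) = {\<xi> - k x, \<eta> - k y}"

abbreviation E where "E \<equiv> short_weierstrass A B"

lemma on_curve_E: "on_curve E x y \<longleftrightarrow> y\<^sup>2 = x ^ 3 + A * x + B"
  by (rule on_curve_short)

text \<open>The hypotheses say that a is a double root of T^3 + A T + B, that is, (a, 0) is a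
  singular point. They give B = 2 a^3, and 4 A^3 + 27 B^2 vanishes.\<close>

lemma no_singular_point:
  assumes "B = - (a ^ 3) - A * a" "A = - 3 * a\<^sup>2" shows False
proof -
  have B: "B = 2 * a ^ 3" using assms by (simp add: power2_eq_square power3_eq_cube)
  have "4 * A ^ 3 + 27 * B\<^sup>2 = 0"
    unfolding B assms(2) by (simp add: eval_nat_numeral)
  then show False using nonsingular by simp
qed

text \<open>The function \<xi> - x vanishes exactly at the two opposite points. Since (\<eta> -
  y)(\<eta> + y) is divisible by \<xi> - x, so is each product of generators, and the quotients
  generate the unit ideal.\<close>

lemma point_gens_neg:
  assumes "on_curve E x y"
  shows "rspan (point_gens (Affine x y) * point_gens (Affine x (- y))) = rspan {\<xi> - k x}"
proof -
  define u where "u = \<xi> - k x"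
  \<comment> \<open>This is (f(\<xi>) - f(x)) / (\<xi> - x) for f = T^3 + A T + B.\<close>
  define q where "q = \<xi>\<^sup>2 + k x * \<xi> + k x ^ 2 + k A"
  have kx: "k y ^ 2 = k x ^ 3 + k A * k x + k B"
    using assms on_curve_E by (simp add: fls_const_power[symmetric] fls_plus_const)
  have uq: "(\<eta> - k y) * (\<eta> + k y) = u * q"
    using \<eta>_eq kx by (simp add: u_def q_def algebra_simps power2_eq_square power3_eq_cube)
  have R: "u \<in> R" "q \<in> R" "\<eta> + k y \<in> R" "\<eta> - k y \<in> R"
    by (auto simp: u_def q_def intro!: R_closed)
  have prod: "point_gens (Affine x y) * point_gens (Affine x (- y)) =
      {u} * {u, \<eta> - k y, \<eta> + k y, q}"
    using uq by (auto simp: set_times_def u_def[symmetric] mult.commute)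
  define J where "J = {u, \<eta> - k y, \<eta> + k y, q}"
  have J: "u \<in> rspan J" "\<eta> - k y \<in> rspan J" "\<eta> + k y \<in> rspan J" "q \<in> rspan J"
    by (auto simp: J_def intro: rspan_base)
  have 1: "1 \<in> rspan J"
  proof (cases "y = 0")
    case False
    have "k (2 * y) = (\<eta> + k y) - (\<eta> - k y)" by (simp flip: fls_const_mult_const)
    then have "k (2 * y) \<in> rspan J" using rspan_diff J by metis
    then show ?thesis using False rspan_const_unit[of "2 * y"] by simp
  next
    case True
    \<comment> \<open>The derivative f'(x), which is the remainder of q modulo \<xi> - x; for y = 0
      its vanishing would make the point singular.\<close>
    have "3 * x\<^sup>2 + A \<noteq> 0"
    proof
      assume "3 * x\<^sup>2 + A = 0"
      then have A: "A = - 3 * x\<^sup>2" by (simp add: add_eq_0_iff)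
      have "0 = x ^ 3 + A * x + B" using True assms on_curve_E by simp
      moreover have "B = (x ^ 3 + A * x + B) - x ^ 3 - A * x" by simp
      ultimately have "B = - (x ^ 3) - A * x" by (metis diff_0)
      then show False using A no_singular_point by blast
    qed
    moreover have "k (3 * x\<^sup>2 + A) = q - (\<xi> + 2 * k x) * u"
      by (simp add: q_def u_def fls_const_power algebra_simps power2_eq_square flip: fls_const_mult_const fls_plus_const)
    then have "k (3 * x\<^sup>2 + A) \<in> rspan J"
      using J by (auto intro!: rspan_diff rspan_scale R_closed)
    ultimately show ?thesis using rspan_const_unit by blast
  qed
  have "rspan ({u} * J) = rspan ({u} * {1})"
  proof -
    have "rspan J = rspan {1}"
      using 1 R by (intro rspan_eqI) (auto simp: J_def rspan_singleton)
    then show ?thesis using rspan_mult_cong[of J "{1}" "{u}"] by (simp add: mult.commute)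
  qed
  then show ?thesis unfolding prod J_def[symmetric] singleton_mult by (simp add: u_def)
qed

text \<open>w is the function of the line. Vieta gives w (\<eta> + l \<xi> + m) = (\<xi> - x1)(\<xi>
  - x2)(\<xi> - x3), so w divides all products of generators; the work is to show that the quotients
  generate the unit ideal, also when intersection points coincide.\<close>

lemma line_gens:
  assumes lm: "line_meets A B l m x1 x2 x3"
  defines "w \<equiv> \<eta> - (k l * \<xi> + k m)"
  shows "rspan ({\<xi> - k x1, w} * {\<xi> - k x2, w} * {\<xi> - k x3, w}) = rspan {w}"
proof -
  define u1 where "u1 = \<xi> - k x1"
  define u2 where "u2 = \<xi> - k x2"
  define u3 where "u3 = \<xi> - k x3"
  define L where "L = k l * \<xi> + k m"
  note e = line_meetsD[OF lm]
  have e1: "k x1 + k x2 + k x3 = k l ^ 2"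
    using arg_cong[OF e(1), of k] by (simp add: fls_const_power flip: fls_plus_const)
  have A: "A = x1 * x2 + x1 * x3 + x2 * x3 + 2 * l * m" using e(2) by simp
  have B: "B = m\<^sup>2 - x1 * x2 * x3" using e(3) by simp
  have kA: "k A = k x1 * k x2 + k x1 * k x3 + k x2 * k x3 + 2 * k l * k m"
    unfolding A by (simp flip: fls_plus_const fls_const_mult_const)
  have kB: "k B = k m ^ 2 - k x1 * k x2 * k x3"
    unfolding B by (simp add: fls_const_power flip: fls_minus_const fls_const_mult_const)
  have "w * (\<eta> + L) = \<eta>\<^sup>2 - L\<^sup>2" by (simp add: w_def L_def algebra_simps power2_eq_square)
  also have "\<dots> = \<xi> ^ 3 - k l ^ 2 * \<xi>\<^sup>2 + (k A - 2 * k l * k m) * \<xi> + (k B - k m ^ 2)"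
    unfolding \<eta>_eq L_def by (simp add: algebra_simps power2_eq_square)
  also have "\<dots> = u1 * u2 * u3"
    unfolding e1[symmetric] kA kB u1_def u2_def u3_def
    by (simp add: algebra_simps power2_eq_square power3_eq_cube)
  finally have w: "w * (\<eta> + L) = u1 * u2 * u3" .
  \<comment> \<open>One factor from each pair, divided by w; for u1 u2 u3 the quotient is \<eta> +
    L.\<close>
  define J where "J = {\<eta> + L, u1 * u2, u1 * u3, u2 * u3, w * u1, w * u2, w * u3, w * w}"
  have prod: "{u1, w} * {u2, w} * {u3, w} = {w} * J"
    using w by (auto simp: set_times_def J_def algebra_simps)
  have R: "u1 \<in> R" "u2 \<in> R" "u3 \<in> R" "w \<in> R" "L \<in> R" "\<eta> + L \<in> R"
    by (auto simp: u1_def u2_def u3_def w_def L_def intro!: R_closed)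
  have J: "\<eta> + L \<in> rspan J" "u1 * u2 \<in> rspan J" "u1 * u3 \<in> rspan J" "u2 * u3 \<in> rspan J"
    "w * u1 \<in> rspan J" "w * u2 \<in> rspan J" "w * u3 \<in> rspan J" "w * w \<in> rspan J"
    by (auto simp: J_def intro: rspan_base)
  \<comment> \<open>As \<eta> + L = w + 2 L and 2 is invertible, a multiple of w in the ideal can be
    traded for the same multiple of L.\<close>
  have Lu: "L * v \<in> rspan J" if "w * v \<in> rspan J" "v \<in> R" for v
  proof -
    have "v * (\<eta> + L) - w * v \<in> rspan J"
      using rspan_diff[OF rspan_scale[OF J(1) that(2)] that(1)] .
    moreover have "v * (\<eta> + L) - w * v = k 2 * (L * v)" by (simp add: w_def L_def algebra_simps)
    ultimately show ?thesis using rspan_const_cancel[of 2 "L * v"] by simp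
  qed
  have LL: "L * L \<in> rspan J"
    using Lu[of w] Lu[of L] J R by (simp add: mult.commute)
  \<comment> \<open>A double intersection at a. With L = n + l u, where n is the ordinate of the
    line at a, the elements u^2 and L u give n u, then u, then n^2; n = 0 would make (a, 0) a
    singular point.\<close>
  have repeated: "1 \<in> rspan J"
    if "a = x1 \<and> a = x2 \<or> a = x1 \<and> a = x3 \<or> a = x2 \<and> a = x3" for a
  proof -
    define u where "u = \<xi> - k a"
    have uu: "u * u \<in> rspan J" and Lu': "L * u \<in> rspan J"
      using that J R Lu by (auto simp: u_def u1_def u2_def u3_def)
    have R': "u \<in> R" by (auto simp: u_def intro!: R_closed)
    define n where "n = l * a + m"
    have n: "n \<noteq> 0"
    proof
      assume n: "n = 0"
      then have m: "m = - l * a" by (simp add: n_def add_eq_0_iff)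
      define b where "b = x1 + x2 + x3 - a - a"
      have "x1 + x2 + x3 = a + a + b" "x1 * x2 + x1 * x3 + x2 * x3 = a * a + 2 * (a * b)" "x1 * x2 * x3 = a * a * b"
        using that by (auto simp: b_def algebra_simps)
      then have b: "l\<^sup>2 = a + a + b" "A = a * a + 2 * (a * b) + 2 * l * m" "B = m\<^sup>2 - a * a * b"
        using A B e(1) by simp_all
      have A': "A = a * a + 2 * (a * b) - 2 * a * l\<^sup>2" and B': "B = a * a * l\<^sup>2 - a * a * b"
        using b by (simp_all add: m power2_eq_square)
      have "A = - 3 * a\<^sup>2"
        unfolding A' b(1) by (simp add: algebra_simps power2_eq_square)
      moreover have "B = - (a ^ 3) - A * a"
        unfolding A' B' b(1) by (simp add: algebra_simps power2_eq_square power3_eq_cube)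
      ultimately show False using no_singular_point by blast
    qed
    have L: "L = k n + k l * u"
      by (simp add: L_def n_def u_def algebra_simps flip: fls_plus_const fls_const_mult_const)
    have "L * u - k l * (u * u) \<in> rspan J" using uu Lu' by (auto intro!: rspan_diff rspan_scale)
    then have "k n * u \<in> rspan J" by (simp add: L algebra_simps)
    then have u: "u \<in> rspan J" using n rspan_const_cancel by blast
    have "L * L - (k l * (k n + L)) * u \<in> rspan J"
      using u LL R by (auto intro!: rspan_diff rspan_scale R_closed)
    then have "k (n * n) \<in> rspan J" by (simp add: L algebra_simps flip: fls_const_mult_const)
    then show ?thesis using n rspan_const_unit[of "n * n"] by simp
  qed
  have 1: "1 \<in> rspan J"
  proof (cases "x1 = x2 \<or> x1 = x3 \<or> x2 = x3")
    case True
    then show ?thesis using repeated by metis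
  next
    case False
    \<comment> \<open>For distinct abscissas, differences of the products of two u's are nonzero
      constants times u1 and u2, and u1 - u2 is a nonzero constant.\<close>
    have "u1 * u2 - u1 * u3 \<in> rspan J" using J by (intro rspan_diff)
    then have "k (x3 - x2) * u1 \<in> rspan J"
      by (simp add: u2_def u3_def algebra_simps flip: fls_minus_const)
    then have u1: "u1 \<in> rspan J" using False rspan_const_cancel[of "x3 - x2"] by auto
    have "u1 * u2 - u2 * u3 \<in> rspan J" using J by (intro rspan_diff)
    then have "k (x3 - x1) * u2 \<in> rspan J"
      by (simp add: u1_def u3_def algebra_simps flip: fls_minus_const)
    then have u2: "u2 \<in> rspan J" using False rspan_const_cancel[of "x3 - x1"] by auto
    have "u1 - u2 \<in> rspan J" using u1 u2 by (intro rspan_diff)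
    then have "k (x2 - x1) \<in> rspan J" by (simp add: u1_def u2_def flip: fls_minus_const)
    then show ?thesis using False rspan_const_unit[of "x2 - x1"] by auto
  qed
  have "rspan J = rspan {1}"
    using 1 R by (intro rspan_eqI) (auto simp: J_def rspan_singleton intro!: R_closed)
  then have "rspan ({w} * J) = rspan ({w} * {1})"
    using rspan_mult_cong[of J "{1}" "{w}"] by (simp add: mult.commute)
  then show ?thesis using prod by (simp add: u1_def u2_def u3_def set_times_def)
qed

text \<open>Replaces the generator \<eta> - y by the function of a line through the point, which is
  the same for all three points of intersection.\<close>

lemma point_gens_line:
  assumes "y = l * x + m"
  shows "rspan (point_gens (Affine x y)) = rspan {\<xi> - k x, \<eta> - (k l * \<xi> + k m)}"
proof -
  have eq: "\<eta> - k y = (\<eta> - (k l * \<xi> + k m)) + k l * (\<xi> - k x)"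
    unfolding assms by (simp add: algebra_simps flip: fls_plus_const fls_const_mult_const)
  then have eq': "\<eta> - (k l * \<xi> + k m) = (\<eta> - k y) - k l * (\<xi> - k x)" by simp
  show ?thesis
  proof (rule rspan_eqI)
    show "point_gens (Affine x y) \<subseteq> rspan {\<xi> - k x, \<eta> - (k l * \<xi> + k m)}"
      unfolding point_gens.simps eq insert_subset
      by (intro conjI rspan_add rspan_scale R_const rspan_base) auto
    show "{\<xi> - k x, \<eta> - (k l * \<xi> + k m)} \<subseteq> rspan (point_gens (Affine x y))"
      unfolding point_gens.simps eq' insert_subset
      by (intro conjI rspan_diff rspan_scale R_const rspan_base) auto
  qed
qed

lemma \<xi>_minus_const_nonzero: "\<xi> - k x \<noteq> 0"
proof
  assume "\<xi> - k x = 0"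
  then have "\<xi> = k x" by simp
  then have "fls_subdegree \<xi> = fls_subdegree (k x)" by (rule arg_cong)
  then show False by simp
qed

text \<open>The ideal class is additive. For S the third point on the line, I_P I_Q I_S = (w) and
  I_S I_(P+Q) = (\<xi> - x3), because P + Q is the opposite of S; hence g = w / (\<xi> -
  x3).\<close>

lemma point_gens_add:
  assumes "on_curve_point E P" "on_curve_point E Q"
  obtains g where "g \<noteq> 0" "rspan (point_gens P * point_gens Q) = rspan ({g} * point_gens (point_add E P Q))"
proof (cases P; cases Q)
  fix x1 y1 x2 y2 assume PQ: "P = Affine x1 y1" "Q = Affine x2 y2"
  then have c: "on_curve E x1 y1" "on_curve E x2 y2" using assms by auto
  show thesis
  proof (cases rule: point_add_short_cases[OF c, case_names opposite line])
    case opposite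
    have "rspan (point_gens P * point_gens Q) = rspan ({\<xi> - k x1} * point_gens (point_add E P Q))"
      using opposite point_gens_neg[OF c(1)] PQ by (simp add: singleton_mult)
    then show thesis by (rule that[OF \<xi>_minus_const_nonzero])
  next
    case (line l m x3)
    define w where "w = \<eta> - (k l * \<xi> + k m)"
    define S where "S = Affine x3 (l * x3 + m)"
    have add: "point_add E P Q = Affine x3 (- (l * x3 + m))" using line PQ by simp
    have w0: "w \<noteq> 0"
    proof
      assume "w = 0"
      then have "poly_at [:m, l:] \<xi> + poly_at 0 \<xi> * \<eta> = poly_at 0 \<xi> + poly_at 1 \<xi> * \<eta>"
        by (simp add: w_def algebra_simps)
      from ring_repr_unique(2)[OF this] show False by simp
    qed
    have "rspan (point_gens P * point_gens Q * point_gens S) =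
        rspan ({\<xi> - k x1, w} * {\<xi> - k x2, w} * {\<xi> - k x3, w})"
      unfolding PQ S_def w_def
      by (intro rspan_mult_cong2 point_gens_line line refl)
    also have "\<dots> = rspan {w}" using line_gens[OF line(1)] by (simp add: w_def)
    finally have PQS: "rspan (point_gens P * point_gens Q * point_gens S) = rspan {w}" .
    have S: "rspan (point_gens S * point_gens (point_add E P Q)) = rspan {\<xi> - k x3}"
      unfolding add S_def by (rule point_gens_neg[OF line_meets_on_curve[OF line(1)]])
    have "rspan ({\<xi> - k x3} * (point_gens P * point_gens Q)) =
        rspan ((point_gens S * point_gens (point_add E P Q)) * (point_gens P * point_gens Q))"
      by (intro rspan_mult_cong S[symmetric])
    also have "\<dots> = rspan ((point_gens P * point_gens Q * point_gens S) * point_gens (point_add E P Q))"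
      by (simp only: mult_ac)
    also have "\<dots> = rspan ({w} * point_gens (point_add E P Q))"
      by (intro rspan_mult_cong PQS)
    also have "{w} * point_gens (point_add E P Q) = {\<xi> - k x3} * ({w / (\<xi> - k x3)} * point_gens (point_add E P Q))"
      using \<xi>_minus_const_nonzero[of x3] by (simp add: singleton_mult_mult)
    finally have "rspan (point_gens P * point_gens Q) = rspan ({w / (\<xi> - k x3)} * point_gens (point_add E P Q))"
      by (rule rspan_cancel[OF \<xi>_minus_const_nonzero])
    then show thesis using that[of "w / (\<xi> - k x3)"] w0 \<xi>_minus_const_nonzero[of x3] by auto
  qed
qed (use that[of 1] in \<open>auto simp: set_times_def\<close>)

text \<open>Evaluation at (x, y) would turn a relation 1 = u (\<xi> - x) + v (\<eta> - y) into 1 =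
  0. It is performed on the polynomials multiplying 1 and \<eta>, whose uniqueness gives two
  identities to be evaluated at x.\<close>

lemma point_gens_not_unit:
  assumes "on_curve E x y" shows "1 \<notin> rspan (point_gens (Affine x y))"
proof
  assume "1 \<in> rspan (point_gens (Affine x y))"
  moreover have "\<exists>a\<in>R. \<exists>b\<in>R. v = a * (\<xi> - k x) + b * (\<eta> - k y)" if "v \<in> rspan (point_gens (Affine x y))" for v
    using that
  proof (induction rule: rspan.induct)
    case zero
    then show ?case using R_0 by (intro bexI[of _ 0]) auto
  next
    case (step r s v)
    then obtain a b where ab: "a \<in> R" "b \<in> R" "v = a * (\<xi> - k x) + b * (\<eta> - k y)" by blast
    from step consider "s = \<xi> - k x" | "s = \<eta> - k y" by auto
    then show ?case
    proof cases
      case 1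
      have "r * s + v = (r + a) * (\<xi> - k x) + b * (\<eta> - k y)"
        unfolding 1 ab(3) by (simp add: algebra_simps)
      then show ?thesis using ab R_add[OF step(1) ab(1)] by (intro bexI)
    next
      case 2
      have "r * s + v = a * (\<xi> - k x) + (r + b) * (\<eta> - k y)"
        unfolding 2 ab(3) by (simp add: algebra_simps)
      then show ?thesis using ab R_add[OF step(1) ab(2)] by (intro bexI)
    qed
  qed
  ultimately obtain u v where uv: "u \<in> R" "v \<in> R" "1 = u * (\<xi> - k x) + v * (\<eta> - k y)" by blast
  obtain a b c d where ab: "u = poly_at a \<xi> + poly_at b \<xi> * \<eta>" "v = poly_at c \<xi> + poly_at d \<xi> * \<eta>"
    using uv by (auto simp: R_def)
  let ?p = "[:- x, 1:]"
  have \<xi>: "\<xi> - k x = poly_at ?p \<xi>" by (simp add: algebra_simps)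
  have "poly_at 1 \<xi> + poly_at 0 \<xi> * \<eta> = u * (\<xi> - k x) + v * (\<eta> - k y)" using uv by simp
  also have "\<dots> = poly_at a \<xi> * poly_at ?p \<xi> + poly_at d \<xi> * (\<eta> * \<eta>) - poly_at [:y:] \<xi> * poly_at c \<xi>
      + (poly_at b \<xi> * poly_at ?p \<xi> + poly_at c \<xi> - poly_at [:y:] \<xi> * poly_at d \<xi>) * \<eta>"
    unfolding ab \<xi> by (simp add: algebra_simps)
  also have "\<dots> = poly_at (a * ?p + d * [:B, A, 0, 1:] - [:y:] * c) \<xi> + poly_at (b * ?p + c - [:y:] * d) \<xi> * \<eta>"
    unfolding \<eta>_poly by (simp only: poly_at_add poly_at_mult poly_at_diff)
  finally have eq: "1 = a * ?p + d * [:B, A, 0, 1:] - [:y:] * c" "0 = b * ?p + c - [:y:] * d"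
    by (rule ring_repr_unique)+
  have "0 = poly c x - y * poly d x" using arg_cong[OF eq(2), of "\<lambda>p. poly p x"] by simp
  moreover have "1 = poly d x * (x ^ 3 + A * x + B) - y * poly c x"
    using arg_cong[OF eq(1), of "\<lambda>p. poly p x"] by (simp add: algebra_simps power3_eq_cube)
  moreover have "x ^ 3 + A * x + B = y * y" using assms on_curve_E by (simp add: power2_eq_square)
  ultimately have "1 = poly d x * (y * y) - y * (y * poly d x)" by simp
  then show False by (simp add: algebra_simps)
qed

text \<open>A generator of the ideal of an affine point divides \<open>\<xi> - x\<close>, of degree 2, so it has
  degree 0, 1 or 2; degree 0 makes the ideal trivial, degree 1 does not occur, and degree 2
  prevents it from dividing \<open>\<eta> - y\<close>, of degree 3.\<close>

lemma point_gens_not_principal: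
  assumes "on_curve E x y" shows "rspan (point_gens (Affine x y)) \<noteq> rspan {g}"
proof
  assume eq: "rspan (point_gens (Affine x y)) = rspan {g}"
  have "\<xi> - k x \<in> rspan (point_gens (Affine x y))" by (auto intro: rspan_base)
  then obtain h where h: "h \<in> R" "\<xi> - k x = h * g" unfolding eq rspan_singleton by auto
  have "\<eta> - k y \<in> rspan (point_gens (Affine x y))" by (auto intro: rspan_base)
  then obtain h' where h': "h' \<in> R" "\<eta> - k y = h' * g" unfolding eq rspan_singleton by auto
  have "g \<in> rspan {g}" by (auto intro: rspan_base)
  then have g: "g \<in> R"
  proof -
    have "rspan (point_gens (Affine x y)) \<subseteq> rspan {1}"
      by (intro rspan_least) (auto simp: rspan_singleton intro!: R_closed)
    then show ?thesis using \<open>g \<in> rspan {g}\<close> unfolding eq by (auto simp: rspan_singleton)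
  qed
  have "h * g \<noteq> 0" using \<xi>_minus_const_nonzero[of x] unfolding h(2) .
  then have 0: "h \<noteq> 0" "g \<noteq> 0" by auto
  have "fls_subdegree (\<xi> + k (- x)) = -2"
    by (subst fls_subdegree_add_eq1) auto
  then have "fls_subdegree (\<xi> - k x) = -2" by simp
  then have d: "fls_subdegree h + fls_subdegree g = -2" using 0 h by simp
  have dY: "fls_subdegree (\<eta> + k (- y)) = -3"
    by (subst fls_subdegree_add_eq1) auto
  then have "h' * g \<noteq> 0" using h' by auto
  then have "fls_subdegree h' + fls_subdegree g = -3" using dY h' by simp
  then have "fls_subdegree g = 0"
    using d subdegree_R_nonpos[OF h(1)] subdegree_R_nonpos[OF g] subdegree_R_nonpos[OF h'(1)] by linarith
  then obtain c where "c \<noteq> 0" "g = k c" using R_const_of_subdegree_0[OF g] 0 by blast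
  then have "1 \<in> rspan {g}" using \<open>g \<in> rspan {g}\<close> rspan_const_unit by blast
  then show False using point_gens_not_unit[OF assms] eq by simp
qed

lemma point_add_neg: "point_add E (point_neg P) P = Infinity"
  by (cases P) auto

text \<open>Injectivity of the class map: the ideal of P + (-Q) is principal, so this point is
  \<open>Infinity\<close>, and \<open>point_add\<close> returns \<open>Infinity\<close> only for
  opposite points.\<close>

lemma point_eq_of_class_eq:
  assumes "on_curve_point E P" "on_curve_point E Q" "g \<noteq> 0" "h \<noteq> 0"
    and eq: "rspan ({g} * point_gens P) = rspan ({h} * point_gens Q)"
  shows "P = Q"
proof -
  have nQ: "on_curve_point E (point_neg Q)" using assms on_curve_point_neg by blast
  define S where "S = point_add E P (point_neg Q)"
  obtain a where a: "a \<noteq> 0" "rspan (point_gens P * point_gens (point_neg Q)) = rspan ({a} * point_gens S)"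
    using point_gens_add[OF assms(1) nQ] unfolding S_def .
  obtain b where b: "b \<noteq> 0" "rspan (point_gens (point_neg Q) * point_gens Q) = rspan ({b} * {1})"
    using point_gens_add[OF nQ assms(2)] by (auto simp: point_add_neg)
  have "rspan ({g * a} * point_gens S) = rspan ({g} * ({a} * point_gens S))"
    by (simp add: singleton_mult_mult)
  also have "\<dots> = rspan ({g} * (point_gens P * point_gens (point_neg Q)))"
    using a by (intro rspan_mult_cong_right) simp
  also have "\<dots> = rspan (({g} * point_gens P) * point_gens (point_neg Q))"
    by (simp only: mult.assoc)
  also have "\<dots> = rspan (({h} * point_gens Q) * point_gens (point_neg Q))"
    by (intro rspan_mult_cong eq)
  also have "\<dots> = rspan ({h} * (point_gens (point_neg Q) * point_gens Q))"
    by (simp only: mult_ac)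
  also have "\<dots> = rspan ({h} * ({b} * {1}))"
    using b by (intro rspan_mult_cong_right) simp
  also have "{h} * ({b} * {1}) = {g * a} * {h * b / (g * a)}"
    using a assms by (auto simp: set_times_def)
  finally have "rspan (point_gens S) = rspan {h * b / (g * a)}"
    by (rule rspan_cancel[rotated]) (use a assms in auto)
  moreover have "on_curve_point E S" unfolding S_def using assms nQ on_curve_point_add by blast
  ultimately have "S = Infinity" using point_gens_not_principal by (cases S) auto
  then show "P = Q"
    by (cases P; cases Q) (auto simp: S_def Let_def split: if_splits)
qed

text \<open>Both sides have the class of I_P I_Q I_S.\<close>

lemma point_add_assoc:
  assumes P: "on_curve_point E P" and Q: "on_curve_point E Q" and S: "on_curve_point E S"
  shows "point_add E (point_add E P Q) S = point_add E P (point_add E Q S)"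
proof -
  note c = P Q S on_curve_point_add[OF P Q] on_curve_point_add[OF Q S]
  obtain a where a: "a \<noteq> 0" "rspan (point_gens P * point_gens Q) = rspan ({a} * point_gens (point_add E P Q))"
    using point_gens_add[OF P Q] .
  obtain b where b: "b \<noteq> 0" "rspan (point_gens (point_add E P Q) * point_gens S) =
      rspan ({b} * point_gens (point_add E (point_add E P Q) S))"
    using point_gens_add[OF c(4) S] .
  obtain a' where a': "a' \<noteq> 0" "rspan (point_gens Q * point_gens S) = rspan ({a'} * point_gens (point_add E Q S))"
    using point_gens_add[OF Q S] .
  obtain b' where b': "b' \<noteq> 0" "rspan (point_gens P * point_gens (point_add E Q S)) =
      rspan ({b'} * point_gens (point_add E P (point_add E Q S)))"
    using point_gens_add[OF P c(5)] .
  have "rspan ({a * b} * point_gens (point_add E (point_add E P Q) S))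
      = rspan ({a} * ({b} * point_gens (point_add E (point_add E P Q) S)))"
    by (simp add: singleton_mult_mult)
  also have "\<dots> = rspan ({a} * (point_gens (point_add E P Q) * point_gens S))"
    using b by (intro rspan_mult_cong_right) simp
  also have "\<dots> = rspan (({a} * point_gens (point_add E P Q)) * point_gens S)"
    by (simp only: mult.assoc)
  also have "\<dots> = rspan ((point_gens P * point_gens Q) * point_gens S)"
    using a by (intro rspan_mult_cong) simp
  also have "\<dots> = rspan ((point_gens Q * point_gens S) * point_gens P)"
    by (simp only: mult_ac)
  also have "\<dots> = rspan (({a'} * point_gens (point_add E Q S)) * point_gens P)"
    using a' by (intro rspan_mult_cong) simp
  also have "\<dots> = rspan ({a'} * (point_gens P * point_gens (point_add E Q S)))"
    by (simp only: mult_ac)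
  also have "\<dots> = rspan ({a'} * ({b'} * point_gens (point_add E P (point_add E Q S))))"
    using b' by (intro rspan_mult_cong_right) simp
  also have "\<dots> = rspan ({a' * b'} * point_gens (point_add E P (point_add E Q S)))"
    by (simp add: singleton_mult_mult)
  finally show ?thesis
    by (intro point_eq_of_class_eq[of _ _ "a * b" "a' * b'"]) (use a b a' b' c on_curve_point_add in auto)
qed

end

section \<open>Existence of the coordinate ring and the group law\<close>

lemma coordinate_ring_exists:
  fixes A B :: "'a::field_char_0"
  assumes "4 * A ^ 3 + 27 * B\<^sup>2 \<noteq> 0"
  shows "\<exists>\<eta>. coordinate_ring A B \<eta>"
proof -
  \<comment> \<open>With \<xi> = z^(-2) the equation asks for \<eta> = z^(-3) sqrt(1 + A z^4 + B
    z^6); the root exists as a power series because the constant coefficient is 1 and the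
    characteristic is 0.\<close>
  define q :: "'a fps" where "q = 1 + fps_const A * fps_X ^ 4 + fps_const B * fps_X ^ 6"
  define s where "s = fps_radical (\<lambda>_ _. 1) 2 q"
  have "s ^ Suc 1 = q"
    unfolding s_def using power_radical[of q "\<lambda>_ _. 1" 1] by (simp add: q_def numeral_2_eq_2)
  then have "fps_to_fls (s * s) = fps_to_fls q" by simp
  then have s: "fps_to_fls s ^ 2 = 1 + fls_const A * fls_X_intpow 4 + fls_const B * fls_X_intpow 6"
    by (simp add: q_def power2_eq_square fls_times_fps_to_fls fps_to_fls_power fls_X_power_conv_shift_1)
  define \<eta> where "\<eta> = fls_X_intpow (-3) * fps_to_fls s"
  have "\<eta>\<^sup>2 = (fls_X_intpow (-2)) ^ 3 + fls_const A * fls_X_intpow (-2) + fls_const B"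
  proof -
    have "(fls_X_intpow (-3) :: 'a fls)\<^sup>2 = fls_X_intpow (-6)" "(fls_X_intpow (-2) :: 'a fls) ^ 3 = fls_X_intpow (-6)"
      using fls_X_intpow_power[of "-3" 2] fls_X_intpow_power[of "-2" 3] by simp_all
    moreover have "fls_X_intpow (-6) * fls_X_intpow 4 = (fls_X_intpow (-2) :: 'a fls)"
      "fls_X_intpow (-6) * fls_X_intpow 6 = (1 :: 'a fls)"
      using fls_X_intpow_times_fls_X_intpow[of "-6" 4] fls_X_intpow_times_fls_X_intpow[of "-6" 6] by simp_all
    ultimately show ?thesis
      unfolding \<eta>_def power_mult_distrib s
      by (simp only: distrib_left mult.left_commute mult_1_right)
  qed
  then show ?thesis using assms by (auto simp: coordinate_ring_def)
qed

theorem point_add_assoc_short: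
  fixes A B :: "'a::field_char_0"
  assumes "4 * A ^ 3 + 27 * B\<^sup>2 \<noteq> 0"
    and "on_curve_point (short_weierstrass A B) P" "on_curve_point (short_weierstrass A B) Q"
      "on_curve_point (short_weierstrass A B) S"
  shows "point_add (short_weierstrass A B) (point_add (short_weierstrass A B) P Q) S =
    point_add (short_weierstrass A B) P (point_add (short_weierstrass A B) Q S)"
  using coordinate_ring_exists[OF assms(1)] coordinate_ring.point_add_assoc assms(2-) by blast

text \<open>The group is formed over the whole ambient field; rationality over K is tracked by
  separate conditions on the coordinates.\<close>

lemma comm_group_point_group_short:
  fixes A B :: "'a::field_char_0"
  assumes "4 * A ^ 3 + 27 * B\<^sup>2 \<noteq> 0"
  shows "comm_group (point_group (short_weierstrass A B) UNIV)"
proof -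
  let ?E = "short_weierstrass A B"
  have carrier: "P \<in> carrier (point_group ?E UNIV) \<longleftrightarrow> on_curve_point ?E P" for P
    by (cases P) (auto simp: point_group_def)
  have comm: "point_add ?E P Q = point_add ?E Q P" if "on_curve_point ?E P" "on_curve_point ?E Q" for P Q
  proof (cases P; cases Q)
    fix x1 y1 x2 y2 assume PQ: "P = Affine x1 y1" "Q = Affine x2 y2"
    then have "on_curve ?E x1 y1" "on_curve ?E x2 y2" using that by auto
    then have c: "y1\<^sup>2 = x1 ^ 3 + A * x1 + B" "y2\<^sup>2 = x2 ^ 3 + A * x2 + B"
      by (simp_all add: on_curve_short)
    show ?thesis
    proof (cases "x1 = x2")
      case True
      then have "(y1 - y2) * (y1 + y2) = 0" using c by (simp add: algebra_simps power2_eq_square)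
      then have "y1 = y2 \<or> y1 + y2 = 0" by auto
      then show ?thesis using True PQ by (auto simp: add.commute)
    next
      case False
      have sl: "(y1 - y2) / (x1 - x2) = (y2 - y1) / (x2 - x1)"
        using False by (simp add: divide_simps) (simp add: algebra_simps)
      define L where "L = (y2 - y1) / (x2 - x1)"
      have "L * (x1 - x2) = y1 - y2"
        using False by (simp add: L_def divide_simps) (simp add: algebra_simps)
      then have y1: "y1 = y2 + L * (x1 - x2)" by simp
      have "point_add ?E P Q = Affine (L\<^sup>2 - x1 - x2) (- (y1 + L * (L\<^sup>2 - x1 - x2 - x1)))"
        using False PQ by (simp add: Let_def L_def)
      moreover have "point_add ?E Q P = Affine (L\<^sup>2 - x2 - x1) (- (y2 + L * (L\<^sup>2 - x2 - x1 - x2)))"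
        using False PQ by (simp add: Let_def L_def sl)
      ultimately show ?thesis by (simp add: y1 algebra_simps)
    qed
  qed auto
  show ?thesis
  proof (rule comm_groupI)
    fix P assume "P \<in> carrier (point_group ?E UNIV)"
    then show "\<exists>Q\<in>carrier (point_group ?E UNIV). Q \<otimes>\<^bsub>point_group ?E UNIV\<^esub> P = \<one>\<^bsub>point_group ?E UNIV\<^esub>"
      using on_curve_point_neg[of A B P] carrier
      by (intro bexI[of _ "point_neg P"]) (cases P; auto simp: point_group_def)+
  qed (use carrier comm on_curve_point_add point_add_assoc_short[OF assms] in \<open>auto simp: point_group_def\<close>)
qed

section \<open>The kernel of reduction\<close>

text \<open>In the coordinates \<open>t = x / y\<close> and \<open>s = 1 / y\<close> around the point at infinity the curve is
  \<open>s = t\<^sup>3 + A t s\<^sup>2 + B s\<^sup>3\<close>, and the line \<open>y = l x + m\<close> is \<open>s = \<alpha> t + \<beta>\<close> with \<open>\<alpha> = - l / m\<close> and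
  \<open>\<beta> = 1 / m\<close>.\<close>

lemma line_sum_parameter:
  fixes A B :: "'a::field"
  assumes lm: "line_meets A B l m x1 x2 x3" and m: "m \<noteq> 0"
    and y: "l * x1 + m \<noteq> 0" "l * x2 + m \<noteq> 0"
  defines "\<alpha> \<equiv> - l / m" and "\<beta> \<equiv> 1 / m"
  defines "c \<equiv> 1 + A * \<alpha>\<^sup>2 + B * \<alpha> ^ 3"
  assumes c: "c \<noteq> 0"
  shows "l * x3 + m \<noteq> 0"
    and "x1 / (l * x1 + m) + x2 / (l * x2 + m) + x3 / (l * x3 + m) = - (2 * A * \<alpha> * \<beta> + 3 * B * \<alpha>\<^sup>2 * \<beta>) / c"
proof -
  note e = line_meetsD[OF lm]
  have A: "A = x1 * x2 + x1 * x3 + x2 * x3 + 2 * l * m" using e(2) by simp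
  have B: "B = m\<^sup>2 - x1 * x2 * x3" using e(3) by simp
  have "c * m ^ 3 = m ^ 3 + A * l\<^sup>2 * m - B * l ^ 3"
    using m by (simp add: c_def \<alpha>_def field_simps power2_eq_square power3_eq_cube)
  also have "\<dots> = (l * x1 + m) * (l * x2 + m) * (l * x3 + m) + l * m\<^sup>2 * (l\<^sup>2 - (x1 + x2 + x3))"
    unfolding A B by (simp add: algebra_simps power2_eq_square power3_eq_cube)
  finally have cm: "c * m ^ 3 = (l * x1 + m) * (l * x2 + m) * (l * x3 + m)" using e(1) by simp
  then show y3: "l * x3 + m \<noteq> 0" using c m by auto
  have num: "x1 * (l * x2 + m) * (l * x3 + m) + x2 * (l * x1 + m) * (l * x3 + m) + x3 * (l * x1 + m) * (l * x2 + m)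
      = 2 * A * l * m - 3 * B * l\<^sup>2 - m\<^sup>2 * (l\<^sup>2 - (x1 + x2 + x3))"
    unfolding A B by (simp add: algebra_simps power2_eq_square)
  have "x1 / (l * x1 + m) + x2 / (l * x2 + m) + x3 / (l * x3 + m) =
      (x1 * (l * x2 + m) * (l * x3 + m) + x2 * (l * x1 + m) * (l * x3 + m) + x3 * (l * x1 + m) * (l * x2 + m))
      / ((l * x1 + m) * (l * x2 + m) * (l * x3 + m))"
    using y y3 by (simp add: add_divide_distrib)
  also have "\<dots> = (2 * A * l * m - 3 * B * l\<^sup>2) / (c * m ^ 3)"
    unfolding num cm[symmetric] using e(1) by simp
  also have "2 * A * l * m - 3 * B * l\<^sup>2 = - (2 * A * \<alpha> * \<beta> + 3 * B * \<alpha>\<^sup>2 * \<beta>) * m ^ 3"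
    using m by (simp add: \<alpha>_def \<beta>_def field_simps power2_eq_square power3_eq_cube)
  finally show "x1 / (l * x1 + m) + x2 / (l * x2 + m) + x3 / (l * x3 + m) = - (2 * A * \<alpha> * \<beta> + 3 * B * \<alpha>\<^sup>2 * \<beta>) / c"
    using m by simp
qed

lemma curve_at_infinity:
  fixes A B :: "'a::field"
  assumes "y\<^sup>2 = x ^ 3 + A * x + B" "y \<noteq> 0"
  shows "1 / y = (x / y) ^ 3 + A * (x / y) * (1 / y)\<^sup>2 + B * (1 / y) ^ 3"
proof -
  have "1 / y = y\<^sup>2 * (1 / y) ^ 3" using assms(2) by (simp add: field_simps power2_eq_square power3_eq_cube)
  also have "\<dots> = (x / y) ^ 3 + A * (x / y) * (1 / y)\<^sup>2 + B * (1 / y) ^ 3"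
    unfolding assms(1) by (simp add: add_divide_distrib power2_eq_square power3_eq_cube)
  finally show ?thesis .
qed

text \<open>Subtracting the two curve equations in (t, s) gives (s2 - s1) u = (t2 - t1) n with n the
  numerator of the conclusion. In the kernel of reduction u is a unit, so the slope n / u is visibly
  small, for tangents as well as for chords.\<close>

lemma line_slope_parameter:
  fixes A B :: "'a::field"
  assumes c: "y1\<^sup>2 = x1 ^ 3 + A * x1 + B" "y2\<^sup>2 = x2 ^ 3 + A * x2 + B"
    and y: "y1 \<noteq> 0" "y2 \<noteq> 0"
    and l: "y1 = l * x1 + m" "y2 = l * x2 + m"
    and tangent: "x1 = x2 \<Longrightarrow> 2 * y1 * l = 3 * x1\<^sup>2 + A"
  defines "t1 \<equiv> x1 / y1" and "t2 \<equiv> x2 / y2" and "s1 \<equiv> 1 / y1" and "s2 \<equiv> 1 / y2"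
  defines "u \<equiv> 1 - A * t1 * (s1 + s2) - B * (s1\<^sup>2 + s1 * s2 + s2\<^sup>2)"
  assumes u: "u \<noteq> 0"
  shows "m \<noteq> 0" and "- l / m = (t1\<^sup>2 + t1 * t2 + t2\<^sup>2 + A * s2\<^sup>2) / u"
proof -
  define n where "n = t1\<^sup>2 + t1 * t2 + t2\<^sup>2 + A * s2\<^sup>2"
  have s: "s1 = t1 ^ 3 + A * t1 * s1\<^sup>2 + B * s1 ^ 3" "s2 = t2 ^ 3 + A * t2 * s2\<^sup>2 + B * s2 ^ 3"
    unfolding t1_def t2_def s1_def s2_def by (intro curve_at_infinity c y)+
  have "(s2 - s1) * u - (t2 - t1) * n =
      (s2 - (t2 ^ 3 + A * t2 * s2\<^sup>2 + B * s2 ^ 3)) - (s1 - (t1 ^ 3 + A * t1 * s1\<^sup>2 + B * s1 ^ 3))"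
    unfolding u_def n_def by (simp add: algebra_simps power2_eq_square power3_eq_cube)
  then have su: "(s2 - s1) * u = (t2 - t1) * n" using s by simp
  have "l * t1 + m * s1 = (l * x1 + m) / y1" "l * t2 + m * s2 = (l * x2 + m) / y2"
    by (simp_all add: t1_def t2_def s1_def s2_def add_divide_distrib)
  then have ts: "l * t1 + m * s1 = 1" "l * t2 + m * s2 = 1"
    unfolding l[symmetric] using y by simp_all
  have eq: "l * t1 = l * t2" if "m = 0" using ts that by simp
  \<comment> \<open>As u is nonzero, equal t forces equal s, so equal parameters occur only in the
    tangent case.\<close>
  have t_eq: "x1 = x2 \<and> y1 = y2" if "t1 = t2"
  proof -
    have "s1 = s2" using su that u by simp
    then show ?thesis using that y by (simp add: t1_def t2_def s1_def s2_def)
  qed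
  have tan: "2 * m * s1 = - u \<and> 2 * s1 * l = n" if "t1 = t2"
  proof -
    have [simp]: "x2 = x1" "y2 = y1" using t_eq that by auto
    have [simp]: "t2 = t1" "s2 = s1" by (simp_all add: t1_def t2_def s1_def s2_def)
    have tl: "2 * y1 * l = 3 * x1\<^sup>2 + A" using tangent by simp
    have "2 * s1 * l = 2 * y1 * l * s1\<^sup>2" using y by (simp add: s1_def power2_eq_square)
    also have "\<dots> = n" unfolding tl n_def using y
      by (simp add: t1_def s1_def field_simps power2_eq_square)
    finally have n: "2 * s1 * l = n" .
    have "2 * y1 * m = 2 * y1\<^sup>2 - (2 * y1 * l) * x1"
      using l(1) by (simp add: algebra_simps power2_eq_square)
    also have "\<dots> = - (y1\<^sup>2 - 2 * A * x1 - 3 * B) + 3 * (y1\<^sup>2 - (x1 ^ 3 + A * x1 + B))"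
      unfolding tl by (simp add: algebra_simps power2_eq_square power3_eq_cube)
    finally have ym: "2 * y1 * m = - (y1\<^sup>2 - 2 * A * x1 - 3 * B)" using c by simp
    have u': "u = 1 - A * t1 * (s1 + s1) - B * (s1\<^sup>2 + s1 * s1 + s1\<^sup>2)" by (simp add: u_def)
    have "u * y1\<^sup>2 = y1\<^sup>2 - 2 * A * x1 - 3 * B" unfolding u' t1_def s1_def using y
      by (simp add: field_simps power2_eq_square)
    then have "2 * y1 * m * s1\<^sup>2 = - (u * y1\<^sup>2) * s1\<^sup>2" using ym by simp
    then have "2 * m * s1 = - u" using y by (simp add: s1_def power2_eq_square)
    then show ?thesis using n by simp
  qed
  show m: "m \<noteq> 0"
  proof
    assume m: "m = 0"
    then have "l \<noteq> 0" using ts by auto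
    then have "t1 = t2" using eq m by simp
    then show False using tan u m by simp
  qed
  have "- l / m * u = n"
  proof (cases "t1 = t2")
    case True
    then have *: "u = - (2 * m * s1)" "n = 2 * s1 * l" using tan by simp_all
    show ?thesis unfolding * using m by simp
  next
    case False
    have "- l * (t2 - t1) = m * (s2 - s1)" using ts by (simp add: algebra_simps)
    then have "- l * (t2 - t1) * u = m * ((t2 - t1) * n)" by (simp only: mult.assoc su)
    then have "(t2 - t1) * (- l * u) = (t2 - t1) * (m * n)" by (simp add: algebra_simps)
    then have "- l * u = m * n" using False by (metis mult_cancel_left right_minus_eq)
    then show ?thesis using m by (simp add: field_simps)
  qed
  then show "- l / m = (t1\<^sup>2 + t1 * t2 + t2\<^sup>2 + A * s2\<^sup>2) / u"
    using u by (simp add: n_def field_simps)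
qed

section \<open>Valued subfields of the ambient field\<close>

locale subfield_valuation =
  fixes K :: "'k::field_char_0 set" and v :: "'k \<Rightarrow> int"
  assumes K_1: "1 \<in> K"
    and K_minus: "x \<in> K \<Longrightarrow> y \<in> K \<Longrightarrow> x - y \<in> K"
    and K_mult: "x \<in> K \<Longrightarrow> y \<in> K \<Longrightarrow> x * y \<in> K"
    and K_inverse: "x \<in> K \<Longrightarrow> inverse x \<in> K"
    and v_mult: "x \<in> K \<Longrightarrow> y \<in> K \<Longrightarrow> x \<noteq> 0 \<Longrightarrow> y \<noteq> 0 \<Longrightarrow> v (x * y) = v x + v y"
    and v_add: "x \<in> K \<Longrightarrow> y \<in> K \<Longrightarrow> x \<noteq> 0 \<Longrightarrow> y \<noteq> 0 \<Longrightarrow> x + y \<noteq> 0 \<Longrightarrow> min (v x) (v y) \<le> v (x + y)"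
begin

lemma K_0: "0 \<in> K" using K_minus[OF K_1 K_1] by simp
lemma K_uminus: "x \<in> K \<Longrightarrow> - x \<in> K" using K_minus[OF K_0] by simp
lemma K_add: "x \<in> K \<Longrightarrow> y \<in> K \<Longrightarrow> x + y \<in> K" using K_minus[of x "- y"] K_uminus[of y] by simp
lemma K_divide: "x \<in> K \<Longrightarrow> y \<in> K \<Longrightarrow> x / y \<in> K" by (simp add: divide_inverse K_mult K_inverse)
lemma K_power: "x \<in> K \<Longrightarrow> x ^ n \<in> K" by (induction n) (auto intro: K_1 K_mult)

lemma v_1: "v 1 = 0" using v_mult[OF K_1 K_1] by simp

lemma v_minus_1: "v (- 1) = 0"
  using v_mult[OF K_uminus[OF K_1] K_uminus[OF K_1]] v_1 by simp

lemma v_uminus: "x \<in> K \<Longrightarrow> v (- x) = v x"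
  using v_mult[OF K_uminus[OF K_1], of x] v_minus_1 by (cases "x = 0") auto

lemma v_inverse: "x \<in> K \<Longrightarrow> x \<noteq> 0 \<Longrightarrow> v (inverse x) = - v x"
  using v_mult[of x "inverse x"] K_inverse v_1 by simp

lemma v_divide: "x \<in> K \<Longrightarrow> y \<in> K \<Longrightarrow> x \<noteq> 0 \<Longrightarrow> y \<noteq> 0 \<Longrightarrow> v (x / y) = v x - v y"
  using v_mult[of x "inverse y"] K_inverse v_inverse by (simp add: divide_inverse)

lemma v_power: "x \<in> K \<Longrightarrow> x \<noteq> 0 \<Longrightarrow> v (x ^ n) = int n * v x"
  by (induction n) (auto simp: v_1 v_mult K_power algebra_simps)

lemma v_add_eq_min:
  assumes "x \<in> K" "y \<in> K" "x \<noteq> 0" "y \<noteq> 0" "v x \<noteq> v y"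
  shows "x + y \<noteq> 0" "v (x + y) = min (v x) (v y)"
proof -
  have *: "x + y \<noteq> 0 \<and> v (x + y) = v x"
    if "x \<in> K" "y \<in> K" "x \<noteq> 0" "y \<noteq> 0" "v x < v y" for x y
  proof -
    have 0: "x + y \<noteq> 0" using that v_uminus[of x] by (auto simp: add_eq_0_iff)
    have "min (v (x + y)) (v (- y)) \<le> v (x + y + - y)"
      using that 0 by (intro v_add K_add K_uminus) auto
    then show ?thesis using v_add[OF that(1-4) 0] v_uminus[OF that(2)] that(5) 0 by auto
  qed
  show "x + y \<noteq> 0" "v (x + y) = min (v x) (v y)"
    using *[of x y] *[of y x] assms by (cases "v x < v y"; auto simp: add.commute)+
qed

text \<open>The fractional ideal (\<pi>^n), with \<open>M 0\<close> the valuation ring; zero is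
  added by hand because v 0 has no meaning.\<close>

definition M :: "int \<Rightarrow> 'k set" where "M n = {x \<in> K. x = 0 \<or> n \<le> v x}"

lemma M_K: "x \<in> M n \<Longrightarrow> x \<in> K" by (simp add: M_def)
lemma M_0: "0 \<in> M n" by (simp add: M_def K_0)
lemma M_1: "1 \<in> M 0" by (simp add: M_def K_1 v_1)
lemma M_mono: "x \<in> M n \<Longrightarrow> k \<le> n \<Longrightarrow> x \<in> M k" by (auto simp: M_def)

lemma M_add: "x \<in> M n \<Longrightarrow> y \<in> M n \<Longrightarrow> x + y \<in> M n"
  using v_add[of x y] by (cases "x = 0"; cases "y = 0"; cases "x + y = 0") (auto simp: M_def K_add K_0)

lemma M_uminus: "x \<in> M n \<Longrightarrow> - x \<in> M n"
  by (auto simp: M_def K_uminus v_uminus)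

lemma M_diff: "x \<in> M n \<Longrightarrow> y \<in> M n \<Longrightarrow> x - y \<in> M n"
  using M_add[OF _ M_uminus] by fastforce

lemma M_mult: "x \<in> M a \<Longrightarrow> y \<in> M b \<Longrightarrow> n \<le> a + b \<Longrightarrow> x * y \<in> M n"
  by (cases "x = 0"; cases "y = 0") (auto simp: M_def K_mult K_0 v_mult)

lemma M_power: "x \<in> M a \<Longrightarrow> n \<le> int k * a \<Longrightarrow> x ^ k \<in> M n"
proof -
  assume x: "x \<in> M a" and n: "n \<le> int k * a"
  have "x ^ k \<in> M (int k * a)"
  proof (induction k)
    case 0
    then show ?case by (simp add: M_1)
  next
    case (Suc k)
    show ?case unfolding power_Suc by (rule M_mult[OF x Suc]) (simp add: algebra_simps)
  qed
  then show ?thesis using n M_mono by blast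
qed

lemma M_of_nat: "of_nat n \<in> M 0"
  by (induction n) (auto intro: M_0 M_1 M_add)

lemma M_numeral: "numeral n \<in> M 0"
  using M_of_nat[of "numeral n"] by simp

lemma unit_plus:
  assumes "x \<in> M 1" shows "1 - x \<noteq> 0" "1 - x \<in> M 0" "1 / (1 - x) \<in> M 0"
proof -
  show 0: "1 - x \<noteq> 0" using assms v_1 by (auto simp: M_def)
  show M: "1 - x \<in> M 0" by (intro M_diff M_1 M_mono[OF assms]) simp
  have "v (1 - x) = 0"
  proof (rule ccontr)
    assume "v (1 - x) \<noteq> 0"
    then have "1 - x \<in> M 1" using M 0 by (auto simp: M_def)
    then have "(1 - x) + x \<in> M 1" using assms by (rule M_add)
    then show False using v_1 by (simp add: M_def)
  qed
  then show "1 / (1 - x) \<in> M 0" using 0 M v_inverse[of "1 - x"] K_inverse[of "1 - x"]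
    by (auto simp: M_def divide_inverse)
qed

end

locale integral_short_curve = subfield_valuation K v for K :: "'k::field_char_0 set" and v +
  fixes A B :: 'k
  assumes A: "A \<in> M 0" and B: "B \<in> M 0" and nonsingular: "4 * A ^ 3 + 27 * B\<^sup>2 \<noteq> 0"
begin

abbreviation E where "E \<equiv> short_weierstrass A B"
abbreviation G where "G \<equiv> point_group E UNIV"

sublocale G: comm_group G by (rule comm_group_point_group_short[OF nonsingular])

fun kernel_param :: "'k point \<Rightarrow> 'k" where
  "kernel_param Infinity = 0"
| "kernel_param (Affine x y) = x / y"

text \<open>For n at least 1, the n-th step of the filtration of the kernel of reduction. The bound
  on s = 1 / y is the one that s = t^3 + A t s^2 + B s^3 leads to; it is carried along as part of
  the definition.\<close>

fun in_kernel :: "int \<Rightarrow> 'k point \<Rightarrow> bool" where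
  "in_kernel n Infinity \<longleftrightarrow> True"
| "in_kernel n (Affine x y) \<longleftrightarrow>
     on_curve E x y \<and> x \<in> K \<and> y \<in> K \<and> y \<noteq> 0 \<and> x / y \<in> M n \<and> 1 / y \<in> M (3 * n)"

text \<open>The slope \<alpha> has order at least 2 n and \<beta> = s1 - \<alpha> t1 order at least
  3 n, so the sum of the three parameters, a multiple of \<alpha> \<beta>, has order at least 5 n.
  The terms of degrees 2 to 4 of the general formal group law come with a1, a2, a3, which vanish
  here.\<close>

lemma kernel_add:
  assumes n: "n \<ge> 1" and P: "in_kernel n P" and Q: "in_kernel n Q"
  shows "in_kernel n (point_add E P Q)"
    and "kernel_param (point_add E P Q) - kernel_param P - kernel_param Q \<in> M (5 * n)"
proof -
  have "in_kernel n (point_add E P Q) \<and> kernel_param (point_add E P Q) - kernel_param P - kernel_param Q \<in> M (5 * n)"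
  proof (cases P; cases Q)
    fix x1 y1 x2 y2 assume PQ: "P = Affine x1 y1" "Q = Affine x2 y2"
    then have c: "on_curve E x1 y1" "on_curve E x2 y2" and K: "x1 \<in> K" "y1 \<in> K" "x2 \<in> K" "y2 \<in> K"
      and y: "y1 \<noteq> 0" "y2 \<noteq> 0" using P Q by auto
    then have c': "y1\<^sup>2 = x1 ^ 3 + A * x1 + B" "y2\<^sup>2 = x2 ^ 3 + A * x2 + B"
      by (simp_all add: on_curve_short)
    define t1 where "t1 = x1 / y1"
    define t2 where "t2 = x2 / y2"
    define s1 where "s1 = 1 / y1"
    define s2 where "s2 = 1 / y2"
    have ts: "t1 \<in> M n" "t2 \<in> M n" "s1 \<in> M (3 * n)" "s2 \<in> M (3 * n)"
      using P Q PQ by (simp_all add: t1_def t2_def s1_def s2_def)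
    show ?thesis
    proof (cases rule: point_add_short_cases[OF c, case_names opposite line])
      case opposite
      then show ?thesis using PQ M_0 y by simp
    next
      case (line l m x3)
      define u where "u = 1 - (A * t1 * (s1 + s2) + B * (s1\<^sup>2 + s1 * s2 + s2\<^sup>2))"
      have "A * t1 * (s1 + s2) + B * (s1\<^sup>2 + s1 * s2 + s2\<^sup>2) \<in> M 1"
      proof (intro M_add)
        have "A * t1 \<in> M n" using A ts by (intro M_mult) auto
        moreover have "s1 + s2 \<in> M (3 * n)" using ts by (intro M_add)
        ultimately show "A * t1 * (s1 + s2) \<in> M 1" by (rule M_mult) (use n in simp)
        have "s1\<^sup>2 + s1 * s2 + s2\<^sup>2 \<in> M (6 * n)"
          using ts by (auto intro!: M_add M_power M_mult)
        with B show "B * (s1\<^sup>2 + s1 * s2 + s2\<^sup>2) \<in> M 1" by (rule M_mult) (use n in simp)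
      qed
      note u = unit_plus[OF this, folded u_def]
      have u_eq: "u = 1 - A * t1 * (s1 + s2) - B * (s1\<^sup>2 + s1 * s2 + s2\<^sup>2)" by (simp add: u_def)
      have tan: "x1 = x2 \<Longrightarrow> 2 * y1 * l = 3 * x1\<^sup>2 + A" using line(4) by blast
      note slope = line_slope_parameter[OF c' y line(2,3) tan, folded t1_def t2_def s1_def s2_def, folded u_eq, OF _ u(1)]
      have m: "m \<noteq> 0" and \<alpha>_eq: "- l / m = (t1\<^sup>2 + t1 * t2 + t2\<^sup>2 + A * s2\<^sup>2) * (1 / u)"
        using slope by simp_all
      define \<alpha> where "\<alpha> = - l / m"
      define \<beta> where "\<beta> = 1 / m"
      have "t1\<^sup>2 + t1 * t2 + t2\<^sup>2 + A * s2\<^sup>2 \<in> M (2 * n)"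
      proof (intro M_add)
        have "s2\<^sup>2 \<in> M (6 * n)" using ts by (auto intro!: M_power)
        with A show "A * s2\<^sup>2 \<in> M (2 * n)" by (rule M_mult) (use n in simp)
      qed (use ts in \<open>auto intro!: M_power M_mult\<close>)
      then have \<alpha>: "\<alpha> \<in> M (2 * n)" unfolding \<alpha>_def \<alpha>_eq using u(3) by (rule M_mult) simp
      have "l * t1 + m * s1 = (l * x1 + m) / y1" by (simp add: t1_def s1_def add_divide_distrib)
      then have "l * t1 + m * s1 = 1" unfolding line(2)[symmetric] using y by simp
      then have "m * s1 = 1 - l * t1" by (simp add: algebra_simps)
      then have "\<beta> = s1 - \<alpha> * t1" using m by (simp add: \<alpha>_def \<beta>_def field_simps)
      moreover have "\<alpha> * t1 \<in> M (3 * n)" using \<alpha> ts by (intro M_mult) auto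
      ultimately have \<beta>: "\<beta> \<in> M (3 * n)" using ts M_diff by blast
      define c where "c = 1 + A * \<alpha>\<^sup>2 + B * \<alpha> ^ 3"
      have c_eq: "c = 1 - (- (A * \<alpha>\<^sup>2 + B * \<alpha> ^ 3))" by (simp add: c_def)
      have "- (A * \<alpha>\<^sup>2 + B * \<alpha> ^ 3) \<in> M 1"
      proof (intro M_uminus M_add)
        have "\<alpha>\<^sup>2 \<in> M (4 * n)" "\<alpha> ^ 3 \<in> M (6 * n)" using \<alpha> by (auto intro!: M_power)
        then show "A * \<alpha>\<^sup>2 \<in> M 1" "B * \<alpha> ^ 3 \<in> M 1" using A B n by (auto intro!: M_mult)
      qed
      note cu = unit_plus[OF this, folded c_eq]
      define y3 where "y3 = l * x3 + m"
      have y12: "l * x1 + m \<noteq> 0" "l * x2 + m \<noteq> 0" using y line by auto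
      note sum = line_sum_parameter[OF line(1) m y12, folded \<alpha>_def \<beta>_def, folded c_def, OF cu(1)]
      have y3: "y3 \<noteq> 0" using sum(1) by (simp add: y3_def)
      define d where "d = - (2 * A * \<alpha> * \<beta> + 3 * B * \<alpha>\<^sup>2 * \<beta>) / c"
      have d: "t1 + t2 + x3 / y3 = d" using sum(2) line(2,3) by (simp add: t1_def t2_def y3_def d_def)
      have "- (2 * A * \<alpha> * \<beta> + 3 * B * \<alpha>\<^sup>2 * \<beta>) \<in> M (5 * n)"
      proof (intro M_uminus M_add)
        have "2 * A \<in> M 0" "3 * B \<in> M 0" using A B by (auto intro!: M_mult[OF M_numeral])
        moreover have "\<alpha>\<^sup>2 \<in> M (4 * n)" using \<alpha> by (auto intro!: M_power)
        ultimately have "2 * A * \<alpha> \<in> M (2 * n)" "3 * B * \<alpha>\<^sup>2 \<in> M (4 * n)"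
          using \<alpha> by (auto intro: M_mult)
        then show "2 * A * \<alpha> * \<beta> \<in> M (5 * n)" "3 * B * \<alpha>\<^sup>2 * \<beta> \<in> M (5 * n)"
          using \<beta> n by (auto intro: M_mult)
      qed
      then have "- (2 * A * \<alpha> * \<beta> + 3 * B * \<alpha>\<^sup>2 * \<beta>) * (1 / c) \<in> M (5 * n)"
        using cu(3) by (rule M_mult) simp
      then have dM: "d \<in> M (5 * n)" by (simp add: d_def)
      have t3: "x3 / y3 = d - t1 - t2" using d by (simp add: algebra_simps)
      have t3M: "x3 / y3 \<in> M n" unfolding t3
        using ts dM n by (intro M_diff) (auto intro: M_mono)
      have "\<alpha> * (x3 / y3) + \<beta> = (y3 - l * x3) / (m * y3)"
        using y3 m by (simp add: \<alpha>_def \<beta>_def field_simps)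
      also have "y3 - l * x3 = m" by (simp add: y3_def)
      finally have "1 / y3 = \<alpha> * (x3 / y3) + \<beta>" using m by simp
      moreover have "\<alpha> * (x3 / y3) \<in> M (3 * n)" using \<alpha> t3M by (intro M_mult) auto
      ultimately have s3M: "1 / y3 \<in> M (3 * n)" using \<beta> M_add by auto
      have "y3 = 1 / (1 / y3)" "x3 = (x3 / y3) * y3" using y3 by auto
      then have K3: "y3 \<in> K" "x3 \<in> K" using K_divide[OF K_1 M_K[OF s3M]] K_mult[OF M_K[OF t3M]] by metis+
      have add: "point_add E P Q = Affine x3 (- y3)" using line PQ by (simp add: y3_def)
      have "on_curve E x3 (- y3)" unfolding on_curve_short_neg y3_def
        by (rule line_meets_on_curve[OF line(1)])
      then have ker: "in_kernel n (Affine x3 (- y3))"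
        using K3 y3 M_uminus[OF t3M] M_uminus[OF s3M] by (simp add: K_uminus)
      \<comment> \<open>P + Q is the reflection of the third point, so its parameter is - x3 /
        y3.\<close>
      have "kernel_param (Affine x3 (- y3)) - kernel_param P - kernel_param Q = - d"
        unfolding d[symmetric] by (simp add: PQ t1_def t2_def)
      then show ?thesis using ker M_uminus[OF dM] unfolding add by simp
    qed
  qed (use P Q M_0 in \<open>auto simp: M_0\<close>)
  then show "in_kernel n (point_add E P Q)"
    and "kernel_param (point_add E P Q) - kernel_param P - kernel_param Q \<in> M (5 * n)" by auto
qed

text \<open>The error stays in \<open>M (5 * n)\<close> however often P is added, since this is an
  additive group.\<close>

lemma kernel_pow:
  assumes n: "n \<ge> 1" and P: "in_kernel n P"
  shows "in_kernel n (P [^]\<^bsub>G\<^esub> (k::nat)) \<and>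
    kernel_param (P [^]\<^bsub>G\<^esub> k) - of_nat k * kernel_param P \<in> M (5 * n)"
proof (induction k)
  case 0
  then show ?case by (simp add: point_group_def M_0)
next
  case (Suc k)
  have pow: "P [^]\<^bsub>G\<^esub> Suc k = point_add E (P [^]\<^bsub>G\<^esub> k) P" by (simp add: point_group_def)
  note add = kernel_add[OF n conjunct1[OF Suc] P, folded pow]
  have "kernel_param (P [^]\<^bsub>G\<^esub> Suc k) - of_nat (Suc k) * kernel_param P =
      (kernel_param (P [^]\<^bsub>G\<^esub> Suc k) - kernel_param (P [^]\<^bsub>G\<^esub> k) - kernel_param P)
      + (kernel_param (P [^]\<^bsub>G\<^esub> k) - of_nat k * kernel_param P)"
    by (simp add: algebra_simps)
  also have "\<dots> \<in> M (5 * n)" by (rule M_add[OF add(2) conjunct2[OF Suc]])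
  finally show ?case using add(1) pow by metis
qed

text \<open>For v x < 0 the term x^3 dominates: y^2 = x^3 (1 + w) with 1 + w a unit, so 2 v y = 3 v
  x, which forces v x = -2 n and v y = -3 n.\<close>

lemma nonintegral_in_kernel:
  assumes "on_curve E x y" "x \<in> K" "y \<in> K" "x \<notin> M 0"
  obtains n where "n \<ge> 1" "in_kernel n (Affine x y)" "v (x / y) = n" "x \<noteq> 0" "y \<noteq> 0"
proof -
  have x0: "x \<noteq> 0" "v x < 0" using assms by (auto simp: M_def)
  define w where "w = A / x\<^sup>2 + B / x ^ 3"
  have c: "y\<^sup>2 = x ^ 3 * (1 - (- w))"
  proof -
    have "x ^ 3 * (1 - (- w)) = x ^ 3 + A * x + B"
      using x0 by (simp add: w_def field_simps power2_eq_square power3_eq_cube)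
    then show ?thesis using assms(1) by (simp add: on_curve_short)
  qed
  have inv: "1 / x ^ k \<in> M (- int k * v x)" for k
    using x0 assms(2) v_inverse[of "x ^ k"] v_power[of x k] K_power[of x k] K_inverse[of "x ^ k"]
    by (auto simp: M_def divide_inverse)
  have "w = A * (1 / x\<^sup>2) + B * (1 / x ^ 3)" by (simp add: w_def)
  moreover have "A * (1 / x\<^sup>2) \<in> M 1" "B * (1 / x ^ 3) \<in> M 1"
    using M_mult[OF A inv[of 2]] M_mult[OF B inv[of 3]] x0 by auto
  ultimately have w: "- w \<in> M 1" using M_add M_uminus by metis
  note u = unit_plus[OF w]
  have vu: "v (1 - (- w)) = 0"
    using u v_inverse[of "1 - (- w)"] M_K[OF u(2)] by (auto simp: M_def divide_inverse)
  have "y\<^sup>2 \<noteq> 0" unfolding c using u(1) x0 by simp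
  then have y0: "y \<noteq> 0" by auto
  have "2 * v y = v (y\<^sup>2)" using v_power[OF assms(3) y0, of 2] by simp
  also have "\<dots> = 3 * v x" unfolding c
    using v_mult[of "x ^ 3" "1 - (- w)"] v_power[OF assms(2) x0(1), of 3] vu u(1) x0 M_K[OF u(2)] K_power[OF assms(2)] by simp
  finally have vy: "2 * v y = 3 * v x" .
  define n where "n = v (x / y)"
  have n: "n = v x - v y" using v_divide[OF assms(2,3) x0(1) y0] by (simp add: n_def)
  have n1: "n \<ge> 1" using n vy x0(2) by presburger
  have vy': "v y = - 3 * n" using n vy by presburger
  have "in_kernel n (Affine x y)"
  proof -
    have "x / y \<in> M n" using K_divide[OF assms(2,3)] by (simp add: M_def n_def)
    moreover have "v (1 / y) = 3 * n" using v_inverse[OF assms(3) y0] vy' by (simp add: divide_inverse)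
    then have "1 / y \<in> M (3 * n)" using K_divide[OF K_1 assms(3)] by (simp add: M_def)
    ultimately show ?thesis using assms y0 by simp
  qed
  then show thesis by (rule that[OF n1 _ n_def[symmetric] x0(1) y0])
qed

theorem kernel_torsion_free:
  assumes primes: "\<And>q. Factorial_Ring.prime q \<Longrightarrow> v (of_nat q) \<le> 2"
    and P: "n \<ge> 1" "in_kernel n P" "P \<noteq> Infinity"
  shows "P \<notin> torsion G"
proof
  assume "P \<in> torsion G"
  then obtain j :: nat where j: "j > 0" "P [^]\<^bsub>G\<^esub> j = \<one>\<^bsub>G\<^esub>" "P \<in> carrier G" by (auto simp: torsion_def)
  have one: "\<one>\<^bsub>G\<^esub> = Infinity" by (simp add: point_group_def)
  \<comment> \<open>Strong induction on the exponent j: for a prime q dividing j, either the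
    multiple of P by j / q is already \<open>Infinity\<close>, or it is a point of order q.\<close>
  have "\<exists>Q q. Factorial_Ring.prime q \<and> in_kernel n Q \<and> Q \<noteq> Infinity \<and> Q [^]\<^bsub>G\<^esub> (q::nat) = Infinity"
    using j(1,2)
  proof (induction j rule: less_induct)
    case (less j)
    have "j \<noteq> 1" using less.prems P(3) G.nat_pow_eone[OF j(3)] one by auto
    then obtain q where q: "Factorial_Ring.prime q" "q dvd j" using prime_factor_nat by blast
    then obtain i where i: "j = i * q" by (metis dvdE mult.commute)
    have i': "i < j" "0 < i" using prime_gt_1_nat[OF q(1)] i less.prems by auto
    show ?case
    proof (cases "P [^]\<^bsub>G\<^esub> i = Infinity")
      case True
      then show ?thesis using less.IH[OF i'] one by simp
    next
      case False
      have "(P [^]\<^bsub>G\<^esub> i) [^]\<^bsub>G\<^esub> q = Infinity"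
        using G.nat_pow_pow[OF j(3)] less.prems i one by simp
      then show ?thesis using q kernel_pow[OF P(1,2), of i] False by blast
    qed
  qed
  then obtain Q q where Q: "Factorial_Ring.prime q" "in_kernel n Q" "Q \<noteq> Infinity" "Q [^]\<^bsub>G\<^esub> (q::nat) = Infinity" by blast
  then obtain x y where xy: "Q = Affine x y" by (cases Q) auto
  then have xy': "on_curve E x y" "x \<in> K" "y \<in> K" "1 / y \<in> M (3 * n)" "x / y \<in> M n" "y \<noteq> 0" using Q by auto
  have "x \<notin> M 0"
  proof
    assume x: "x \<in> M 0"
    have "y\<^sup>2 = x ^ 3 + A * x + B" using xy' by (simp add: on_curve_short)
    also have "\<dots> \<in> M 0" using x A B by (auto intro!: M_add M_power M_mult)
    finally have "y\<^sup>2 \<in> M 0" .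
    then have "v y \<ge> 0" using xy' v_power[of y 2] by (auto simp: M_def)
    moreover have "v y \<le> - 3 * n" using xy' v_inverse[of y] by (auto simp: M_def divide_inverse)
    ultimately show False using P by simp
  qed
  \<comment> \<open>The level n is only a lower bound; the estimate needs the exact valuation k of
    the parameter.\<close>
  then obtain k where k: "k \<ge> 1" "in_kernel k (Affine x y)" "v (x / y) = k" "x \<noteq> 0"
    using nonintegral_in_kernel[OF xy'(1-3)] by metis
  have "in_kernel k Q" using k(2) xy by simp
  from conjunct2[OF kernel_pow[OF k(1) this, of q]] have "- (of_nat q * (x / y)) \<in> M (5 * k)"
    unfolding Q(4) unfolding xy by simp
  from M_uminus[OF this] have "of_nat q * (x / y) \<in> M (5 * k)" by simp
  moreover have "of_nat q \<noteq> (0::'k)" using Q prime_gt_0_nat by auto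
  ultimately have "5 * k \<le> v (of_nat q) + v (x / y)"
    using xy' k v_mult[of "of_nat q" "x / y"] M_K[OF M_of_nat[of q]] K_divide by (auto simp: M_def)
  then show False using primes[OF Q(1)] k by simp
qed

end

section \<open>The p-adic valuation on the rationals\<close>

lemma padic_val_frac:
  assumes p: "Factorial_Ring.prime p" and "a \<noteq> 0" "b \<noteq> 0"
  shows "padic_val p (of_int a / of_int b) = int (multiplicity (int p) a) - int (multiplicity (int p) b)"
proof -
  let ?q = "of_int a / of_int b :: rat"
  obtain m n where mn: "quotient_of ?q = (m, n)" by fastforce
  have n: "n > 0" using quotient_of_denom_pos[OF mn] .
  have "?q = of_int m / of_int n" using quotient_of_div[OF mn] .
  then have "of_int a * of_int n = (of_int m * of_int b :: rat)"
    using assms n by (simp add: field_simps)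
  then have eq: "a * n = m * b" by (metis of_int_eq_iff of_int_mult)
  then have m: "m \<noteq> 0" using assms n by auto
  have pe: "prime_elem (int p)" using p by (simp add: prime_imp_prime_elem)
  have "multiplicity (int p) a + multiplicity (int p) n = multiplicity (int p) m + multiplicity (int p) b"
    using arg_cong[OF eq, of "multiplicity (int p)"] assms n m
    by (simp add: prime_elem_multiplicity_mult_distrib[OF pe])
  then show ?thesis by (simp add: padic_val_def mn)
qed

lemma rat_frac_cases:
  fixes x :: rat assumes "x \<noteq> 0"
  obtains a b where "x = of_int a / of_int b" "a \<noteq> 0" "b \<noteq> 0"
  using assms by (cases x) (auto simp: Fract_of_int_quotient)

lemma padic_val_mult:
  assumes p: "Factorial_Ring.prime p" and "x \<noteq> 0" "y \<noteq> 0"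
  shows "padic_val p (x * y) = padic_val p x + padic_val p y"
proof -
  obtain a b where x: "x = of_int a / of_int b" "a \<noteq> 0" "b \<noteq> 0" using assms rat_frac_cases by blast
  obtain c d where y: "y = of_int c / of_int d" "c \<noteq> 0" "d \<noteq> 0" using assms rat_frac_cases by blast
  have pe: "prime_elem (int p)" using p by (simp add: prime_imp_prime_elem)
  have "x * y = of_int (a * c) / of_int (b * d)" using x y by simp
  then have "padic_val p (x * y) = int (multiplicity (int p) (a * c)) - int (multiplicity (int p) (b * d))"
    using x y padic_val_frac[OF p, of "a * c" "b * d"] by simp
  then show ?thesis using x y padic_val_frac[OF p] by (simp add: prime_elem_multiplicity_mult_distrib[OF pe])
qed

lemma padic_val_add:
  assumes p: "Factorial_Ring.prime p" and "x \<noteq> 0" "y \<noteq> 0" "x + y \<noteq> 0"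
  shows "min (padic_val p x) (padic_val p y) \<le> padic_val p (x + y)"
proof -
  obtain a b where x: "x = of_int a / of_int b" "a \<noteq> 0" "b \<noteq> 0" using assms rat_frac_cases by blast
  obtain c d where y: "y = of_int c / of_int d" "c \<noteq> 0" "d \<noteq> 0" using assms rat_frac_cases by blast
  have pe: "prime_elem (int p)" using p by (simp add: prime_imp_prime_elem)
  then have nu: "\<not> is_unit (int p)" by auto
  let ?m = "multiplicity (int p)"
  have x': "x = of_int (a * d) / of_int (b * d)" and y': "y = of_int (c * b) / of_int (b * d)"
    and xy: "x + y = of_int (a * d + c * b) / of_int (b * d)"
    using x y by (simp_all add: field_simps)
  have ne: "a * d + c * b \<noteq> 0" using assms(4) xy by (metis div_0 of_int_0)
  let ?k = "min (?m (a * d)) (?m (c * b))"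
  have "int p ^ ?k dvd a * d" "int p ^ ?k dvd c * b" by (simp_all add: multiplicity_dvd')
  then have "int p ^ ?k dvd a * d + c * b" by (rule dvd_add)
  then have "?k \<le> ?m (a * d + c * b)" using ne nu by (intro multiplicity_geI)
  moreover have "padic_val p x = int (?m (a * d)) - int (?m (b * d))"
    "padic_val p y = int (?m (c * b)) - int (?m (b * d))"
    "padic_val p (x + y) = int (?m (a * d + c * b)) - int (?m (b * d))"
    unfolding xy unfolding x' y' using x y ne by (intro padic_val_frac[OF p]; simp)+
  ultimately show ?thesis by linarith
qed

lemma padic_valuation: "Factorial_Ring.prime p \<Longrightarrow> subfield_valuation UNIV (padic_val p)"
  by standard (auto intro: padic_val_mult padic_val_add)

lemma padic_val_of_nat:
  assumes "Factorial_Ring.prime p" "n \<noteq> 0" shows "padic_val p (of_nat n) = int (multiplicity (int p) (int n))"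
  using padic_val_frac[OF assms(1), of "int n" 1] assms(2) by simp

lemma padic_integral_denominator:
  assumes p: "Factorial_Ring.prime p" and "padic_integral p x"
  obtains a m :: int where "x = of_int a / of_int m" "m \<noteq> 0" "\<not> int p dvd m"
proof -
  obtain a m where q: "quotient_of x = (a, m)" by fastforce
  have m: "m > 0" and x: "x = of_int a / of_int m" and c: "coprime a m"
    using quotient_of_denom_pos[OF q] quotient_of_div[OF q] quotient_of_coprime[OF q] by auto
  have pi: "Factorial_Ring.prime (int p)" using p by simp
  have "\<not> int p dvd m"
  proof
    assume d: "int p dvd m"
    then have na: "\<not> int p dvd a" using c pi by (meson coprime_common_divisor not_prime_unit)
    then have "a \<noteq> 0" by auto
    then have "x \<noteq> 0" using x m by simp
    then have "padic_val p x \<ge> 0" using assms by (simp add: padic_integral_def)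
    moreover have "multiplicity (int p) a = 0" using na by (simp add: not_dvd_imp_multiplicity_0)
    moreover have "multiplicity (int p) m > 0" using d m pi by (simp add: prime_multiplicity_gt_zero_iff)
    ultimately show False by (simp add: padic_val_def q)
  qed
  then show thesis using that[OF x] m by simp
qed

section \<open>Quadratic fields\<close>

lemma ambient_simps [simp]:
  "carrier (ambient :: 'a::field ring) = UNIV" "x \<otimes>\<^bsub>ambient\<^esub> y = x * y" "x \<oplus>\<^bsub>ambient\<^esub> y = x + y"
  "\<one>\<^bsub>ambient\<^esub> = (1::'a)" "\<zero>\<^bsub>ambient\<^esub> = (0::'a)"
  by (simp_all add: ring_of_type_algebra_def)

lemma subfield_ambient_closed:
  fixes K :: "'a::field set"
  assumes "subfield K ambient"
  shows "1 \<in> K" "x \<in> K \<Longrightarrow> y \<in> K \<Longrightarrow> x - y \<in> K" "x \<in> K \<Longrightarrow> y \<in> K \<Longrightarrow> x * y \<in> K"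
    "x \<in> K \<Longrightarrow> inverse x \<in> K"
proof -
  interpret F: field "ambient :: 'a ring" by (rule field_from_type_algebra)
  note S = subringE[OF subfieldE(1)[OF assms]]
  show "1 \<in> K" using S(3) by simp
  show m: "x \<in> K \<Longrightarrow> y \<in> K \<Longrightarrow> x * y \<in> K" for x y using S(6)[of x y] by simp
  show "x - y \<in> K" if "x \<in> K" "y \<in> K"
  proof -
    have "\<ominus>\<^bsub>ambient\<^esub> y \<in> K" using S(5) that by simp
    moreover have "\<ominus>\<^bsub>ambient\<^esub> y = - y"
      using F.l_neg[of y] by (simp add: eq_neg_iff_add_eq_0)
    ultimately show ?thesis using S(7)[of x "- y"] that by simp
  qed
  show "inverse x \<in> K" if "x \<in> K"
  proof (cases "x = 0")
    case False
    then have "inv\<^bsub>ambient\<^esub> x \<in> K" using F.subfield_m_inv(1)[OF assms, of x] that by simp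
    moreover have "inv\<^bsub>ambient\<^esub> x = inverse x"
      using F.subfield_m_inv(2)[OF assms, of x] that False by (simp add: inverse_unique)
    ultimately show ?thesis by simp
  qed (use that in simp)
qed

text \<open>Two steps of the inductive definition of \<open>dimension\<close>, each a line extension
  of the previous space.\<close>

lemma quadratic_field_basis:
  fixes K :: "'k::field_char_0 set"
  assumes "quadratic_field K"
  obtains a b where "a \<noteq> 0" "b \<notin> {of_rat r * a | r. True}" "K = {of_rat r * a + of_rat s * b | r s. True}"
proof -
  interpret R: ring "ambient :: 'k ring" by (rule ring_from_type_algebra)
  have "R.dimension (Suc (Suc 0)) \<rat> K" using assms by (simp add: quadratic_field_def numeral_2_eq_2)
  then obtain b E1 where b: "b \<notin> E1" "R.dimension (Suc 0) \<rat> E1" "K = R.line_extension \<rat> b E1"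
    by (cases rule: R.dimension.cases) auto
  from b(2) obtain a E0 where a: "a \<notin> E0" "R.dimension 0 \<rat> E0" "E1 = R.line_extension \<rat> a E0"
    by (cases rule: R.dimension.cases) auto
  from a(2) have E0: "E0 = {0}" by (cases rule: R.dimension.cases) auto
  have E1: "E1 = {of_rat r * a | r. True}"
    unfolding a(3) E0 by (auto simp: R.line_extension_mem_iff Rats_def)
  have "K = {of_rat r * a + of_rat s * b | r s. True}"
    unfolding b(3) E1 by (auto simp: R.line_extension_mem_iff Rats_def) (metis add.commute)+
  moreover have "a \<noteq> 0" "b \<notin> {of_rat r * a | r. True}" using a(1) b(1) E0 E1 by auto
  ultimately show thesis using that by blast
qed

text \<open>Dividing the basis by its first vector gives 1, \<theta>; completing the square in the
  quadratic equation of \<theta> gives \<delta> = \<theta> - s / 2.\<close>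

lemma quadratic_field_sqrt:
  fixes K :: "'k::field_char_0 set"
  assumes "quadratic_field K"
  obtains \<delta> d where "\<delta>\<^sup>2 = of_rat d" "\<delta> \<notin> \<rat>" "K = {of_rat r + of_rat s * \<delta> | r s. True}"
proof -
  obtain a b where ab: "a \<noteq> 0" "b \<notin> {of_rat r * a | r. True}" "K = {of_rat r * a + of_rat s * b | r s. True}"
    using quadratic_field_basis[OF assms] .
  note K = subfield_ambient_closed[of K]
  have sf: "subfield K ambient" using assms by (simp add: quadratic_field_def)
  define \<theta> where "\<theta> = b / a"
  have b: "b = \<theta> * a" using ab by (simp add: \<theta>_def)
  have aK: "a \<in> K"
    unfolding ab(3) by (rule CollectI, rule exI[of _ 1], rule exI[of _ 0]) simp
  have K_eq: "K = {of_rat r + of_rat s * \<theta> | r s. True}"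
  proof (intro equalityI subsetI)
    fix x assume "x \<in> K"
    then have "x * a \<in> K" using K(3)[OF sf] aK by auto
    then obtain r s where "x * a = of_rat r * a + of_rat s * b" unfolding ab(3) by auto
    then have "x * a = (of_rat r + of_rat s * \<theta>) * a" by (simp add: b algebra_simps)
    then have "x = of_rat r + of_rat s * \<theta>" using ab(1) by (metis mult_cancel_right)
    then show "x \<in> {of_rat r + of_rat s * \<theta> | r s. True}" by auto
  next
    fix x assume "x \<in> {of_rat r + of_rat s * \<theta> | r s. True}"
    then obtain r s where x: "x = of_rat r + of_rat s * \<theta>" by auto
    have "of_rat r * a + of_rat s * b \<in> K" unfolding ab(3) by auto
    then have "(of_rat r * a + of_rat s * b) * inverse a \<in> K" using K(3,4)[OF sf] aK by auto
    also have "(of_rat r * a + of_rat s * b) * inverse a = x" using ab(1) by (simp add: x b field_simps)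
    finally show "x \<in> K" .
  qed
  have "\<theta> \<in> K" unfolding K_eq by (rule CollectI, rule exI[of _ 0], rule exI[of _ 1]) simp
  then have "\<theta> * \<theta> \<in> K" using K(3)[OF sf] by auto
  then obtain r s where \<theta>: "\<theta> * \<theta> = of_rat r + of_rat s * \<theta>" unfolding K_eq by auto
  define \<delta> where "\<delta> = \<theta> - of_rat (s / 2)"
  have \<theta>_eq: "\<theta> = of_rat (s / 2) + \<delta>" by (simp add: \<delta>_def)
  have "\<delta>\<^sup>2 = \<theta> * \<theta> - of_rat s * \<theta> + of_rat (s / 2) ^ 2"
    by (simp add: \<delta>_def algebra_simps power2_eq_square of_rat_divide)
  also have "\<dots> = of_rat (r + (s / 2)\<^sup>2)" unfolding \<theta> by (simp add: of_rat_add of_rat_power)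
  finally have 1: "\<delta>\<^sup>2 = of_rat (r + (s / 2)\<^sup>2)" .
  have "\<theta> \<notin> \<rat>"
  proof
    assume "\<theta> \<in> \<rat>"
    then obtain q where "\<theta> = of_rat q" by (auto elim: Rats_cases)
    then show False using ab(2) b by auto
  qed
  then have 2: "\<delta> \<notin> \<rat>" unfolding \<theta>_eq by (auto intro: Rats_add)
  have "{of_rat r + of_rat s * \<theta> | r s. True} = {of_rat r + of_rat s * \<delta> | r s. True}"
  proof (intro equalityI subsetI)
    fix x assume "x \<in> {of_rat r + of_rat s * \<theta> | r s. True}"
    then obtain r' s' where "x = of_rat r' + of_rat s' * \<theta>" by auto
    then have "x = of_rat (r' + s' * (s / 2)) + of_rat s' * \<delta>"
      unfolding \<theta>_eq by (simp add: of_rat_add of_rat_mult of_rat_divide algebra_simps)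
    then show "x \<in> {of_rat r + of_rat s * \<delta> | r s. True}" by blast
  next
    fix x assume "x \<in> {of_rat r + of_rat s * \<delta> | r s. True}"
    then obtain r' s' where "x = of_rat r' + of_rat s' * \<delta>" by auto
    then have "x = of_rat (r' - s' * (s / 2)) + of_rat s' * \<theta>"
      unfolding \<theta>_eq by (simp add: of_rat_diff of_rat_mult of_rat_divide algebra_simps)
    then show "x \<in> {of_rat r + of_rat s * \<theta> | r s. True}" by blast
  qed
  then show thesis using that[OF 1 2] K_eq by simp
qed

text \<open>Scaling \<delta> by a nonzero rational changes d by a square; the factor p^(-k) with k =
  v(d) div 2 leaves only the parity of v(d).\<close>

lemma quadratic_field_sqrt_normalized:
  fixes K :: "'k::field_char_0 set"
  assumes K: "quadratic_field K" and p: "Factorial_Ring.prime p"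
  obtains \<delta> d where "\<delta>\<^sup>2 = of_rat d" "\<delta> \<notin> \<rat>" "K = {of_rat r + of_rat s * \<delta> | r s. True}"
    "padic_val p d = 0 \<or> padic_val p d = 1"
proof -
  interpret Q: subfield_valuation UNIV "padic_val p" by (rule padic_valuation[OF p])
  obtain \<delta> d where d: "\<delta>\<^sup>2 = of_rat d" "\<delta> \<notin> \<rat>" "K = {of_rat r + of_rat s * \<delta> | r s. True}"
    using quadratic_field_sqrt[OF K] .
  have d0: "d \<noteq> 0" using d(1,2) by auto
  define k where "k = padic_val p d div 2"
  have p0: "(of_nat p :: rat) \<noteq> 0" using p by (simp add: prime_gt_0_nat)
  have vp: "padic_val p (of_nat p) = 1" using padic_val_of_nat[OF p, of p] p0 p by auto
  define c where "c = (if k \<ge> 0 then inverse (of_nat p ^ nat k) else of_nat p ^ nat (- k) :: rat)"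
  have c: "c \<noteq> 0" "padic_val p c = - k"
    using p0 vp Q.v_power[of "of_nat p"] Q.v_inverse[of "of_nat p ^ nat k"] by (auto simp: c_def)
  have "padic_val p (c\<^sup>2 * d) = padic_val p d - 2 * k"
    using c d0 Q.v_mult[of "c\<^sup>2" d] Q.v_power[of c 2] by simp
  then have v: "padic_val p (c\<^sup>2 * d) = 0 \<or> padic_val p (c\<^sup>2 * d) = 1" unfolding k_def by presburger
  show thesis
  proof (rule that[of "of_rat c * \<delta>" "c\<^sup>2 * d"])
    show "(of_rat c * \<delta>)\<^sup>2 = of_rat (c\<^sup>2 * d)" by (simp add: power_mult_distrib d of_rat_mult of_rat_power)
    show "of_rat c * \<delta> \<notin> \<rat>"
    proof
      assume "of_rat c * \<delta> \<in> \<rat>"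
      then have "of_rat c * \<delta> / of_rat c \<in> \<rat>" by (intro Rats_divide) auto
      then show False using c d by simp
    qed
    show "K = {of_rat r + of_rat s * (of_rat c * \<delta>) | r s. True}" unfolding d(3)
    proof (intro equalityI subsetI)
      fix x assume "x \<in> {of_rat r + of_rat s * \<delta> | r s. True}"
      then obtain r s where "x = of_rat r + of_rat s * \<delta>" by auto
      then have "x = of_rat r + of_rat (s / c) * (of_rat c * \<delta>)" using c by (simp add: of_rat_divide)
      then show "x \<in> {of_rat r + of_rat s * (of_rat c * \<delta>) | r s. True}" by blast
    next
      fix x assume "x \<in> {of_rat r + of_rat s * (of_rat c * \<delta>) | r s. True}"
      then obtain r s where "x = of_rat r + of_rat s * (of_rat c * \<delta>)" by auto
      then have "x = of_rat r + of_rat (s * c) * \<delta>" by (simp add: of_rat_mult)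
      then show "x \<in> {of_rat r + of_rat s * \<delta> | r s. True}" by blast
    qed
    show "padic_val p (c\<^sup>2 * d) = 0 \<or> padic_val p (c\<^sup>2 * d) = 1" by (rule v)
  qed
qed

section \<open>Explicit arithmetic in Q(sqrt d)\<close>

locale sqrt_field =
  fixes K :: "'k::field_char_0 set" and \<delta> :: 'k and d :: rat and p :: nat
  assumes p: "Factorial_Ring.prime p" and p_odd: "p \<noteq> 2"
    and \<delta>: "\<delta>\<^sup>2 = of_rat d" "\<delta> \<notin> \<rat>"
    and K_eq: "K = {of_rat r + of_rat s * \<delta> | r s. True}"
begin

sublocale Q: subfield_valuation UNIV "padic_val p" by (rule padic_valuation[OF p])

definition elt :: "rat \<Rightarrow> rat \<Rightarrow> 'k" where "elt a b = of_rat a + of_rat b * \<delta>"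

lemma K_elt: "x \<in> K \<longleftrightarrow> (\<exists>a b. x = elt a b)" by (auto simp: K_eq elt_def)

lemma elt_eq_iff: "elt a b = elt a' b' \<longleftrightarrow> a = a' \<and> b = b'"
proof
  assume *: "elt a b = elt a' b'"
  have "b = b'"
  proof (rule ccontr)
    assume "b \<noteq> b'"
    then have "\<delta> = of_rat ((a' - a) / (b - b'))"
      using * by (simp add: elt_def of_rat_divide of_rat_diff field_simps)
    then show False using \<delta>(2) by simp
  qed
  then show "a = a' \<and> b = b'" using * by (simp add: elt_def)
qed simp

lemma elt_0: "elt 0 0 = 0" by (simp add: elt_def)
lemma elt_eq_0_iff: "elt a b = 0 \<longleftrightarrow> a = 0 \<and> b = 0" using elt_eq_iff[of a b 0 0] by (simp add: elt_0)
lemma elt_of_rat: "elt a 0 = of_rat a" by (simp add: elt_def)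
lemma elt_add: "elt a b + elt a' b' = elt (a + a') (b + b')"
  by (simp add: elt_def of_rat_add algebra_simps)
lemma elt_diff: "elt a b - elt a' b' = elt (a - a') (b - b')"
  by (simp add: elt_def of_rat_diff algebra_simps)
lemma elt_mult: "elt a b * elt a' b' = elt (a * a' + d * b * b') (a * b' + a' * b)"
proof -
  have "elt a b * elt a' b' = of_rat a * of_rat a' + of_rat b * of_rat b' * \<delta>\<^sup>2
      + (of_rat a * of_rat b' + of_rat a' * of_rat b) * \<delta>"
    by (simp add: elt_def algebra_simps power2_eq_square)
  then show ?thesis unfolding \<delta> by (simp add: elt_def of_rat_add of_rat_mult algebra_simps)
qed

lemma d_nonzero: "d \<noteq> 0" using \<delta> by auto

lemma K_Rats: "of_rat r \<in> K" using K_elt elt_of_rat by metis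

text \<open>Coordinates in the basis 1, \<delta> are unique on K; outside K the value is
  unspecified.\<close>

definition conjugate :: "'k \<Rightarrow> 'k" where
  "conjugate x = (THE y. \<exists>a b. x = elt a b \<and> y = elt a (- b))"

lemma conjugate_elt: "conjugate (elt a b) = elt a (- b)"
  unfolding conjugate_def by (rule the_equality) (auto simp: elt_eq_iff)

text \<open>Taken in \<open>rat\<close>, so that the p-adic valuation applies to it.\<close>

definition field_norm :: "'k \<Rightarrow> rat" where
  "field_norm x = (THE r. of_rat r = x * conjugate x)"

lemma field_norm_elt: "field_norm (elt a b) = a\<^sup>2 - d * b\<^sup>2"
proof -
  have "elt a b * conjugate (elt a b) = of_rat (a\<^sup>2 - d * b\<^sup>2)"
    by (simp add: conjugate_elt elt_mult power2_eq_square mult.assoc flip: elt_of_rat)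
  then show ?thesis unfolding field_norm_def by (intro the_equality) auto
qed

lemma field_norm_nonzero: "x \<in> K \<Longrightarrow> x \<noteq> 0 \<Longrightarrow> field_norm x \<noteq> 0"
proof -
  assume "x \<in> K" "x \<noteq> 0"
  then obtain a b where x: "x = elt a b" "a \<noteq> 0 \<or> b \<noteq> 0" using K_elt elt_eq_0_iff by metis
  have "elt a b * elt a (- b) \<noteq> 0" using x by (simp add: elt_eq_0_iff)
  then show "field_norm x \<noteq> 0" by (simp add: x field_norm_elt elt_mult elt_eq_0_iff power2_eq_square)
qed

lemma field_norm_mult: "x \<in> K \<Longrightarrow> y \<in> K \<Longrightarrow> field_norm (x * y) = field_norm x * field_norm y"
  by (auto simp: K_elt elt_mult field_norm_elt algebra_simps power2_eq_square)

lemma K_closed: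
  "1 \<in> K" "x \<in> K \<Longrightarrow> y \<in> K \<Longrightarrow> x - y \<in> K" "x \<in> K \<Longrightarrow> y \<in> K \<Longrightarrow> x * y \<in> K" "x \<in> K \<Longrightarrow> inverse x \<in> K"
proof -
  show "1 \<in> K" using K_Rats[of 1] by simp
  show "x \<in> K \<Longrightarrow> y \<in> K \<Longrightarrow> x - y \<in> K" using elt_diff unfolding K_elt by metis
  show m: "x \<in> K \<Longrightarrow> y \<in> K \<Longrightarrow> x * y \<in> K" for x y using elt_mult unfolding K_elt by metis
  show "inverse x \<in> K" if x: "x \<in> K"
  proof (cases "x = 0")
    case False
    obtain a b where ab: "x = elt a b" using x K_elt by auto
    have "x * elt a (- b) = of_rat (field_norm x)"
      by (simp add: ab elt_mult field_norm_elt power2_eq_square mult.assoc flip: elt_of_rat)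
    then have "x * (elt a (- b) * of_rat (inverse (field_norm x))) = 1"
      using field_norm_nonzero[OF x False] by (simp add: of_rat_inverse flip: mult.assoc)
    then have "inverse x = elt a (- b) * of_rat (inverse (field_norm x))" by (rule inverse_unique)
    moreover have "elt a (- b) \<in> K" using K_elt by auto
    ultimately show ?thesis using m K_Rats by simp
  qed (use x in simp)
qed

text \<open>For p-integral d this is the ring Z_(p)[\<delta>].\<close>

definition local_ring :: "'k set" where
  "local_ring = {elt a b | a b. a \<in> Q.M 0 \<and> b \<in> Q.M 0}"

end

section \<open>The case v_p(d) = 0: p does not ramify\<close>

locale unramified_sqrt_field = sqrt_field K \<delta> d p
  for K :: "'k::field_char_0 set" and \<delta> d p +
  assumes v_d: "padic_val p d = 0"
begin

lemma d_M: "d \<in> Q.M 0" using v_d by (simp add: Q.M_def)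

lemma local_ring_closed:
  "0 \<in> local_ring" "1 \<in> local_ring"
  "x \<in> local_ring \<Longrightarrow> y \<in> local_ring \<Longrightarrow> x + y \<in> local_ring"
  "x \<in> local_ring \<Longrightarrow> y \<in> local_ring \<Longrightarrow> x - y \<in> local_ring"
  "x \<in> local_ring \<Longrightarrow> y \<in> local_ring \<Longrightarrow> x * y \<in> local_ring"
proof -
  have e: "elt a b \<in> local_ring" if "a \<in> Q.M 0" "b \<in> Q.M 0" for a b
    using that by (auto simp: local_ring_def)
  show "0 \<in> local_ring" using e[OF Q.M_0 Q.M_0] by (simp add: elt_0)
  show "1 \<in> local_ring" using e[OF Q.M_1 Q.M_0] by (simp add: elt_of_rat)
  assume "x \<in> local_ring" "y \<in> local_ring"
  then obtain a b a' b' where xy: "x = elt a b" "y = elt a' b'"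
    and M: "a \<in> Q.M 0" "b \<in> Q.M 0" "a' \<in> Q.M 0" "b' \<in> Q.M 0"
    by (auto simp: local_ring_def)
  show "x + y \<in> local_ring" unfolding xy elt_add by (intro e Q.M_add M)
  show "x - y \<in> local_ring" unfolding xy elt_diff by (intro e Q.M_diff M)
  have m: "u * w \<in> Q.M 0" if "u \<in> Q.M 0" "w \<in> Q.M 0" for u w
    using Q.M_mult[OF that] by simp
  show "x * y \<in> local_ring" unfolding xy elt_mult by (intro e Q.M_add m M d_M)
qed

lemma local_ring_of_nat: "of_nat n \<in> local_ring"
  by (induction n) (auto intro: local_ring_closed)

lemma local_ring_of_int: "of_int n \<in> local_ring"
  by (cases n rule: int_diff_cases) (auto intro: local_ring_closed local_ring_of_nat)

lemma local_ring_power: "x \<in> local_ring \<Longrightarrow> x ^ n \<in> local_ring"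
  by (induction n) (auto intro: local_ring_closed)

lemma local_ring_sum: "(\<And>i. i \<in> I \<Longrightarrow> f i \<in> local_ring) \<Longrightarrow> sum f I \<in> local_ring"
  by (induction I rule: infinite_finite_induct) (auto intro: local_ring_closed)

lemma v_p: "padic_val p (of_nat p) = 1" and p_nonzero: "(of_nat p :: rat) \<noteq> 0"
  using padic_val_of_nat[OF p, of p] p by (auto simp: prime_gt_0_nat)

lemma M_divide_p: "a / of_nat p \<in> Q.M 0 \<longleftrightarrow> a \<in> Q.M 1"
  using Q.v_divide[of a "of_nat p"] v_p p_nonzero by (auto simp: Q.M_def)

lemma elt_divide_p: "elt a b / of_nat p = elt (a / of_nat p) (b / of_nat p)"
  by (simp add: elt_def of_rat_divide add_divide_distrib)

lemma local_ring_elt: "elt a b \<in> local_ring \<longleftrightarrow> a \<in> Q.M 0 \<and> b \<in> Q.M 0"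
  by (auto simp: local_ring_def elt_eq_iff)

text \<open>As \<open>p\<close> does not divide \<open>2 d\<close>, the local ring is reduced modulo \<open>p\<close>.\<close>

lemma local_ring_square:
  assumes "x \<in> local_ring" "x\<^sup>2 / of_nat p \<in> local_ring"
  shows "x / of_nat p \<in> local_ring"
proof -
  obtain a b where x: "x = elt a b" and M: "a \<in> Q.M 0" "b \<in> Q.M 0" using assms(1) by (auto simp: local_ring_def)
  have sq: "x\<^sup>2 = elt (a * a + d * b * b) (2 * (a * b))"
    by (simp add: x power2_eq_square elt_mult)
  have 1: "a * a + d * b * b \<in> Q.M 1" "2 * (a * b) \<in> Q.M 1"
    using assms(2) unfolding sq elt_divide_p local_ring_elt M_divide_p by auto
  have v2: "padic_val p 2 = 0"
  proof -
    have "\<not> p dvd 2" using p p_odd by (metis primes_dvd_imp_eq two_is_prime_nat)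
    then have "\<not> int p dvd 2" by (metis int_dvd_int_iff of_nat_numeral)
    then show ?thesis using padic_val_of_nat[OF p, of 2] by (simp add: not_dvd_imp_multiplicity_0)
  qed
  \<comment> \<open>p divides 2 a b, hence a or b; then it divides the other, since it divides a^2 +
    d b^2 and d is a unit.\<close>
  have ab: "a \<in> Q.M 1 \<or> b \<in> Q.M 1"
  proof (rule ccontr)
    assume "\<not> ?thesis"
    then have *: "a \<noteq> 0" "b \<noteq> 0" "padic_val p a = 0" "padic_val p b = 0" using M by (auto simp: Q.M_def)
    then have "padic_val p (2 * (a * b)) = 0" using v2 Q.v_mult[of a b] Q.v_mult[of 2 "a * b"] by simp
    then show False using 1(2) * by (simp add: Q.M_def)
  qed
  have sqM: "u \<in> Q.M 1" if "u * u \<in> Q.M 1" for u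
    using that Q.v_mult[of u u] by (cases "u = 0") (auto simp: Q.M_def)
  have "a \<in> Q.M 1 \<and> b \<in> Q.M 1"
  proof (cases "a \<in> Q.M 1")
    case True
    then have "a * a \<in> Q.M 1" by (rule Q.M_mult) (use M in auto)
    then have "(a * a + d * b * b) - a * a \<in> Q.M 1" using 1(1) by (intro Q.M_diff)
    then have "d * (b * b) \<in> Q.M 1" by (simp add: algebra_simps)
    then have "b * b \<in> Q.M 1" using Q.v_mult[of d "b * b"] v_d d_nonzero by (cases "b = 0") (auto simp: Q.M_def)
    then show ?thesis using True sqM by blast
  next
    case False
    then have b: "b \<in> Q.M 1" using ab by simp
    have "d * b * b \<in> Q.M 1"
      using Q.M_mult[OF Q.M_mult[OF d_M M(2), of 0] b, of 1] by simp
    then have "(a * a + d * b * b) - d * b * b \<in> Q.M 1" using 1(1) by (intro Q.M_diff)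
    then have "a * a \<in> Q.M 1" by simp
    then show ?thesis using b sqM by blast
  qed
  then show ?thesis unfolding x elt_divide_p local_ring_elt M_divide_p .
qed

lemma denominator_bound: "x \<in> K \<Longrightarrow> \<exists>n. of_nat p ^ n * x \<in> local_ring"
proof -
  assume "x \<in> K"
  then obtain a b where x: "x = elt a b" using K_elt by auto
  have r: "\<exists>n. \<forall>k\<ge>n. of_nat p ^ k * r \<in> Q.M 0" for r :: rat
  proof (intro exI[of _ "nat (- padic_val p r)"] allI impI)
    fix k assume "nat (- padic_val p r) \<le> k"
    then show "of_nat p ^ k * r \<in> Q.M 0"
      using Q.v_mult[of "of_nat p ^ k" r] Q.v_power[of "of_nat p" k] v_p p_nonzero by (cases "r = 0") (auto simp: Q.M_def)
  qed
  obtain m n where mn: "\<forall>k\<ge>m. of_nat p ^ k * a \<in> Q.M 0" "\<forall>k\<ge>n. of_nat p ^ k * b \<in> Q.M 0" using r by metis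
  have "of_nat p ^ max m n * x = elt (of_nat p ^ max m n * a) (of_nat p ^ max m n * b)"
    by (simp add: x elt_def of_rat_mult of_rat_power algebra_simps)
  then show ?thesis using mn by (metis local_ring_elt max.cobounded1 max.cobounded2)
qed

lemma K_power: "x \<in> K \<Longrightarrow> x ^ n \<in> K"
  by (induction n) (auto intro: K_closed)

text \<open>The powers of an algebraic integer have a common denominator; since \<open>local_ring\<close> is
  reduced modulo \<open>p\<close>, this denominator is prime to \<open>p\<close>.\<close>

lemma algebraic_int_local:
  assumes x: "x \<in> K" and int: "algebraic_int x"
  shows "x \<in> local_ring"
proof (rule ccontr)
  assume nx: "x \<notin> local_ring"
  obtain f where f: "lead_coeff f = 1" "\<forall>i. coeff f i \<in> \<int>" "poly f x = 0"
    using int by (auto elim: algebraic_int.cases)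
  define n where "n = degree f"
  have pm: "of_nat p ^ k * y \<in> local_ring" if "y \<in> local_ring" for y k
    by (intro local_ring_closed local_ring_power local_ring_of_nat that)
  \<comment> \<open>One denominator p^N for all powers of x below the degree of f.\<close>
  have "\<exists>N. \<forall>i<m. of_nat p ^ N * x ^ i \<in> local_ring" for m
  proof (induction m)
    case (Suc m)
    then obtain N where N: "\<forall>i<m. of_nat p ^ N * x ^ i \<in> local_ring" by blast
    obtain N' where N': "of_nat p ^ N' * x ^ m \<in> local_ring" using denominator_bound[OF K_power[OF x]] by blast
    have "of_nat p ^ (N + N') * x ^ i \<in> local_ring" if "i < Suc m" for i
    proof (cases "i = m")
      case True
      then show ?thesis using pm[OF N', of N] by (simp add: power_add mult.assoc)
    next
      case False
      then have "of_nat p ^ N * x ^ i \<in> local_ring" using that N by simp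
      from pm[OF this, of N'] show ?thesis by (simp add: power_add mult_ac)
    qed
    then show ?case by blast
  qed auto
  then obtain N where N: "\<forall>i<n. of_nat p ^ N * x ^ i \<in> local_ring" by blast
  have xn: "x ^ n = - (\<Sum>i<n. coeff f i * x ^ i)"
  proof -
    have "0 = (\<Sum>i\<le>n. coeff f i * x ^ i)" using f(3) by (simp add: poly_altdef n_def)
    also have "\<dots> = (\<Sum>i<n. coeff f i * x ^ i) + x ^ n"
      using f(1) by (simp add: n_def flip: lessThan_Suc_atMost)
    finally show ?thesis by (simp add: eq_neg_iff_add_eq_0 add.commute)
  qed
  \<comment> \<open>The monic equation expresses higher powers by lower ones with integer
    coefficients, so the same N serves all powers.\<close>
  have all: "of_nat p ^ N * x ^ m \<in> local_ring" for m
  proof (induction m rule: less_induct)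
    case (less m)
    show ?case
    proof (cases "m < n")
      case False
      have "x ^ m = x ^ (m - n) * x ^ n" using False by (simp flip: power_add)
      also have "\<dots> = 0 - (\<Sum>i<n. coeff f i * x ^ (i + (m - n)))"
        unfolding xn by (simp add: sum_distrib_left power_add mult_ac)
      finally have "of_nat p ^ N * x ^ m = 0 - (\<Sum>i<n. coeff f i * (of_nat p ^ N * x ^ (i + (m - n))))"
        by (simp add: sum_distrib_left mult_ac)
      also have "\<dots> \<in> local_ring"
      proof (rule local_ring_closed(4)[OF local_ring_closed(1) local_ring_sum], rule local_ring_closed(5))
        fix i assume "i \<in> {..<n}"
        then show "of_nat p ^ N * x ^ (i + (m - n)) \<in> local_ring" using less[of "i + (m - n)"] False by auto
        show "coeff f i \<in> local_ring" using f(2) by (metis Ints_cases local_ring_of_int)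
      qed
      finally show ?thesis .
    qed (use N in auto)
  qed
  define k where "k = (LEAST k. of_nat p ^ k * x \<in> local_ring)"
  have k: "of_nat p ^ k * x \<in> local_ring" unfolding k_def using denominator_bound[OF x] by (rule LeastI_ex)
  have "k \<noteq> 0" using nx k by (intro notI) simp
  then obtain k' where k': "k = Suc k'" using not0_implies_Suc by blast
  then have nk': "of_nat p ^ k' * x \<notin> local_ring" using not_less_Least[of k' "\<lambda>k. of_nat p ^ k * x \<in> local_ring"] k_def by auto
  \<comment> \<open>By minimality of k, u is not divisible by p in \<open>local_ring\<close>, and
    reducedness passes this on to every u^(2^j).\<close>
  define u where "u = of_nat p ^ k * x"
  have p0: "of_nat p \<noteq> (0::'k)" using p_nonzero by simp
  have u: "u \<in> local_ring" "u / of_nat p \<notin> local_ring" using k nk' p0 by (simp_all add: u_def k')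
  have ud: "u ^ 2 ^ j / of_nat p \<notin> local_ring" for j
  proof (induction j)
    case (Suc j)
    have "u ^ 2 ^ Suc j = (u ^ 2 ^ j)\<^sup>2" by (simp add: power_mult[symmetric] mult.commute)
    then show ?case using Suc local_ring_square[OF local_ring_power[OF u(1), of "2 ^ j"]] by metis
  qed (use u in auto)
  have N2: "N < 2 ^ N" by (rule less_exp)
  have "u ^ 2 ^ N = of_nat p ^ (k * 2 ^ N) * x ^ 2 ^ N" by (simp add: u_def power_mult_distrib power_mult)
  \<comment> \<open>Because N < 2^N \<le> k 2^N the truncated subtraction is exact, and a factor p
    is left over beyond p^N.\<close>
  also have "k * 2 ^ N = Suc (k * 2 ^ N - N - 1) + N"
  proof -
    have "2 ^ N \<le> k * 2 ^ N" using k' by simp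
    then show ?thesis using N2 by linarith
  qed
  finally have "u ^ 2 ^ N / of_nat p = of_nat p ^ (k * 2 ^ N - N - 1) * (of_nat p ^ N * x ^ 2 ^ N)"
    using p0 by (simp add: power_add mult.assoc)
  then have "u ^ 2 ^ N / of_nat p \<in> local_ring" using pm[OF all[of "2 ^ N"]] by simp
  then show False using ud by blast
qed

text \<open>Clears the denominators of a, b and d, all prime to p. The denominator of d enters
  because \<delta> itself need not be integral.\<close>

lemma local_ring_multiple_integral:
  assumes "y \<in> local_ring"
  obtains m :: int where "\<not> int p dvd m" "algebraic_int (of_int m * y)"
proof -
  obtain a b where y: "y = elt a b" "a \<in> Q.M 0" "b \<in> Q.M 0" using assms by (auto simp: local_ring_def)
  then have pi: "padic_integral p a" "padic_integral p b" "padic_integral p d"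
    using d_M by (auto simp: padic_integral_def Q.M_def)
  obtain a1 a2 where a: "a = of_int a1 / of_int a2" "a2 \<noteq> 0" "\<not> int p dvd a2" using padic_integral_denominator[OF p pi(1)] .
  obtain b1 b2 where b: "b = of_int b1 / of_int b2" "b2 \<noteq> 0" "\<not> int p dvd b2" using padic_integral_denominator[OF p pi(2)] .
  obtain d1 d2 where d: "d = of_int d1 / of_int d2" "d2 \<noteq> 0" "\<not> int p dvd d2" using padic_integral_denominator[OF p pi(3)] .
  define m where "m = a2 * b2 * d2"
  have pm: "\<not> int p dvd m"
    using a b d p unfolding m_def by (metis prime_dvd_mult_iff prime_nat_int_transfer)
  \<comment> \<open>Chosen so that m y = r + w with w^2 = s, which is a root of (T - r)^2 -
    s.\<close>
  define r where "r = a1 * b2 * d2"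
  define s where "s = (a2 * b1)\<^sup>2 * d1 * d2"
  have "of_int m * a = of_int r" using a by (simp add: m_def r_def)
  have my: "of_int m * y = of_int r + of_rat (of_int m * b) * \<delta>"
  proof -
    have "of_int m * y = of_rat (of_int m * a) + of_rat (of_int m * b) * \<delta>"
      by (simp add: y elt_def of_rat_mult algebra_simps)
    then show ?thesis using \<open>of_int m * a = of_int r\<close> by simp
  qed
  have mb: "of_int m * b = of_int (a2 * b1 * d2)" and dd: "of_int d2 * d = of_int d1"
    using b d by (simp_all add: m_def)
  have "(of_int m * b)\<^sup>2 * d = (of_int (a2 * b1))\<^sup>2 * of_int d2 * (of_int d2 * d)"
    unfolding mb by (simp add: power2_eq_square)
  then have "(of_int m * b)\<^sup>2 * d = of_int s"
    unfolding dd by (simp add: s_def)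
  then have sq: "(of_rat (of_int m * b) * \<delta>)\<^sup>2 = of_int s"
    by (metis \<delta>(1) of_rat_mult of_rat_of_int_eq of_rat_power power_mult_distrib)
  define w where "w = of_rat (of_int m * b) * \<delta>"
  have "algebraic_int (of_int m * y)"
  proof (rule algebraic_int.intros)
    let ?f = "[:of_int (r\<^sup>2 - s), of_int (- 2 * r), 1:] :: 'k poly"
    show "lead_coeff ?f = 1" by simp
    show "\<forall>i. coeff ?f i \<in> \<int>"
      by (auto simp: coeff_pCons split: nat.splits)
    have "poly ?f (of_int r + w) = w\<^sup>2 - of_int s"
      by (simp add: algebra_simps power2_eq_square)
    then show "poly ?f (of_int m * y) = 0" unfolding my using sq by (simp add: w_def)
  qed
  then show thesis using that pm by blast
qed

text \<open>If \<open>(p) = P\<^sup>2 J\<close>, the square of every element of \<open>P J\<close> is divisible by \<open>p\<close>, hence so is, locally,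
  the element itself. Then \<open>p \<in> P (P J)\<close> gives \<open>1 \<in> P\<close> after localisation at \<open>p\<close>; the set \<open>S\<close> below is
  that localisation of \<open>P\<close>.\<close>

lemma not_ramified: "\<not> ramifies_in p K"
proof
  assume "ramifies_in p K"
  define R where "R = ring_of_integers K"
  obtain P J where P: "primeideal P R" and J: "ideal J R"
    and eq: "PIdl\<^bsub>R\<^esub> (of_nat p) = (P [^]\<^bsub>ideals_set R\<^esub> (2::nat)) \<otimes>\<^bsub>ideals_set R\<^esub> J"
    using \<open>ramifies_in p K\<close> by (auto simp: ramifies_in_def Let_def R_def)
  interpret P: primeideal P R by (rule P)
  interpret J: ideal J R by (rule J)
  have R_simps [simp]: "carrier R = {x \<in> K. algebraic_int x}" "\<And>x y. x \<otimes>\<^bsub>R\<^esub> y = x * y"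
    "\<And>x y. x \<oplus>\<^bsub>R\<^esub> y = x + y" "\<one>\<^bsub>R\<^esub> = 1" "\<zero>\<^bsub>R\<^esub> = 0"
    by (simp_all add: R_def ring_of_integers_def)
  \<comment> \<open>A power in a monoid starts from the unit, here the ideal
    \<open>carrier R\<close>; hence the extra factor.\<close>
  define P2 where "P2 = ideal_prod R (ideal_prod R (carrier R) P) P"
  have eq': "PIdl\<^bsub>R\<^esub> (of_nat p) = ideal_prod R P2 J"
    using eq by (simp add: P2_def ideals_set_def numeral_2_eq_2)
  have RP: "ideal_prod R (carrier R) P \<subseteq> P"
    using P.ideal_prod_inter[OF P.oneideal P.is_ideal] by auto
  have p0: "of_nat p \<noteq> (0::'k)" using p_nonzero by simp
  have intK: "of_int n \<in> carrier R" for n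
    using K_Rats[of "of_int n"] by (auto intro: int_imp_algebraic_int)
  have Pm: "r * x \<in> P" if "r \<in> carrier R" "x \<in> P" for r x using P.I_l_closed[of x r] that by simp
  have Pa: "x + y \<in> P" if "x \<in> P" "y \<in> P" for x y
    using additive_subgroup.a_closed[OF ideal.axioms(1)[OF P.is_ideal], of x y] that by simp
  define S where "S = {z. \<exists>m::int. \<not> int p dvd m \<and> of_int m * z \<in> P}"
  have S_add: "y + z \<in> S" if yz: "y \<in> S" "z \<in> S" for y z
  proof -
    obtain m n where mn: "\<not> int p dvd m" "of_int m * y \<in> P" "\<not> int p dvd n" "of_int n * z \<in> P"
      using yz by (auto simp: S_def)
    have "of_int n * (of_int m * y) + of_int m * (of_int n * z) \<in> P"
      by (intro Pa Pm intK mn)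
    then have "of_int (m * n) * (y + z) \<in> P" by (simp add: algebra_simps)
    moreover have "\<not> int p dvd m * n" using mn p by (metis prime_dvd_mult_iff prime_nat_int_transfer)
    ultimately show ?thesis unfolding S_def by blast
  qed
  have S_mult: "e * y \<in> S" if e: "e \<in> P" and y: "y \<in> local_ring" for e y
  proof -
    obtain m where m: "\<not> int p dvd m" "algebraic_int (of_int m * y)" using local_ring_multiple_integral[OF y] .
    have "y \<in> K" using y by (auto simp: local_ring_def K_elt)
    then have "of_int m * y \<in> carrier R" using m intK[of m] K_closed by simp
    then have "(of_int m * y) * e \<in> P" using Pm e by blast
    then show ?thesis using m unfolding S_def by (auto simp: mult_ac)
  qed
  \<comment> \<open>f^2 j is a multiple of p, so p divides (f j)^2 in \<open>local_ring\<close> and,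
    by reducedness, f j.\<close>
  have key: "f * j / of_nat p \<in> local_ring" if f: "f \<in> P" and j: "j \<in> J" for f j
  proof -
    have fR: "f \<in> carrier R" and jR: "j \<in> carrier R" using f j P.Icarr J.Icarr by auto
    have "f * f * j \<in> ideal_prod R P2 J"
    proof -
      have "1 * f \<in> ideal_prod R (carrier R) P" using ideal_prod.prod[of 1 "carrier R" f P R] f intK[of 1] by simp
      then have "f * f \<in> P2" unfolding P2_def using ideal_prod.prod[of f "ideal_prod R (carrier R) P" f P R] f by simp
      then show ?thesis using ideal_prod.prod[of "f * f" P2 j J R] j by simp
    qed
    then obtain z where z: "z \<in> carrier R" "f * f * j = z * of_nat p"
      unfolding eq'[symmetric] by (auto simp: cgenideal_def)
    have fl: "f \<in> local_ring" "j \<in> local_ring" "z \<in> local_ring"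
      using fR jR z algebraic_int_local by auto
    have "(f * j)\<^sup>2 = (f * f * j) * j" by (simp add: power2_eq_square algebra_simps)
    also have "\<dots> / of_nat p = z * j" unfolding z(2) using p0 by simp
    finally have "(f * j)\<^sup>2 / of_nat p \<in> local_ring" using local_ring_closed(5)[OF fl(3,2)] by simp
    then show ?thesis by (rule local_ring_square[OF local_ring_closed(5)[OF fl(1,2)]])
  qed
  \<comment> \<open>In a product e f j the factor e is kept in P while f j is divisible by p, which
    puts e f j / p into the localisation of P.\<close>
  have inner: "u * j / of_nat p \<in> S" if "u \<in> P2" "j \<in> J" for u j
    using that(1) unfolding P2_def
  proof (induction rule: ideal_prod.induct)
    case (prod e f)
    then have "e * (f * j / of_nat p) \<in> S" using RP key that(2) by (intro S_mult) auto
    then show ?case by (simp add: mult.assoc)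
  next
    case (sum s1 s2)
    then show ?case using S_add by (simp add: algebra_simps add_divide_distrib)
  qed
  have "s / of_nat p \<in> S" if "s \<in> ideal_prod R P2 J" for s
    using that
  proof (induction rule: ideal_prod.induct)
    case (prod u j)
    then show ?case using inner by simp
  next
    case (sum s1 s2)
    then show ?case using S_add by (simp add: add_divide_distrib)
  qed
  moreover have pI: "of_nat p \<in> ideal_prod R P2 J"
    unfolding eq'[symmetric] cgenideal_def using intK[of 1] by (auto intro!: exI[of _ 1])
  \<comment> \<open>Applied to p itself, 1 lies in the localisation, so P contains an integer m
    prime to p. As P also contains p, Bezout puts 1 into P.\<close>
  ultimately have "of_nat p / of_nat p \<in> S" by blast
  then obtain m where m: "\<not> int p dvd m" "of_int m \<in> P" using p0 by (auto simp: S_def)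
  have "of_nat p \<in> P"
  proof -
    have "P2 \<subseteq> P" unfolding P2_def
      using P.ideal_prod_inter[OF P.ideal_prod_is_ideal[OF P.oneideal P.is_ideal] P.is_ideal] by auto
    moreover have "ideal P2 R" unfolding P2_def
      by (intro P.ideal_prod_is_ideal P.oneideal P.is_ideal)
    ultimately show ?thesis using P.ideal_prod_inter[OF _ J, of P2] pI by auto
  qed
  then have pP: "of_nat p \<in> P" .
  obtain r s where rs: "r * int p + s * m = 1"
  proof -
    have "coprime (int p) m" using m(1) p by (simp add: prime_imp_coprime)
    then show thesis using that bezout_int[of "int p" m] by (auto simp: coprime_iff_gcd_eq_1)
  qed
  have "of_int r * of_nat p + of_int s * of_int m \<in> P" by (intro Pa Pm intK pP m)
  also have "of_int r * of_nat p + of_int s * of_int m = (of_int (r * int p + s * m) :: 'k)" by simp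
  finally have "1 \<in> P" by (simp add: rs)
  then show False using P.one_imp_carrier P.I_notcarr by simp
qed

end

lemma ramified_sqrt:
  fixes K :: "'k::field_char_0 set"
  assumes K: "quadratic_field K" and p: "Factorial_Ring.prime p" "p \<noteq> 2" and ram: "ramifies_in p K"
  obtains \<delta> d where "sqrt_field K \<delta> d p" "padic_val p d = 1"
proof -
  obtain \<delta> d where d: "\<delta>\<^sup>2 = of_rat d" "\<delta> \<notin> \<rat>" "K = {of_rat r + of_rat s * \<delta> | r s. True}"
    "padic_val p d = 0 \<or> padic_val p d = 1"
    using quadratic_field_sqrt_normalized[OF K p(1)] .
  have sq: "sqrt_field K \<delta> d p" using d p by (simp add: sqrt_field_def)
  have "padic_val p d \<noteq> 0"
  proof
    assume "padic_val p d = 0"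
    then have "unramified_sqrt_field K \<delta> d p"
      using sq by (simp add: unramified_sqrt_field_def unramified_sqrt_field_axioms_def)
    then show False using unramified_sqrt_field.not_ramified ram by blast
  qed
  then show thesis using that sq d by auto
qed

section \<open>The case v_p(d) = 1: the valuation above p\<close>

locale ramified_sqrt_field = sqrt_field K \<delta> d p
  for K :: "'k::field_char_0 set" and \<delta> d p +
  assumes v_d: "padic_val p d = 1"
begin

text \<open>The normalised valuation at the prime above p: w(p) = 2 and w(\<delta>) = 1.\<close>

definition w :: "'k \<Rightarrow> int" where "w x = padic_val p (field_norm x)"

text \<open>2 v(a) and 2 v(b) + 1 have different parity, so nothing cancels in the norm a^2 - d b^2
  and w is their minimum. The form with a lower bound n treats zero coordinates uniformly and
  reduces the ultrametric inequality to the coordinates.\<close>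

lemma w_ge_iff:
  assumes "elt a b \<noteq> 0"
  shows "n \<le> w (elt a b) \<longleftrightarrow> (a = 0 \<or> n \<le> 2 * padic_val p a) \<and> (b = 0 \<or> n \<le> 2 * padic_val p b + 1)"
proof -
  have va: "a \<noteq> 0 \<Longrightarrow> padic_val p (a\<^sup>2) = 2 * padic_val p a" using Q.v_power[of a 2] by simp
  have vb: "padic_val p (- (d * b\<^sup>2)) = 2 * padic_val p b + 1" if "b \<noteq> 0"
    using that Q.v_power[of b 2] Q.v_mult[of d "b\<^sup>2"] v_d d_nonzero Q.v_uminus[of "d * b\<^sup>2"] by simp
  have N: "field_norm (elt a b) = a\<^sup>2 + - (d * b\<^sup>2)" by (simp add: field_norm_elt)
  consider "a = 0" "b \<noteq> 0" | "a \<noteq> 0" "b = 0" | "a \<noteq> 0" "b \<noteq> 0" using assms elt_eq_0_iff by blast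
  then show ?thesis
  proof cases
    case 3
    have "padic_val p (a\<^sup>2) \<noteq> padic_val p (- (d * b\<^sup>2))" using va vb 3 by presburger
    then have "w (elt a b) = min (2 * padic_val p a) (2 * padic_val p b + 1)"
      using Q.v_add_eq_min(2)[of "a\<^sup>2" "- (d * b\<^sup>2)"] 3 d_nonzero va vb by (simp add: w_def N)
    then show ?thesis using 3 by auto
  qed (use va vb in \<open>auto simp: w_def field_norm_elt\<close>)
qed

text \<open>From here \<open>M\<close> and the lemmas without prefix refer to w on K, those with
  prefix \<open>Q\<close> to the p-adic valuation on the rationals.\<close>

sublocale subfield_valuation K w
proof
  show "1 \<in> K" "\<And>x y. x \<in> K \<Longrightarrow> y \<in> K \<Longrightarrow> x - y \<in> K" "\<And>x y. x \<in> K \<Longrightarrow> y \<in> K \<Longrightarrow> x * y \<in> K"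
    "\<And>x. x \<in> K \<Longrightarrow> inverse x \<in> K" by (fact K_closed)+
  show "w (x * y) = w x + w y" if "x \<in> K" "y \<in> K" "x \<noteq> 0" "y \<noteq> 0" for x y
    using that field_norm_mult field_norm_nonzero Q.v_mult[of "field_norm x" "field_norm y"] by (simp add: w_def)
  show "min (w x) (w y) \<le> w (x + y)" if xy: "x \<in> K" "y \<in> K" "x \<noteq> 0" "y \<noteq> 0" "x + y \<noteq> 0" for x y
  proof -
    obtain a b a' b' where e: "x = elt a b" "y = elt a' b'" using xy K_elt by auto
    define n where "n = min (w x) (w y)"
    have "n \<le> w x" "n \<le> w y" by (simp_all add: n_def)
    then have 1: "a = 0 \<or> n \<le> 2 * padic_val p a" "b = 0 \<or> n \<le> 2 * padic_val p b + 1"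
      "a' = 0 \<or> n \<le> 2 * padic_val p a'" "b' = 0 \<or> n \<le> 2 * padic_val p b' + 1"
      using w_ge_iff xy e by auto
    have "a + a' = 0 \<or> n \<le> 2 * padic_val p (a + a')"
      using 1(1,3) Q.v_add[of a a'] by (cases "a = 0"; cases "a' = 0") auto
    moreover have "b + b' = 0 \<or> n \<le> 2 * padic_val p (b + b') + 1"
      using 1(2,4) Q.v_add[of b b'] by (cases "b = 0"; cases "b' = 0") auto
    ultimately show ?thesis using w_ge_iff[of "a + a'" "b + b'" n] xy(5) by (simp add: e elt_add n_def)
  qed
qed

lemma w_of_rat: "r \<noteq> 0 \<Longrightarrow> w (of_rat r) = 2 * padic_val p r"
  using Q.v_power[of r 2] by (simp add: w_def field_norm_elt flip: elt_of_rat)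

lemma w_prime: "Factorial_Ring.prime q \<Longrightarrow> w (of_nat q) \<le> 2"
proof -
  assume q: "Factorial_Ring.prime q"
  have "multiplicity (int p) (int q) \<le> 1"
    using p q by (cases "p = q") (auto simp: prime_multiplicity_other)
  then show ?thesis using w_of_rat[of "of_nat q"] padic_val_of_nat[OF p, of q] q by auto
qed

end

section \<open>Changes of variables\<close>

fun point_change :: "'a::field \<Rightarrow> 'a \<Rightarrow> 'a \<Rightarrow> 'a \<Rightarrow> 'a point \<Rightarrow> 'a point" where
  "point_change u r s t Infinity = Infinity"
| "point_change u r s t (Affine x y) = Affine ((x - r) / u\<^sup>2) ((y - s * (x - r) - t) / u ^ 3)"

lemma change_of_variables_sel:
  "a1 (change_of_variables u r s t E) = (a1 E + 2 * s) / u"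
  "a2 (change_of_variables u r s t E) = (a2 E - s * a1 E + 3 * r - s ^ 2) / u ^ 2"
  "a3 (change_of_variables u r s t E) = (a3 E + r * a1 E + 2 * t) / u ^ 3"
  "a4 (change_of_variables u r s t E) =
     (a4 E - s * a3 E + 2 * r * a2 E - (t + r * s) * a1 E + 3 * r ^ 2 - 2 * s * t) / u ^ 4"
  "a6 (change_of_variables u r s t E) =
     (a6 E + r * a4 E + r ^ 2 * a2 E + r ^ 3 - t * a3 E - t ^ 2 - r * t * a1 E) / u ^ 6"
  by (simp_all add: change_of_variables_def)

text \<open>Triangular form: each old coefficient is expressed by a new one and old ones of smaller
  index, so unfolding from a6 down to a1 removes the old coefficients without division.\<close>

lemma change_of_variables_inverse:
  fixes E :: "'a::field weierstrass"
  assumes u: "u \<noteq> 0" and E': "E' = change_of_variables u r s t E"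
  shows "a1 E = u * a1 E' - 2 * s"
    and "a2 E = u\<^sup>2 * a2 E' + s * a1 E - 3 * r + s\<^sup>2"
    and "a3 E = u ^ 3 * a3 E' - r * a1 E - 2 * t"
    and "a4 E = u ^ 4 * a4 E' + s * a3 E - 2 * r * a2 E + (t + r * s) * a1 E - 3 * r\<^sup>2 + 2 * s * t"
    and "a6 E = u ^ 6 * a6 E' - r * a4 E - r\<^sup>2 * a2 E - r ^ 3 + t * a3 E + t\<^sup>2 + r * t * a1 E"
  using u unfolding E' change_of_variables_sel by simp_all

lemma change_of_variables_id: "change_of_variables 1 0 0 0 E = E"
  by (cases E) (simp add: change_of_variables_def)

lemma change_of_variables_comp:
  fixes E :: "'a::field weierstrass"
  assumes "u \<noteq> 0" "u' \<noteq> 0"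
  shows "change_of_variables u' r' s' t' (change_of_variables u r s t E) =
    change_of_variables (u * u') (u\<^sup>2 * r' + r) (u * s' + s) (u ^ 3 * t' + u\<^sup>2 * s * r' + t) E"
proof -
  define W where "W = change_of_variables u r s t E"
  note W = change_of_variables_inverse[OF assms(1) W_def]
  show ?thesis unfolding W_def[symmetric]
    unfolding change_of_variables_def weierstrass.inject
  proof (intro conjI)
    show "(a1 W + 2 * s') / u' = (a1 E + 2 * (u * s' + s)) / (u * u')"
      unfolding W(1) using assms by (simp add: divide_simps) (simp add: algebra_simps)
  qed (use assms in \<open>simp add: divide_simps; simp add: W(5); simp add: W(4); simp add: W(3); simp add: W(2); simp add: W(1) algebra_simps eval_nat_numeral\<close>)+
qed

lemma on_curve_change:
  fixes E :: "'a::field weierstrass"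
  assumes u: "u \<noteq> 0"
  shows "on_curve (change_of_variables u r s t E) ((x - r) / u\<^sup>2) ((y - s * (x - r) - t) / u ^ 3)
    \<longleftrightarrow> on_curve E x y"
proof -
  define W where "W = change_of_variables u r s t E"
  note W = change_of_variables_inverse[OF u W_def]
  define x' where "x' = (x - r) / u\<^sup>2"
  define y' where "y' = (y - s * (x - r) - t) / u ^ 3"
  have x: "x = u\<^sup>2 * x' + r" and y: "y = u ^ 3 * y' + s * (u\<^sup>2 * x') + t"
    using u by (simp_all add: x'_def y'_def)
  have "y\<^sup>2 + a1 E * x * y + a3 E * y - (x ^ 3 + a2 E * x\<^sup>2 + a4 E * x + a6 E)
     = u ^ 6 * (y'\<^sup>2 + a1 W * x' * y' + a3 W * y' - (x' ^ 3 + a2 W * x'\<^sup>2 + a4 W * x' + a6 W))"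
    unfolding x y W(5) W(4) W(3) W(2) W(1) by (simp add: algebra_simps eval_nat_numeral)
  then have "on_curve W x' y' \<longleftrightarrow> on_curve E x y"
    using u by (auto simp: on_curve_def)
  then show ?thesis by (simp add: W_def x'_def y'_def)
qed

text \<open>Everything follows from the transformation l = u L + s of slopes, which holds for chords
  and tangents alike.\<close>

lemma point_change_add:
  fixes E :: "'a::field weierstrass"
  assumes u: "u \<noteq> 0" and P: "on_curve_point E P" and Q: "on_curve_point E Q"
  shows "point_change u r s t (point_add E P Q) =
    point_add (change_of_variables u r s t E) (point_change u r s t P) (point_change u r s t Q)"
proof (cases P; cases Q)
  fix x1 y1 x2 y2 assume PQ: "P = Affine x1 y1" "Q = Affine x2 y2"
  define W where "W = change_of_variables u r s t E"
  note W = change_of_variables_inverse[OF u W_def]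
  define X1 where "X1 = (x1 - r) / u\<^sup>2"
  define Y1 where "Y1 = (y1 - s * (x1 - r) - t) / u ^ 3"
  define X2 where "X2 = (x2 - r) / u\<^sup>2"
  define Y2 where "Y2 = (y2 - s * (x2 - r) - t) / u ^ 3"
  have x: "x1 = u\<^sup>2 * X1 + r" "x2 = u\<^sup>2 * X2 + r"
    and y: "y1 = u ^ 3 * Y1 + s * (u\<^sup>2 * X1) + t" "y2 = u ^ 3 * Y2 + s * (u\<^sup>2 * X2) + t"
    using u by (simp_all add: X1_def Y1_def X2_def Y2_def)
  have ch: "point_change u r s t P = Affine X1 Y1" "point_change u r s t Q = Affine X2 Y2"
    by (simp_all add: PQ X1_def Y1_def X2_def Y2_def)
  have xeq: "x1 = x2 \<longleftrightarrow> X1 = X2" using u by (auto simp: x)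
  have opp: "y1 + y2 + a1 E * x2 + a3 E = u ^ 3 * (Y1 + Y2 + a1 W * X2 + a3 W)" if "X1 = X2"
    unfolding x y W(3) W(1) that by (simp add: algebra_simps eval_nat_numeral)
  show ?thesis
  proof (cases "x1 = x2 \<and> y1 + y2 + a1 E * x2 + a3 E = 0")
    case True
    then have "X1 = X2" "Y1 + Y2 + a1 W * X2 + a3 W = 0" using xeq opp u by auto
    then show ?thesis using True unfolding ch W_def[symmetric] by (simp add: PQ)
  next
    case False
    then have F': "\<not> (X1 = X2 \<and> Y1 + Y2 + a1 W * X2 + a3 W = 0)" using xeq opp u by auto
    define l where "l = (if x1 = x2 then (3 * x1\<^sup>2 + 2 * a2 E * x1 + a4 E - a1 E * y1) / (2 * y1 + a1 E * x1 + a3 E)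
                 else (y2 - y1) / (x2 - x1))"
    define L where "L = (if X1 = X2 then (3 * X1\<^sup>2 + 2 * a2 W * X1 + a4 W - a1 W * Y1) / (2 * Y1 + a1 W * X1 + a3 W)
                 else (Y2 - Y1) / (X2 - X1))"
    have l: "l = u * L + s"
    proof (cases "X1 = X2")
      case True
      then have x12: "x1 = x2" using xeq by simp
      have "on_curve E x1 y1" "on_curve E x1 y2" using P Q PQ x12 by auto
      then have "(y1 - y2) * (y1 + y2 + a1 E * x1 + a3 E) = 0"
        by (simp add: on_curve_def algebra_simps power2_eq_square)
      then have "y2 = y1" using False x12 by auto
      then have d0: "2 * y1 + a1 E * x1 + a3 E \<noteq> 0" using False x12 by auto
      have d: "2 * y1 + a1 E * x1 + a3 E = u ^ 3 * (2 * Y1 + a1 W * X1 + a3 W)"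
        unfolding x y W(3) W(1) by (simp add: algebra_simps eval_nat_numeral)
      have n: "3 * x1\<^sup>2 + 2 * a2 E * x1 + a4 E - a1 E * y1 =
          u ^ 4 * (3 * X1\<^sup>2 + 2 * a2 W * X1 + a4 W - a1 W * Y1) + s * (2 * y1 + a1 E * x1 + a3 E)"
        unfolding x y W(4) W(3) W(2) W(1) by (simp add: algebra_simps eval_nat_numeral)
      have "l = u ^ 4 * (3 * X1\<^sup>2 + 2 * a2 W * X1 + a4 W - a1 W * Y1) / (2 * y1 + a1 E * x1 + a3 E) + s"
        unfolding l_def n using x12 d0 by (simp add: add_divide_distrib)
      then show ?thesis unfolding d L_def using True u by (simp add: power_eq_if)
    next
      case False
      have "l = (u ^ 3 * (Y2 - Y1) + s * (u\<^sup>2 * (X2 - X1))) / (u\<^sup>2 * (X2 - X1))"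
        unfolding l_def using False xeq by (simp add: x y algebra_simps)
      then show ?thesis unfolding L_def using False u by (simp add: add_divide_distrib power_eq_if)
    qed
    define x3 where "x3 = l\<^sup>2 + a1 E * l - a2 E - x1 - x2"
    define X3 where "X3 = L\<^sup>2 + a1 W * L - a2 W - X1 - X2"
    have x3: "x3 = u\<^sup>2 * X3 + r"
      unfolding x3_def X3_def l x W(2) W(1) by (simp add: algebra_simps eval_nat_numeral)
    define y3 where "y3 = - (y1 + l * (x3 - x1)) - a1 E * x3 - a3 E"
    define Y3 where "Y3 = - (Y1 + L * (X3 - X1)) - a1 W * X3 - a3 W"
    have y3: "y3 = u ^ 3 * Y3 + s * (u\<^sup>2 * X3) + t"
      unfolding y3_def Y3_def l x3 unfolding x y W(3) W(1) by (simp add: algebra_simps eval_nat_numeral)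
    have "point_add E P Q = Affine x3 y3"
      unfolding PQ point_add.simps if_not_P[OF False] Let_def l_def[symmetric] x3_def[symmetric] y3_def[symmetric] ..
    moreover have "point_add W (Affine X1 Y1) (Affine X2 Y2) = Affine X3 Y3"
      unfolding point_add.simps if_not_P[OF F'] Let_def L_def[symmetric] X3_def[symmetric] Y3_def[symmetric] ..
    ultimately show ?thesis unfolding ch W_def[symmetric] using u by (simp add: x3 y3)
  qed
qed auto

lemma point_group_pow:
  "P [^]\<^bsub>point_group E F\<^esub> (0::nat) = Infinity"
  "P [^]\<^bsub>point_group E F\<^esub> Suc n = point_add E (P [^]\<^bsub>point_group E F\<^esub> n) P"
  by (simp_all add: point_group_def)

text \<open>Powers are iterated \<open>point_add\<close>, so compatibility with addition carries
  over by induction; the target is a curve for which the group law is available.\<close>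

lemma torsion_point_change:
  fixes E :: "'a::field_char_0 weierstrass"
  assumes u: "u \<noteq> 0" and E': "change_of_variables u r s t E = short_weierstrass A B"
    and P: "P \<in> torsion (point_group E F)"
  shows "point_change u r s t P \<in> torsion (point_group (short_weierstrass A B) UNIV)"
proof -
  have curve: "on_curve_point (short_weierstrass A B) (point_change u r s t Q) \<longleftrightarrow> on_curve_point E Q" for Q
    using on_curve_change[OF u, of r s t E] by (cases Q) (auto simp: E')
  obtain n :: nat where n: "n > 0" "P [^]\<^bsub>point_group E F\<^esub> n = Infinity" and PE: "on_curve_point E P"
    using P by (auto simp: torsion_def point_group_def)
  have "on_curve_point E (P [^]\<^bsub>point_group E F\<^esub> k) \<and>
    point_change u r s t (P [^]\<^bsub>point_group E F\<^esub> k) =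
      point_change u r s t P [^]\<^bsub>point_group (short_weierstrass A B) UNIV\<^esub> k" for k :: nat
  proof (induction k)
    case (Suc k)
    let ?Q = "P [^]\<^bsub>point_group E F\<^esub> k"
    have ch: "point_change u r s t (point_add E ?Q P) =
        point_add (short_weierstrass A B) (point_change u r s t ?Q) (point_change u r s t P)"
      using point_change_add[OF u _ PE] Suc E' by metis
    have "on_curve_point (short_weierstrass A B) (point_change u r s t (point_add E ?Q P))"
      unfolding ch using curve[of ?Q] curve[of P] conjunct1[OF Suc] PE
      by (intro on_curve_point_add) simp_all
    then show ?case using ch Suc unfolding point_group_pow(2) curve by simp
  qed (simp add: point_group_def)
  from this[of n] have "point_change u r s t P [^]\<^bsub>point_group (short_weierstrass A B) UNIV\<^esub> n = Infinity"
    using n by simp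
  moreover have "point_change u r s t P \<in> carrier (point_group (short_weierstrass A B) UNIV)"
    using curve[of P] PE by (cases P) (auto simp: point_group_def)
  ultimately show ?thesis using n(1) by (auto simp: torsion_def point_group_def)
qed

section \<open>Short models and good reduction\<close>

lemma base_change_change_of_variables:
  "base_change (change_of_variables u r s t E) =
    change_of_variables (of_rat u) (of_rat r) (of_rat s) (of_rat t) (base_change E)"
  by (cases E) (simp add: base_change_def change_of_variables_def of_rat_divide of_rat_add of_rat_diff of_rat_mult of_rat_power)

lemma base_change_short: "base_change (short_weierstrass A B) = short_weierstrass (of_rat A) (of_rat B)"
  by (simp add: base_change_def short_weierstrass_def)

text \<open>Completing the square and the cube gives A = - c4 / 48 and B = - c6 / 864, where c6 = -
  b2^3 + 36 b2 b4 - 216 b6.\<close>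

lemma short_model:
  fixes E :: "'a::field_char_0 weierstrass"
  defines "A \<equiv> - c4 E / 48" and "B \<equiv> (b2 E ^ 3 - 36 * b2 E * b4 E + 216 * b6 E) / 864"
  defines "r \<equiv> - b2 E / 12"
  shows "change_of_variables 1 r (- a1 E / 2) (- (a3 E + r * a1 E) / 2) E = short_weierstrass A B"
    and "- 16 * (4 * A ^ 3 + 27 * B\<^sup>2) = discriminant E"
proof -
  show "change_of_variables 1 r (- a1 E / 2) (- (a3 E + r * a1 E) / 2) E = short_weierstrass A B"
    unfolding change_of_variables_def short_weierstrass_def weierstrass.inject A_def B_def r_def c4_def b2_def b4_def b6_def
    by (simp add: field_simps eval_nat_numeral)
  have b8: "b8 E = (b2 E * b6 E - b4 E ^ 2) / 4"
    unfolding b2_def b4_def b6_def b8_def by (simp add: field_simps eval_nat_numeral)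
  show "- 16 * (4 * A ^ 3 + 27 * B\<^sup>2) = discriminant E"
    unfolding A_def B_def c4_def discriminant_def b8 by (simp add: field_simps eval_nat_numeral)
qed

context
  fixes p :: nat
  assumes p: "Factorial_Ring.prime p"
begin

interpretation Q: subfield_valuation UNIV "padic_val p" by (rule padic_valuation[OF p])

lemma padic_integral_iff: "padic_integral p q \<longleftrightarrow> q \<in> Q.M 0"
  by (auto simp: padic_integral_def Q.M_def)

lemma discriminant_integral:
  assumes "\<forall>a \<in> set_weierstrass W. padic_integral p a"
  shows "discriminant W \<in> Q.M 0" "b2 W \<in> Q.M 0" "b4 W \<in> Q.M 0" "b6 W \<in> Q.M 0"
proof -
  have a: "a1 W \<in> Q.M 0" "a2 W \<in> Q.M 0" "a3 W \<in> Q.M 0" "a4 W \<in> Q.M 0" "a6 W \<in> Q.M 0"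
    using assms by (cases W; auto simp: padic_integral_iff)+
  have m: "x * y \<in> Q.M 0" if "x \<in> Q.M 0" "y \<in> Q.M 0" for x y using Q.M_mult[OF that] by simp
  have pw: "x ^ n \<in> Q.M 0" if "x \<in> Q.M 0" for x n using Q.M_power[OF that] by simp
  note cl = Q.M_add Q.M_diff Q.M_uminus m pw Q.M_numeral a
  show b: "b2 W \<in> Q.M 0" "b4 W \<in> Q.M 0" "b6 W \<in> Q.M 0"
    unfolding b2_def b4_def b6_def by (intro cl)+
  have "b8 W \<in> Q.M 0" unfolding b8_def by (intro cl)
  then show "discriminant W \<in> Q.M 0" unfolding discriminant_def by (intro cl b)
qed

lemma padic_val_numeral_unit:
  assumes "p > 3" "n \<in> {2, 3}" shows "padic_val p (of_nat n) = 0"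
proof -
  have "\<not> int p dvd int n" using assms by (auto dest: dvd_imp_le)
  then show ?thesis using padic_val_of_nat[OF p, of n] assms by (auto simp: not_dvd_imp_multiplicity_0)
qed

text \<open>The denominators 48 = 2^4 3 and 864 = 2^5 3^3 and the factor -16 of the discriminant are
  p-adic units for p > 3, so an integral model with unit discriminant yields a short one of the same
  kind.\<close>

lemma good_reduction_short_model:
  assumes p3: "p > 3" and good: "good_reduction p E"
  obtains u r s t A B where "u \<noteq> 0" "change_of_variables u r s t E = short_weierstrass A B"
    "A \<in> Q.M 0" "B \<in> Q.M 0" "4 * A ^ 3 + 27 * B\<^sup>2 \<noteq> 0" "padic_val p (4 * A ^ 3 + 27 * B\<^sup>2) = 0"
proof -
  obtain W where W: "integral_model p E W" "\<not> vanishes_mod p (discriminant W)"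
    using good by (auto simp: good_reduction_def minimal_model_def)
  obtain u r s t where u: "u \<noteq> 0" "W = change_of_variables u r s t E"
    using W(1) by (auto simp: integral_model_def isomorphic_curves_def)
  have int: "\<forall>a \<in> set_weierstrass W. padic_integral p a" using W(1) by (simp add: integral_model_def)
  note M = discriminant_integral[OF int]
  have D: "discriminant W \<noteq> 0" "padic_val p (discriminant W) = 0"
    using W(2) M(1) by (auto simp: vanishes_mod_def Q.M_def)
  define A where "A = - c4 W / 48"
  define B where "B = (b2 W ^ 3 - 36 * b2 W * b4 W + 216 * b6 W) / 864"
  note short = short_model[of W, folded A_def B_def]
  have "padic_val p 2 = 0" "padic_val p 3 = 0" using padic_val_numeral_unit[OF p3, of 2] padic_val_numeral_unit[OF p3, of 3] by auto
  then have v: "padic_val p (2 ^ i * 3 ^ j) = 0" for i j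
    using Q.v_power[of 2 i] Q.v_power[of 3 j] Q.v_mult[of "2 ^ i" "3 ^ j"] by simp
  have div: "x / (2 ^ i * 3 ^ j) \<in> Q.M 0" if "x \<in> Q.M 0" for x :: rat and i j
    using that v[of i j] Q.v_divide[of x "2 ^ i * 3 ^ j"] by (auto simp: Q.M_def)
  have m: "x * y \<in> Q.M 0" if "x \<in> Q.M 0" "y \<in> Q.M 0" for x y using Q.M_mult[OF that] by simp
  have pw: "x ^ n \<in> Q.M 0" if "x \<in> Q.M 0" for x n using Q.M_power[OF that] by simp
  note cl = Q.M_add Q.M_diff Q.M_uminus m pw Q.M_numeral M
  have "- c4 W \<in> Q.M 0" unfolding c4_def by (intro cl)
  from div[OF this, of 4 1] have A: "A \<in> Q.M 0" by (simp add: A_def)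
  have "b2 W ^ 3 - 36 * b2 W * b4 W + 216 * b6 W \<in> Q.M 0" by (intro cl)
  from div[OF this, of 5 3] have B: "B \<in> Q.M 0" by (simp add: B_def)
  define D' where "D' = 4 * A ^ 3 + 27 * B\<^sup>2"
  have D': "D' \<noteq> 0" using short(2) D(1) by (auto simp: D'_def)
  have "padic_val p (- (2 ^ 4 * 3 ^ 0)) = 0" using v[of 4 0] Q.v_uminus[of "2 ^ 4 * 3 ^ 0"] by simp
  then have "padic_val p (discriminant W) = padic_val p D'"
    using D' Q.v_mult[of "- (2 ^ 4 * 3 ^ 0)" D'] short(2) by (simp add: D'_def)
  then have "padic_val p D' = 0" using D by simp
  moreover obtain u' r' s' t' where "u' \<noteq> 0" "change_of_variables u' r' s' t' E = short_weierstrass A B"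
    using short(1) change_of_variables_comp[OF u(1) one_neq_zero] u that unfolding u(2) by (metis mult_1_right)
  ultimately show thesis using that[OF _ _ A B] D' by (auto simp: D'_def)
qed

text \<open>Such an equation is already minimal, since the discriminant of an integral model has
  valuation at least 0.\<close>

lemma good_reduction_of_unit_discriminant:
  assumes int: "\<forall>a \<in> set_weierstrass E. padic_integral p a"
    and D: "discriminant E \<noteq> 0" "padic_val p (discriminant E) = 0"
  shows "good_reduction p E"
proof -
  have "isomorphic_curves E E" unfolding isomorphic_curves_def
    using change_of_variables_id[of E, symmetric] by (metis one_neq_zero)
  moreover have "padic_val p (discriminant E) \<le> padic_val p (discriminant W')" if "integral_model p E W'" for W'
  proof -
    have "discriminant W' \<in> Q.M 0" using that discriminant_integral by (simp add: integral_model_def)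
    \<comment> \<open>A default value of \<open>padic_val\<close>, which lets the inequality hold
      for argument 0 as well.\<close>
    moreover have "padic_val p 0 = 0" by (simp add: padic_val_def)
    ultimately show ?thesis using D by (auto simp: Q.M_def)
  qed
  ultimately have "minimal_model p E E" using int by (simp add: minimal_model_def integral_model_def)
  then show ?thesis using D by (auto simp: good_reduction_def vanishes_mod_def)
qed

end

section \<open>Bad primes and the conductor\<close>

lemma finite_padic_val_nonzero:
  "finite {p. Factorial_Ring.prime p \<and> \<not> padic_integral p q}"
  "finite {p. Factorial_Ring.prime p \<and> q \<noteq> 0 \<and> padic_val p q \<noteq> 0}"
proof -
  show fin: "finite {p. Factorial_Ring.prime p \<and> q \<noteq> 0 \<and> padic_val p q \<noteq> 0}"
  proof (cases "q = 0")
    case False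
    then obtain a b where q: "q = of_int a / of_int b" "a \<noteq> 0" "b \<noteq> 0" by (rule rat_frac_cases)
    have "p dvd nat \<bar>a * b\<bar>" if "Factorial_Ring.prime p" "padic_val p q \<noteq> 0" for p
    proof -
      have "int p dvd a \<or> int p dvd b"
        using padic_val_frac[OF that(1) q(2,3)] that(2) not_dvd_imp_multiplicity_0[of "int p" a]
          not_dvd_imp_multiplicity_0[of "int p" b] unfolding q(1) by linarith
      then have "int p dvd a * b" by auto
      then show ?thesis by (simp add: nat_dvd_iff int_dvd_int_iff[symmetric])
    qed
    then have "{p. Factorial_Ring.prime p \<and> q \<noteq> 0 \<and> padic_val p q \<noteq> 0} \<subseteq> {p. p dvd nat \<bar>a * b\<bar>}" by auto
    moreover have "finite {p. p dvd nat \<bar>a * b\<bar>}" using q by (intro finite_divisors_nat) auto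
    ultimately show ?thesis by (rule finite_subset)
  qed simp
  show "finite {p. Factorial_Ring.prime p \<and> \<not> padic_integral p q}"
    by (rule finite_subset[OF _ fin]) (auto simp: padic_integral_def)
qed

text \<open>Bad primes occur in the denominator of a coefficient or in the discriminant, so the
  product in \<open>conductor\<close> is finite; over an infinite set it would be 1. The exponent at
  a bad prime is 1 or at least 2, whatever the wild part.\<close>

lemma prime_dvd_conductor:
  assumes E: "elliptic_curve E" and p: "Factorial_Ring.prime p" and bad: "\<not> good_reduction p E"
  shows "p dvd conductor E"
proof -
  let ?S = "{p. Factorial_Ring.prime p \<and> conductor_exponent p E \<noteq> 0}"
  have D: "discriminant E \<noteq> 0" using E by (simp add: elliptic_curve_def)
  have "?S \<subseteq> (\<Union>a\<in>set_weierstrass E. {p. Factorial_Ring.prime p \<and> \<not> padic_integral p a}) \<union>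
      {p. Factorial_Ring.prime p \<and> discriminant E \<noteq> 0 \<and> padic_val p (discriminant E) \<noteq> 0}"
    using good_reduction_of_unit_discriminant[of _ E] D by (auto simp: conductor_exponent_def)
  moreover have "finite (set_weierstrass E)" by (cases E) simp
  ultimately have fin: "finite ?S"
    by (elim finite_subset) (auto intro: finite_padic_val_nonzero)
  have e: "conductor_exponent p E \<noteq> 0" using bad by (simp add: conductor_exponent_def)
  then have "p ^ conductor_exponent p E dvd conductor E" unfolding conductor_def
    using p fin by (intro dvd_prodI) auto
  moreover have "p dvd p ^ conductor_exponent p E" using e by (simp add: dvd_power)
  ultimately show ?thesis by (rule dvd_trans[rotated])
qed

section \<open>Torsion over a ramified quadratic field\<close>

context ramified_sqrt_field
begin

lemma conjugate_K: "x \<in> K \<Longrightarrow> conjugate x \<in> K"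
  by (metis K_elt conjugate_elt)

lemma conjugate_conjugate: "x \<in> K \<Longrightarrow> conjugate (conjugate x) = x"
  by (auto simp: K_elt conjugate_elt)

lemma conjugate_add: "x \<in> K \<Longrightarrow> y \<in> K \<Longrightarrow> conjugate (x + y) = conjugate x + conjugate y"
  by (auto simp: K_elt conjugate_elt elt_add)

lemma conjugate_diff: "x \<in> K \<Longrightarrow> y \<in> K \<Longrightarrow> conjugate (x - y) = conjugate x - conjugate y"
  by (auto simp: K_elt conjugate_elt elt_diff)

lemma conjugate_mult: "x \<in> K \<Longrightarrow> y \<in> K \<Longrightarrow> conjugate (x * y) = conjugate x * conjugate y"
  by (auto simp: K_elt conjugate_elt elt_mult)

lemma conjugate_of_rat: "conjugate (of_rat r) = of_rat r"
  by (simp add: conjugate_elt flip: elt_of_rat)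

lemma conjugate_0: "conjugate 0 = 0" and conjugate_1: "conjugate 1 = 1"
  and conjugate_numeral: "conjugate (numeral n) = numeral n"
  using conjugate_of_rat[of 0] conjugate_of_rat[of 1] conjugate_of_rat[of "numeral n"] by simp_all

lemma K_numeral: "numeral n \<in> K" using K_Rats[of "numeral n"] by simp

lemma conjugate_uminus: "x \<in> K \<Longrightarrow> conjugate (- x) = - conjugate x"
  using conjugate_diff[OF K_0, of x] by (simp add: conjugate_0)

lemma conjugate_power: "x \<in> K \<Longrightarrow> conjugate (x ^ n) = conjugate x ^ n"
  by (induction n) (auto simp: conjugate_1 conjugate_mult K_power)

lemma conjugate_inverse: "x \<in> K \<Longrightarrow> conjugate (inverse x) = inverse (conjugate x)"
proof (cases "x = 0")
  case False
  assume x: "x \<in> K"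
  have "conjugate x * conjugate (inverse x) = 1"
    using conjugate_mult[OF x K_inverse[OF x]] False by (simp add: conjugate_1)
  then show ?thesis by (metis inverse_unique)
qed (simp add: conjugate_0)

lemma conjugate_divide: "x \<in> K \<Longrightarrow> y \<in> K \<Longrightarrow> conjugate (x / y) = conjugate x / conjugate y"
  by (simp add: divide_inverse conjugate_mult conjugate_inverse K_inverse)

lemma conjugate_eq_iff: "x \<in> K \<Longrightarrow> y \<in> K \<Longrightarrow> conjugate x = conjugate y \<longleftrightarrow> x = y"
  using conjugate_conjugate by metis

lemma conjugate_fixed: "x \<in> K \<Longrightarrow> conjugate x = x \<Longrightarrow> x \<in> \<rat>"
  by (auto simp: K_elt conjugate_elt elt_eq_iff elt_of_rat)

lemmas conjugate_hom = conjugate_add conjugate_diff conjugate_mult conjugate_uminus conjugate_power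
  conjugate_divide conjugate_of_rat conjugate_numeral
lemmas K_intros = K_add K_minus K_mult K_uminus K_power K_divide K_Rats K_numeral

text \<open>Conjugation acts trivially on the residue field: w(b \<delta>) = 2 v(b) + 1 is odd, so
  if it is at least 0 it is at least 1, and x minus its conjugate is 2 b \<delta>.\<close>

lemma M_conjugate:
  assumes "x \<in> M 0" shows "conjugate x \<in> M 0" "x - conjugate x \<in> M 1"
proof -
  obtain a b where x: "x = elt a b" using assms M_K K_elt by blast
  have ab: "b = 0 \<or> 0 \<le> 2 * padic_val p b + 1"
    using assms w_ge_iff[of a b 0] elt_eq_0_iff[of a b] by (auto simp: x M_def)
  have "field_norm (conjugate x) = field_norm x" by (simp add: x conjugate_elt field_norm_elt)
  then have "w (conjugate x) = w x" by (simp add: w_def)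
  then show "conjugate x \<in> M 0"
    using assms conjugate_K[of x] by (auto simp: M_def conjugate_0)
  have diff: "x - conjugate x = elt 0 (2 * b)" by (simp add: x conjugate_elt elt_diff)
  show "x - conjugate x \<in> M 1"
  proof (cases "b = 0")
    case False
    have "padic_val p (2::rat) \<ge> 0" using padic_val_of_nat[OF p, of 2] by simp
    then have "padic_val p (2 * b) \<ge> 0" using ab False Q.v_mult[of 2 b] by simp
    then show ?thesis unfolding diff using w_ge_iff[of 0 "2 * b" 1] by (auto simp: M_def K_elt)
  qed (simp add: diff elt_0 M_0)
qed

lemma w_2: "w 2 = 0"
proof -
  have "\<not> p dvd 2" using p p_odd by (metis primes_dvd_imp_eq two_is_prime_nat)
  then have "\<not> int p dvd 2" by (metis int_dvd_int_iff of_nat_numeral)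
  then have "padic_val p 2 = 0" using padic_val_of_nat[OF p, of 2] by (simp add: not_dvd_imp_multiplicity_0)
  then show ?thesis using w_of_rat[of 2] by simp
qed

lemma M_half: "2 * x \<in> M n \<Longrightarrow> x \<in> M n"
proof -
  assume x: "2 * x \<in> M n"
  then have "2 * x / 2 \<in> K" by (intro K_divide M_K K_numeral)
  then have xK: "x \<in> K" by simp
  show ?thesis using x v_mult[OF K_numeral xK, of "num.Bit0 num.One"] w_2 xK by (auto simp: M_def)
qed

context
  fixes A B :: rat
  assumes A: "A \<in> Q.M 0" and B: "B \<in> Q.M 0"
    and D: "4 * A ^ 3 + 27 * B\<^sup>2 \<noteq> 0" "padic_val p (4 * A ^ 3 + 27 * B\<^sup>2) = 0"
begin

abbreviation (input) kA :: 'k where "kA \<equiv> of_rat A"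
abbreviation (input) kB :: 'k where "kB \<equiv> of_rat B"

lemma M_of_rat: "r \<in> Q.M 0 \<Longrightarrow> of_rat r \<in> M 0"
  using w_of_rat[of r] by (auto simp: Q.M_def M_def K_Rats)

lemma D_of_rat: "4 * kA ^ 3 + 27 * kB\<^sup>2 = of_rat (4 * A ^ 3 + 27 * B\<^sup>2)"
  by (simp add: of_rat_add of_rat_mult of_rat_power)

lemma short_curve: "integral_short_curve K w kA kB"
proof (intro integral_short_curve.intro integral_short_curve_axioms.intro)
  show "subfield_valuation K w" by (rule subfield_valuation_axioms)
  show "kA \<in> M 0" "kB \<in> M 0" using A B by (auto intro: M_of_rat)
  show "4 * kA ^ 3 + 27 * kB\<^sup>2 \<noteq> 0" unfolding D_of_rat using D by simp
qed

interpretation C: integral_short_curve K w kA kB by (rule short_curve)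

text \<open>The hypotheses say that both partial derivatives of the curve vanish at the reduction of
  (x, y); then 4 A^3 + 27 B^2 cannot be a unit.\<close>

lemma no_singular_reduction:
  assumes c: "y\<^sup>2 = x ^ 3 + kA * x + kB" and x: "x \<in> M 0" and y: "y \<in> M 1" and e: "3 * x\<^sup>2 + kA \<in> M 1"
  shows False
proof -
  define e' where "e' = 3 * x\<^sup>2 + kA"
  define h where "h = y\<^sup>2 - e' * x"
  have kA: "kA = e' - 3 * x\<^sup>2" by (simp add: e'_def)
  have "kB = y\<^sup>2 - x ^ 3 - kA * x" using c by simp
  then have kB: "kB = h + 2 * x ^ 3" unfolding kA h_def by (simp add: algebra_simps eval_nat_numeral)
  have m: "a * b \<in> M 0" if "a \<in> M 0" "b \<in> M 0" for a b using M_mult[OF that] by simp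
  have pw: "a ^ n \<in> M 0" if "a \<in> M 0" for a n using M_power[OF that] by simp
  have e1: "e' \<in> M 1" using e by (simp add: e'_def)
  then have e0: "e' \<in> M 0" by (rule M_mono) simp
  have "y\<^sup>2 \<in> M 1" by (rule M_power[OF y]) simp
  moreover have "e' * x \<in> M 1" by (rule M_mult[OF e1 x]) simp
  ultimately have h1: "h \<in> M 1" unfolding h_def by (rule M_diff)
  then have h0: "h \<in> M 0" by (rule M_mono) simp
  \<comment> \<open>For e' = h = 0 one has A = - 3 x^2 and B = 2 x^3 and the expression vanishes, so
    it is a combination of e' and h.\<close>
  have "4 * kA ^ 3 + 27 * kB\<^sup>2 = e' * (4 * e'\<^sup>2 - 36 * e' * x\<^sup>2 + 108 * x ^ 4) + h * (27 * h + 108 * x ^ 3)"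
    unfolding kA kB by (simp add: algebra_simps eval_nat_numeral)
  also have "\<dots> \<in> M 1"
  proof (rule M_add)
    have "4 * e'\<^sup>2 - 36 * e' * x\<^sup>2 + 108 * x ^ 4 \<in> M 0" by (intro M_add M_diff m pw M_numeral e0 x)
    then show "e' * (4 * e'\<^sup>2 - 36 * e' * x\<^sup>2 + 108 * x ^ 4) \<in> M 1" by (rule M_mult[OF e1]) simp
    have "27 * h + 108 * x ^ 3 \<in> M 0" by (intro M_add m pw M_numeral h0 x)
    then show "h * (27 * h + 108 * x ^ 3) \<in> M 1" by (rule M_mult[OF h1]) simp
  qed
  finally have "of_rat (4 * A ^ 3 + 27 * B\<^sup>2) \<in> M 1" unfolding D_of_rat .
  then show False using D w_of_rat[OF D(1)] by (simp add: M_def)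
qed

text \<open>The addition formulas have rational coefficients, so they preserve K and commute with
  conjugation.\<close>

lemma conjugate_point_add:
  assumes "set_point P \<subseteq> K" "set_point Q \<subseteq> K"
  shows "set_point (point_add C.E P Q) \<subseteq> K"
    and "map_point conjugate (point_add C.E P Q) = point_add C.E (map_point conjugate P) (map_point conjugate Q)"
proof -
  have "set_point (point_add C.E P Q) \<subseteq> K \<and>
    map_point conjugate (point_add C.E P Q) = point_add C.E (map_point conjugate P) (map_point conjugate Q)"
  proof (cases P; cases Q)
    fix x1 y1 x2 y2 assume PQ: "P = Affine x1 y1" "Q = Affine x2 y2"
    then have K: "x1 \<in> K" "y1 \<in> K" "x2 \<in> K" "y2 \<in> K" using assms by auto
    have x: "conjugate x1 = conjugate x2 \<longleftrightarrow> x1 = x2" using K conjugate_eq_iff by blast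
    have opp: "conjugate y1 + conjugate y2 = 0 \<longleftrightarrow> y1 + y2 = 0"
      using conjugate_eq_iff[OF K_add[OF K(2,4)] K_0] K by (simp add: conjugate_add conjugate_0)
    show ?thesis
    proof (cases "x1 = x2 \<and> y1 + y2 = 0")
      case True
      then show ?thesis using opp PQ by simp
    next
      case False
      define l where "l = (if x1 = x2 then (3 * x1\<^sup>2 + kA) / (2 * y1) else (y2 - y1) / (x2 - x1))"
      have lK: "l \<in> K" using K by (auto simp: l_def intro!: K_intros)
      have cl: "conjugate l = (if conjugate x1 = conjugate x2 then (3 * (conjugate x1)\<^sup>2 + kA) / (2 * conjugate y1)
          else (conjugate y2 - conjugate y1) / (conjugate x2 - conjugate x1))"
        unfolding l_def x using K by (simp add: conjugate_hom K_intros)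
      define x3 where "x3 = l\<^sup>2 - x1 - x2"
      have x3K: "x3 \<in> K" using K lK by (auto simp: x3_def intro!: K_intros)
      have add: "point_add C.E P Q = Affine x3 (- (y1 + l * (x3 - x1)))"
        using False unfolding PQ by (auto simp: Let_def l_def x3_def)
      have cx3: "conjugate x3 = (conjugate l)\<^sup>2 - conjugate x1 - conjugate x2"
        using K lK by (simp add: x3_def conjugate_hom K_intros)
      have cadd: "point_add C.E (map_point conjugate P) (map_point conjugate Q) =
          Affine (conjugate x3) (- (conjugate y1 + conjugate l * (conjugate x3 - conjugate x1)))"
        using False x opp unfolding PQ cx3 cl by (auto simp: Let_def)
      show ?thesis unfolding add cadd using K lK x3K by (simp add: conjugate_hom K_intros)
    qed
  qed (use assms in auto)
  then show "set_point (point_add C.E P Q) \<subseteq> K"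
    and "map_point conjugate (point_add C.E P Q) = point_add C.E (map_point conjugate P) (map_point conjugate Q)"
    by auto
qed

lemma conjugate_torsion:
  assumes P: "P \<in> torsion C.G" "set_point P \<subseteq> K"
  shows "map_point conjugate P \<in> torsion C.G"
proof -
  obtain n :: nat where n: "n > 0" "P [^]\<^bsub>C.G\<^esub> n = Infinity" and c: "P \<in> carrier C.G"
    using P by (auto simp: torsion_def point_group_def)
  have "set_point (P [^]\<^bsub>C.G\<^esub> k) \<subseteq> K \<and> map_point conjugate (P [^]\<^bsub>C.G\<^esub> k) = map_point conjugate P [^]\<^bsub>C.G\<^esub> k" for k :: nat
  proof (induction k)
    case (Suc k)
    then show ?case unfolding point_group_pow(2) using conjugate_point_add[OF _ P(2)] by metis
  qed (simp add: point_group_def)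
  from this[of n] have "map_point conjugate P [^]\<^bsub>C.G\<^esub> n = Infinity" using n by simp
  moreover have "map_point conjugate P \<in> carrier C.G"
  proof (cases P)
    case (Affine x y)
    then have K: "x \<in> K" "y \<in> K" and cu: "y\<^sup>2 = x ^ 3 + kA * x + kB"
      using P(2) c by (auto simp: point_group_def on_curve_short)
    have "conjugate (y\<^sup>2) = conjugate (x ^ 3 + kA * x + kB)" using cu by simp
    then have "(conjugate y)\<^sup>2 = conjugate x ^ 3 + kA * conjugate x + kB"
      using K by (simp add: conjugate_hom K_intros)
    then show ?thesis using Affine by (auto simp: point_group_def on_curve_short)
  qed (simp add: point_group_def)
  ultimately show ?thesis using n(1) by (auto simp: torsion_def point_group_def)
qed

text \<open>By commutativity m n annihilates the difference if m and n annihilate P and Q.\<close>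

lemma torsion_diff:
  assumes P: "P \<in> torsion C.G" and Q: "Q \<in> torsion C.G"
  shows "point_add C.E P (point_neg Q) \<in> torsion C.G"
proof -
  have mult: "R \<otimes>\<^bsub>C.G\<^esub> S = point_add C.E R S" for R S by (simp add: point_group_def)
  have one: "\<one>\<^bsub>C.G\<^esub> = Infinity" by (simp add: point_group_def)
  obtain m n :: nat where mn: "m > 0" "P [^]\<^bsub>C.G\<^esub> m = \<one>\<^bsub>C.G\<^esub>" "n > 0" "Q [^]\<^bsub>C.G\<^esub> n = \<one>\<^bsub>C.G\<^esub>"
    and c: "P \<in> carrier C.G" "Q \<in> carrier C.G"
    using P Q by (auto simp: torsion_def)
  have nQ: "point_neg Q \<in> carrier C.G"
    using c(2) by (cases Q) (auto simp: point_group_def on_curve_short)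
  have "point_neg Q \<otimes>\<^bsub>C.G\<^esub> Q = \<one>\<^bsub>C.G\<^esub>" unfolding mult one by (cases Q) auto
  then have inv: "point_neg Q = inv\<^bsub>C.G\<^esub> Q" using C.G.inv_equality nQ c by metis
  have "(P \<otimes>\<^bsub>C.G\<^esub> point_neg Q) [^]\<^bsub>C.G\<^esub> (m * n) = P [^]\<^bsub>C.G\<^esub> (m * n) \<otimes>\<^bsub>C.G\<^esub> point_neg Q [^]\<^bsub>C.G\<^esub> (m * n)"
    by (rule C.G.pow_mult_distrib[OF C.G.m_comm[OF c(1) nQ] c(1) nQ])
  also have "P [^]\<^bsub>C.G\<^esub> (m * n) = \<one>\<^bsub>C.G\<^esub>" using C.G.nat_pow_pow[OF c(1), of m n] mn by simp
  also have "point_neg Q [^]\<^bsub>C.G\<^esub> (m * n) = inv\<^bsub>C.G\<^esub> (Q [^]\<^bsub>C.G\<^esub> (n * m))"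
    unfolding inv using C.G.nat_pow_inv[OF c(2), of "m * n"] by (simp add: mult.commute)
  also have "Q [^]\<^bsub>C.G\<^esub> (n * m) = \<one>\<^bsub>C.G\<^esub>" using C.G.nat_pow_pow[OF c(2), of n m] mn by simp
  finally have "(P \<otimes>\<^bsub>C.G\<^esub> point_neg Q) [^]\<^bsub>C.G\<^esub> (m * n) = \<one>\<^bsub>C.G\<^esub>" by simp
  moreover have "P \<otimes>\<^bsub>C.G\<^esub> point_neg Q \<in> carrier C.G" using c(1) nQ by (rule C.G.m_closed)
  moreover have "m * n > 0" using mn by simp
  ultimately show ?thesis unfolding torsion_def mult by blast
qed

theorem torsion_rational:
  assumes P: "Affine x y \<in> torsion C.G" and K: "x \<in> K" "y \<in> K"
  shows "x \<in> \<rat> \<and> y \<in> \<rat>"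
proof (rule ccontr)
  assume neg: "\<not> (x \<in> \<rat> \<and> y \<in> \<rat>)"
  have c: "on_curve C.E x y" using P by (auto simp: torsion_def point_group_def)
  then have cu: "y\<^sup>2 = x ^ 3 + kA * x + kB" by (simp add: on_curve_short)
  \<comment> \<open>A torsion point with non-integral abscissa would lie in the kernel of
    reduction.\<close>
  have no_kernel: "x' \<in> M 0" if t: "Affine x' y' \<in> torsion C.G" "x' \<in> K" "y' \<in> K" for x' y'
  proof (rule ccontr)
    assume "x' \<notin> M 0"
    have "on_curve C.E x' y'" using t by (auto simp: torsion_def point_group_def)
    then obtain n where "n \<ge> 1" "C.in_kernel n (Affine x' y')"
      by (rule C.nonintegral_in_kernel[OF _ t(2,3) \<open>x' \<notin> M 0\<close>])
    then show False using C.kernel_torsion_free[OF w_prime _ _ _] t(1) by blast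
  qed
  have x0: "x \<in> M 0" by (rule no_kernel[OF P K])
  define x' where "x' = conjugate x"
  define y' where "y' = conjugate y"
  have K': "x' \<in> K" "y' \<in> K" using K conjugate_K by (auto simp: x'_def y'_def)
  have "y\<^sup>2 \<in> M 0" unfolding cu using x0 C.A C.B by (auto intro!: M_add M_power M_mult)
  then have y0: "y \<in> M 0" using v_power[of y 2] K by (auto simp: M_def)
  have xx: "x - x' \<in> M 1" and yy: "y - y' \<in> M 1" and x'0: "x' \<in> M 0"
    using M_conjugate x0 y0 by (simp_all add: x'_def y'_def)
  have P': "Affine x' y' \<in> torsion C.G" using conjugate_torsion[OF P] K by (simp add: x'_def y'_def)
  have c': "on_curve C.E x' (- y')" using P' by (auto simp: torsion_def point_group_def on_curve_short)
  then have cu': "y'\<^sup>2 = x' ^ 3 + kA * x' + kB" by (simp add: on_curve_short)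
  have R: "point_add C.E (Affine x y) (Affine x' (- y')) \<in> torsion C.G"
    using torsion_diff[OF P P'] by simp
  have ne: "x \<noteq> x' \<or> y \<noteq> y'" using neg conjugate_fixed K unfolding x'_def y'_def by metis
  show False
  proof (cases rule: point_add_short_cases[OF c c', case_names opposite line])
    case opposite
    then show False using ne by simp
  next
    case (line l m x3)
    \<comment> \<open>The line passes through (x, y) and (x', - y').\<close>
    have lyy: "y + y' = l * (x - x')"
      using arg_cong2[OF line(2,3), of "(-)"] by (simp add: algebra_simps)
    have fyy: "(y - y') * (y + y') = (x - x') * (x\<^sup>2 + x * x' + x'\<^sup>2 + kA)"
    proof -
      have "(y - y') * (y + y') = y\<^sup>2 - y'\<^sup>2" by (simp add: algebra_simps power2_eq_square)
      then show ?thesis unfolding cu cu' by (simp add: algebra_simps eval_nat_numeral)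
    qed
    have lK: "l \<in> K"
    proof (cases "x = x'")
      case True
      then have tan: "y \<noteq> 0" "2 * y * l = 3 * x\<^sup>2 + kA" using line(4) by blast+
      have "l = (2 * y * l) / (2 * y)" using tan(1) by simp
      then have "l = (3 * x\<^sup>2 + kA) / (2 * y)" unfolding tan(2) .
      then show ?thesis using K by (auto intro!: K_intros)
    next
      case False
      then have "l = (y + y') / (x - x')" using lyy by simp
      then show ?thesis using K K' by (auto intro!: K_intros)
    qed
    \<comment> \<open>If l were integral, x - x' in (\<pi>) would force y and then 3 x^2 + A into
      (\<pi>), a singular reduction.\<close>
    have lM: "l \<notin> M 0"
    proof
      assume l: "l \<in> M 0"
      have "l * (x - x') \<in> M 1" by (rule M_mult[OF l xx]) simp
      then have "(y - y') + (y + y') \<in> M 1" unfolding lyy by (rule M_add[OF yy])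
      moreover have "(y - y') + (y + y') = 2 * y" by simp
      ultimately have y1: "y \<in> M 1" using M_half by metis
      have "3 * x\<^sup>2 + kA \<in> M 1"
      proof (cases "x = x'")
        case True
        have "2 * y * l \<in> M 1"
          by (rule M_mult[OF M_mult[OF M_numeral y1, of 1] l]) simp_all
        then show ?thesis using line(4)[OF True] by metis
      next
        case False
        have "(x - x') * ((y - y') * l) = (x - x') * (x\<^sup>2 + x * x' + x'\<^sup>2 + kA)"
          using fyy unfolding lyy by (simp add: algebra_simps)
        then have "(y - y') * l = x\<^sup>2 + x * x' + x'\<^sup>2 + kA" using False by simp
        moreover have "(y - y') * l \<in> M 1" by (rule M_mult[OF yy l]) simp
        \<comment> \<open>Adding (x - x')(2 x + x') turns x^2 + x x' + x'^2 into 3 x^2.\<close>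
        moreover have "2 * x + x' \<in> M 0" using x0 x'0 by (auto intro!: M_add M_mult[OF M_numeral])
        then have "(x - x') * (2 * x + x') \<in> M 1" by (rule M_mult[OF xx]) simp
        ultimately have "(x\<^sup>2 + x * x' + x'\<^sup>2 + kA) + (x - x') * (2 * x + x') \<in> M 1" using M_add by metis
        then show ?thesis by (simp add: algebra_simps power2_eq_square)
      qed
      then show False using no_singular_reduction[OF cu x0 y1] by blast
    qed
    have x3: "x3 = l\<^sup>2 - (x + x')" using line_meetsD(1)[OF line(1)] by (simp add: algebra_simps)
    have "x3 \<notin> M 0"
    proof
      assume "x3 \<in> M 0"
      then have "x3 + (x + x') \<in> M 0" using x0 x'0 by (intro M_add)
      then have "l\<^sup>2 \<in> M 0" by (simp add: x3)
      then show False using lM lK v_power[of l 2] by (auto simp: M_def)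
    qed
    moreover have mK: "m = y - l * x" using line(2) by simp
    have "x3 \<in> K" "- (l * x3 + m) \<in> K" unfolding mK x3 using K K' lK by (auto intro!: K_intros)
    ultimately show False using no_kernel R unfolding line(5) by blast
  qed
qed

end

end

text \<open>The change of variables to the short model has rational coefficients, so rationality of
  a point can be tested on its image.\<close>

theorem torsion_eq_of_good_reduction:
  fixes E :: "rat weierstrass" and K :: "'k::field_char_0 set" and p :: nat
  assumes K: "quadratic_field K" and prime_p: "Factorial_Ring.prime p" "p > 3"
    and ram: "ramifies_in p K" and good: "good_reduction p E"
  shows "E_tors E (\<rat> :: 'k set) = E_tors E K"
proof -
  obtain \<delta> d where sq: "sqrt_field K \<delta> d p" "padic_val p d = 1"
    using ramified_sqrt[OF K prime_p(1) _ ram] prime_p(2) by auto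
  interpret ramified_sqrt_field K \<delta> d p
    using sq by (simp add: ramified_sqrt_field_def ramified_sqrt_field_axioms_def)
  obtain u r s t A B where u: "u \<noteq> 0" "change_of_variables u r s t E = short_weierstrass A B"
    and AB: "A \<in> Q.M 0" "B \<in> Q.M 0" "4 * A ^ 3 + 27 * B\<^sup>2 \<noteq> 0" "padic_val p (4 * A ^ 3 + 27 * B\<^sup>2) = 0"
    using good_reduction_short_model[OF prime_p good] .
  let ?E = "base_change E :: 'k weierstrass"
  let ?u = "of_rat u :: 'k" and ?r = "of_rat r :: 'k" and ?s = "of_rat s :: 'k" and ?t = "of_rat t :: 'k"
  have u0: "?u \<noteq> 0" using u by simp
  have E': "change_of_variables ?u ?r ?s ?t ?E = short_weierstrass (of_rat A) (of_rat B)"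
    using u(2) base_change_change_of_variables[of u r s t E] base_change_short[of A B] by metis
  \<comment> \<open>Powers do not refer to the field, so the torsion over two fields differs only
    through the carriers.\<close>
  have pow: "P [^]\<^bsub>point_group ?E F\<^esub> (n::nat) = P [^]\<^bsub>point_group ?E F'\<^esub> n" for P n and F F' :: "'k set"
  proof (induction n)
    case (Suc n)
    then show ?case unfolding point_group_pow(2) by simp
  qed (simp add: point_group_def)
  have tors: "P \<in> E_tors E F \<longleftrightarrow> P \<in> carrier (point_group ?E F) \<and> (\<exists>n::nat. n > 0 \<and> P [^]\<^bsub>point_group ?E UNIV\<^esub> n = Infinity)" for P F
    using pow[where F = F and F' = UNIV] by (auto simp: E_tors_def torsion_def point_group_def)
  have carrier: "P \<in> carrier (point_group ?E \<rat>) \<longleftrightarrow> P \<in> carrier (point_group ?E K)" if "P \<in> E_tors E K" for P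
  proof (cases P)
    case (Affine x y)
    have "P \<in> carrier (point_group ?E K)" using that tors by blast
    then have xy: "x \<in> K" "y \<in> K" "on_curve ?E x y" using Affine by (auto simp: point_group_def)
    define x' where "x' = (x - ?r) / ?u\<^sup>2"
    define y' where "y' = (y - ?s * (x - ?r) - ?t) / ?u ^ 3"
    have "Affine x' y' \<in> torsion (point_group (short_weierstrass (of_rat A) (of_rat B)) UNIV)"
      using torsion_point_change[OF u0 E', of P K] that by (simp add: E_tors_def Affine x'_def y'_def)
    moreover have "x' \<in> K" "y' \<in> K" using xy by (auto simp: x'_def y'_def intro!: K_intros)
    ultimately have rat: "x' \<in> \<rat>" "y' \<in> \<rat>" using torsion_rational[OF AB] by blast+
    have x: "x = ?u\<^sup>2 * x' + ?r" and y: "y = ?u ^ 3 * y' + ?s * (x - ?r) + ?t"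
      using u0 by (simp_all add: x'_def y'_def)
    have "x \<in> \<rat>" unfolding x using rat by (auto intro!: Rats_add Rats_mult Rats_power)
    moreover from this have "y \<in> \<rat>" unfolding y using rat by (auto intro!: Rats_add Rats_mult Rats_power Rats_diff)
    ultimately show ?thesis using xy by (simp add: Affine point_group_def)
  qed (simp add: point_group_def)
  have "\<rat> \<subseteq> K" using K_Rats by (auto elim: Rats_cases)
  then have "carrier (point_group ?E \<rat>) \<subseteq> carrier (point_group ?E K)" by (auto simp: point_group_def)
  then show ?thesis using tors carrier by blast
qed

theorem theorem1p6:
  fixes E :: "rat weierstrass" and K :: "'k::field_char_0 set" and p :: nat
  assumes "elliptic_curve E"
    and "quadratic_field K"
    and "E_tors E (\<rat> :: 'k set) \<noteq> E_tors E K"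
    and "p \<in> {5, 7}"
    and "ramifies_in p K"
  shows "p dvd conductor E"
proof -
  have "Factorial_Ring.prime (5::nat)" "Factorial_Ring.prime (7::nat)" by simp_all
  then have p: "Factorial_Ring.prime p" "p > 3" using assms(4) by auto
  show ?thesis
    using prime_dvd_conductor[OF assms(1) p(1)] torsion_eq_of_good_reduction[OF assms(2) p assms(5)] assms(3) by blast
qed

end
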